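(* Let $n,d\ge1$. For generic $P\in\mathrm{PC}_{n,d}$ (i.e. there is a proper algebraic subset $A\subset\mathbb{R}^{nd}$ such that the following holds for all $P\in\mathrm{PC}_{n,d}\setminus A$): $P$ is locally identifiable up to isometry under Čech persistence if and only if the circumsphere framework $(H_P,P)$ is rigid.
   Context: Fix a field $\mathbb{F}$; homology is over $\mathbb{F}$. $\mathrm{PC}_{n,d}=\{(p_1,\dots,p_n)\in\mathbb{R}^{nd}: p_i\in\mathbb{R}^d,\ p_i\ne p_j \text{ for } i\neq j\}$ is the space of point clouds; $[n]=\{1,\dots,n\}$; $K(n)$ is the set of nonempty subsets (simplices) of $[n]$. For $\sigma=\{i_1,\dots,i_k\}\subseteq[n]$, $\sigma(P)=(p_{i_1},\dots,p_{i_k})$. Čech persistence: for $\sigma\in K(n)$ let $\rho_\sigma(P)$ be the minimal enclosing radius of $\sigma(P)$, i.e. the least $r$ such that some $q\in\mathbb{R}^d$ has $\|p_i-q\|\le r$ for all $i\in\sigma$. A barcode is a multiset of nonempty intervals in $\mathbb{R}$; a full barcode is a sequence of barcodes $D=(D_i)_{i\ge0}$. $\mathrm{PH}(P)=\mathrm{PH}^{\check{\mathrm C}}(P)=(D_i)_{i\ge0}$ is the full barcode where $D_i$ is the unique finite multiset of nonempty intervals with $\{H_i(\{\sigma\in K(n):\rho_\sigma(P)\le r\})\}_{r\in\mathbb{R}}\cong\bigoplus_{I\in D_i}\chi_I$ as persistence modules, $\chi_I$ being the interval module of $I$ (equivalently, the persistent homology of the filtration by unions of closed radius-$r$ balls about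 the $p_i$). Critical hypergraph: $\sigma\in K(n)$ is a critical simplex of $P$ if (1) $\rho_\sigma(P)$ is an endpoint of some interval in some $D_i$, and (2) $\rho_\tau(P)<\rho_\sigma(P)$ for every nonempty proper subset $\tau\subset\sigma$. $H_P$ is the hypergraph on vertex set $[n]$ whose hyperedges are the critical simplices of $P$ with at least two elements (all critical simplices have at most $d+1$ elements). Circumsphere rigidity: for a point cloud $R=(r_1,\dots,r_k)$, $\Lambda_R$ is the $k\times k$ matrix with entries $\|r_i-r_j\|^2$, and $\Delta_R=\begin{pmatrix}0&\theta^T\\ \theta&\Lambda_R\end{pmatrix}$ with $\theta$ the column vector of $k$ ones. A circumsphere framework is a pair $(H,P)$ with $P\in \mathrm{PC}_{n,d}$ and $H=([n],E)$ a hypergraph whose hyperedges each have between $2$ and $d+1$ elements. $(H,P)$ and $(H,Q)$ are equivalent if $\det\Delta_{\sigma(P)}\det\Lambda_{\sigma(Q)}=\det\Delta_{\sigma(Q)}\det\Lambda_{\sigma(P)}$ for all $\sigma\in E$. $P,Q$ are congruent if $\|p_i-p_j\|=\|q_i-q_j\|$ for all $i,j\in[n]$. $(H,P)$ is rigid if there is a neighborhood $U$ of $P$ such that every $Q\in U$ with $(H,Q)$ equivalent to $(H,P)$ is congruent to $P$. Local identifiability: $P,Q\in\mathrm{PC}_{n,d}$ are isometric if there is a permutation $f$ of $[n]$ with $\|p_i-p_j\|=\|q_{f(i)}-q_{f(j)}\|$ for all $i,j$. $P$ is locally identifiable up to isometry under Čech persistence if there is a neighborhood $U$ of $P$ in $\mathrm{PC}_{n,d}$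 such that every $Q\in U$ with $\mathrm{PH}(Q)=\mathrm{PH}(P)$ is isometric to $P$. *)

theory Defs
  imports "HOL-Analysis.Analysis" "HOL-Algebra.AbelCoset" "Jordan_Normal_Form.VS_Connect"
begin

no_notation Matrix.vec_index (infixl \<open>$\<close> 100)

section \<open>Point clouds and genericity\<close>

text \<open>
  The finite linearly ordered type \<open>'n\<close> plays the role of the vertex set \<open>{1, \<dots>, n}\<close>; the
  order is used only to orient simplices and to list the points of a subset.
\<close>

definition point_clouds :: "(real^'d^'n) set" where
  "point_clouds = {P. \<forall>i j. i \<noteq> j \<longrightarrow> P $ i \<noteq> P $ j}"

definition algebraic_set :: "'a::euclidean_space set \<Rightarrow> bool" where
  "algebraic_set A \<longleftrightarrow>
    (\<exists>S. (\<forall>f\<in>S. real_polynomial_function f) \<and> A = {x. \<forall>f\<in>S. f x = 0})"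


section \<open>Persistence modules over a field\<close>

text \<open>
  Vector spaces over the type-class field \<open>'f\<close> are modules over \<open>class_ring :: 'f ring\<close>; the
  ring operations \<open>mult\<close> and \<open>one\<close> that the record also carries are irrelevant.
\<close>

record ('f, 'v) persistence_module =
  pm_space :: "real \<Rightarrow> ('f, 'v) module"
  pm_map :: "real \<Rightarrow> real \<Rightarrow> 'v \<Rightarrow> 'v"  \<comment> \<open>\<open>pm_map M r s\<close> is meaningful for \<open>r \<le> s\<close>\<close>

definition pm_isomorphic ::
  "('f::field, 'v) persistence_module \<Rightarrow> ('f, 'w) persistence_module \<Rightarrow> bool" where
  "pm_isomorphic M N \<longleftrightarrow>
    (\<exists>\<phi>. (\<forall>r. \<phi> r \<in> module_hom class_ring (pm_space M r) (pm_space N r) \<and>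
              bij_betw (\<phi> r) (carrier (pm_space M r)) (carrier (pm_space N r))) \<and>
         (\<forall>r s. r \<le> s \<longrightarrow>
            (\<forall>x\<in>carrier (pm_space M r). \<phi> s (pm_map M r s x) = pm_map N r s (\<phi> r x))))"

definition interval_module :: "real set \<Rightarrow> ('f::field, 'f) persistence_module" where
  "interval_module I =
    \<lparr>pm_space = (\<lambda>r. \<lparr>carrier = (if r \<in> I then UNIV else {0}), mult = undefined, one = undefined,
                       zero = 0, add = (+), smult = (*)\<rparr>),
     pm_map = (\<lambda>r s x. if r \<in> I \<and> s \<in> I then x else 0)\<rparr>"

text \<open>Direct sums are needed only for finite index sets \<open>J\<close>, where they coincide with products.\<close>

definition pm_direct_sum ::
  "'j set \<Rightarrow> ('j \<Rightarrow> ('f, 'v) persistence_module) \<Rightarrow> ('f, 'j \<Rightarrow> 'v) persistence_module" where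
  "pm_direct_sum J M =
    \<lparr>pm_space = (\<lambda>r. \<lparr>carrier = (\<Pi>\<^sub>E j\<in>J. carrier (pm_space (M j) r)),
                       mult = undefined, one = undefined,
                       zero = (\<lambda>j\<in>J. \<zero>\<^bsub>pm_space (M j) r\<^esub>),
                       add = (\<lambda>x y. \<lambda>j\<in>J. x j \<oplus>\<^bsub>pm_space (M j) r\<^esub> y j),
                       smult = (\<lambda>a x. \<lambda>j\<in>J. a \<odot>\<^bsub>pm_space (M j) r\<^esub> x j)\<rparr>),
     pm_map = (\<lambda>r s x. \<lambda>j\<in>J. pm_map (M j) r s (x j))\<rparr>"

definition barcode :: "real set multiset \<Rightarrow> bool" where
  "barcode D \<longleftrightarrow> (\<forall>I\<in>#D. is_interval I \<and> I \<noteq> {})"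

definition barcode_module ::
  "real set multiset \<Rightarrow> ('f::field, real set \<times> nat \<Rightarrow> 'f) persistence_module" where
  "barcode_module D =
    pm_direct_sum {(I, k). k < count D I} (\<lambda>(I, k). interval_module I)"


section \<open>Simplicial homology over a field\<close>

definition chain_module :: "nat \<Rightarrow> 'n set set \<Rightarrow> ('f::field, 'n set \<Rightarrow> 'f) module" where
  "chain_module i K =
    \<lparr>carrier = {c. \<forall>\<sigma>. c \<sigma> \<noteq> 0 \<longrightarrow> \<sigma> \<in> K \<and> card \<sigma> = Suc i},
     mult = undefined, one = undefined,
     zero = (\<lambda>\<sigma>. 0), add = (\<lambda>b c \<sigma>. b \<sigma> + c \<sigma>), smult = (\<lambda>a c \<sigma>. a * c \<sigma>)\<rparr>"

text \<open>
  This is \<open>\<partial>[v\<^sub>0, \<dots>, v\<^sub>i] = \<Sum>\<^sub>k (-1)\<^sup>k [v\<^sub>0, \<dots>, v\<^sub>i] - {v\<^sub>k}\<close> for \<open>v\<^sub>0 < \<dots> < v\<^sub>i\<close>, read off at the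
  coefficient of \<open>\<tau>\<close>. Homology is unreduced, so the empty face is dropped.
\<close>

definition boundary :: "('n::{finite,linorder} set \<Rightarrow> 'f::field) \<Rightarrow> 'n set \<Rightarrow> 'f" where
  "boundary c \<tau> =
    (if \<tau> = {} then 0 else (\<Sum>v\<in>-\<tau>. (-1) ^ card {w\<in>\<tau>. w < v} * c (insert v \<tau>)))"

definition cycles :: "nat \<Rightarrow> 'n::{finite,linorder} set set \<Rightarrow> ('n set \<Rightarrow> 'f::field) set" where
  "cycles i K = {c \<in> carrier (chain_module i K). boundary c = (\<lambda>\<tau>. 0)}"

definition boundaries :: "nat \<Rightarrow> 'n::{finite,linorder} set set \<Rightarrow> ('n set \<Rightarrow> 'f::field) set" where
  "boundaries i K = boundary ` carrier (chain_module (Suc i) K)"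

definition quotient_module :: "('f, 'v) module \<Rightarrow> 'v set \<Rightarrow> ('f, 'v set) module" where
  "quotient_module M B =
    \<lparr>carrier = a_rcosets\<^bsub>M\<^esub> B, mult = undefined, one = undefined,
     zero = B, add = set_add M, smult = (\<lambda>a X. \<Union>x\<in>X. B +>\<^bsub>M\<^esub> (a \<odot>\<^bsub>M\<^esub> x))\<rparr>"

definition homology ::
  "nat \<Rightarrow> 'n::{finite,linorder} set set \<Rightarrow> ('f::field, ('n set \<Rightarrow> 'f) set) module" where
  "homology i K =
    quotient_module ((chain_module i K)\<lparr>carrier := cycles i K\<rparr>) (boundaries i K)"

text \<open>The map induced by an inclusion into \<open>L\<close> sends the class of a cycle to its class in \<open>L\<close>.\<close>

definition homology_map ::
  "nat \<Rightarrow> 'n::{finite,linorder} set set \<Rightarrow> ('n set \<Rightarrow> 'f::field) set \<Rightarrow> ('n set \<Rightarrow> 'f) set" where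
  "homology_map i L X = (\<Union>c\<in>X. boundaries i L +>\<^bsub>chain_module i L\<^esub> c)"


section \<open>Cech persistent homology\<close>

definition enclosing_radius :: "real^'d^'n \<Rightarrow> 'n set \<Rightarrow> real" where
  "enclosing_radius P \<sigma> = (LEAST r. \<exists>q. \<forall>i\<in>\<sigma>. norm (P $ i - q) \<le> r)"

definition cech_complex :: "real^'d^'n \<Rightarrow> real \<Rightarrow> 'n set set" where
  "cech_complex P r = {\<sigma>. \<sigma> \<noteq> {} \<and> enclosing_radius P \<sigma> \<le> r}"

definition cech_module ::
  "real^'d^('n::{finite,linorder}) \<Rightarrow> nat \<Rightarrow>
    ('f::field, ('n set \<Rightarrow> 'f) set) persistence_module" where
  "cech_module P i =
    \<lparr>pm_space = (\<lambda>r. homology i (cech_complex P r)),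
     pm_map = (\<lambda>r s. homology_map i (cech_complex P s))\<rparr>"

definition PH ::
  "'f::field itself \<Rightarrow> real^'d^('n::{finite,linorder}) \<Rightarrow> nat \<Rightarrow> real set multiset" where
  "PH F P i =
    (THE D. barcode D \<and>
      pm_isomorphic (cech_module P i :: ('f, ('n set \<Rightarrow> 'f) set) persistence_module)
        (barcode_module D))"


section \<open>The critical hypergraph\<close>

definition endpoint :: "real \<Rightarrow> real set \<Rightarrow> bool" where
  "endpoint x I \<longleftrightarrow> (bdd_below I \<and> x = Inf I) \<or> (bdd_above I \<and> x = Sup I)"

definition critical_simplex ::
  "'f::field itself \<Rightarrow> real^'d^('n::{finite,linorder}) \<Rightarrow> 'n set \<Rightarrow> bool" where
  "critical_simplex F P \<sigma> \<longleftrightarrow> \<sigma> \<noteq> {} \<and>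
    (\<exists>i. \<exists>I\<in>#PH F P i. endpoint (enclosing_radius P \<sigma>) I) \<and>
    (\<forall>\<tau>. \<tau> \<noteq> {} \<and> \<tau> \<subset> \<sigma> \<longrightarrow> enclosing_radius P \<tau> < enclosing_radius P \<sigma>)"

text \<open>A hypergraph on the vertex set \<open>UNIV :: 'n set\<close> is given by its set of hyperedges.\<close>

definition critical_hypergraph ::
  "'f::field itself \<Rightarrow> real^'d^('n::{finite,linorder}) \<Rightarrow> 'n set set" where
  "critical_hypergraph F P = {\<sigma>. critical_simplex F P \<sigma> \<and> 2 \<le> card \<sigma>}"


section \<open>Circumsphere rigidity\<close>

definition subcloud :: "'n set \<Rightarrow> real^'d^('n::{finite,linorder}) \<Rightarrow> (real^'d) list" where
  "subcloud \<sigma> P = map (\<lambda>i. P $ i) (sorted_list_of_set \<sigma>)"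

definition Lambda_mat :: "(real^'d) list \<Rightarrow> real mat" where
  "Lambda_mat R =
    Matrix.mat (length R) (length R) (\<lambda>(i, j). (norm (R ! i - R ! j))\<^sup>2)"

definition Delta_mat :: "(real^'d) list \<Rightarrow> real mat" where
  "Delta_mat R =
    four_block_mat (0\<^sub>m 1 1) (Matrix.mat 1 (length R) (\<lambda>_. 1))
      (Matrix.mat (length R) 1 (\<lambda>_. 1)) (Lambda_mat R)"

definition circumsphere_framework :: "'n set set \<Rightarrow> real^'d^'n \<Rightarrow> bool" where
  "circumsphere_framework E P \<longleftrightarrow>
    P \<in> point_clouds \<and> (\<forall>\<sigma>\<in>E. 2 \<le> card \<sigma> \<and> card \<sigma> \<le> CARD('d) + 1)"

definition framework_equivalent ::
  "'n set set \<Rightarrow> real^'d^('n::{finite,linorder}) \<Rightarrow> real^'d^('n::{finite,linorder}) \<Rightarrow> bool" where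
  "framework_equivalent E P Q \<longleftrightarrow>
    (\<forall>\<sigma>\<in>E.
      Determinant.det (Delta_mat (subcloud \<sigma> P)) * Determinant.det (Lambda_mat (subcloud \<sigma> Q)) =
      Determinant.det (Delta_mat (subcloud \<sigma> Q)) * Determinant.det (Lambda_mat (subcloud \<sigma> P)))"

definition congruent_clouds :: "real^'d^'n \<Rightarrow> real^'d^'n \<Rightarrow> bool" where
  "congruent_clouds P Q \<longleftrightarrow> (\<forall>i j. norm (P $ i - P $ j) = norm (Q $ i - Q $ j))"

definition rigid_framework ::
  "'n set set \<Rightarrow> real^'d^('n::{finite,linorder}) \<Rightarrow> bool" where
  "rigid_framework E P \<longleftrightarrow> circumsphere_framework E P \<and>
    (\<exists>U. openin (top_of_set point_clouds) U \<and> P \<in> U \<and>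
      (\<forall>Q\<in>U. framework_equivalent E P Q \<longrightarrow> congruent_clouds P Q))"


section \<open>Local identifiability\<close>

definition isometric_clouds :: "real^'d^'n \<Rightarrow> real^'d^'n \<Rightarrow> bool" where
  "isometric_clouds P Q \<longleftrightarrow>
    (\<exists>f. bij f \<and> (\<forall>i j. norm (P $ i - P $ j) = norm (Q $ f i - Q $ f j)))"

definition locally_identifiable ::
  "'f::field itself \<Rightarrow> real^'d^('n::{finite,linorder}) \<Rightarrow> bool" where
  "locally_identifiable F P \<longleftrightarrow>
    (\<exists>U. openin (top_of_set point_clouds) U \<and> P \<in> U \<and>
      (\<forall>Q\<in>U. PH F Q = PH F P \<longrightarrow> isometric_clouds P Q))"

end

theory Submission
  imports Defs "HOL-Library.Function_Algebras"
begin

text \<open>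
  The Cech complexes of a cloud \<open>P\<close> depend only on the radii \<open>\<rho>\<^sub>\<sigma>(P)\<close>, and which complexes occur, in
  which order, depends only on how these radii are ordered. Call clouds with the same order of radii
  order-equivalent (\<open>same_radius_order\<close>).

  The algebraic half of the proof describes the barcodes of all clouds order-equivalent to \<open>P\<close> at
  once. Cycles and boundaries form two chains of subspaces of the space of chains, and two chains of
  subspaces have a common adapted basis (\<open>common_adapted_basis\<close>). Each basis vector lives from the
  stage at which it becomes a cycle to the stage at which it becomes a boundary, and these lifetimes
  form an interval decomposition of persistent homology (\<open>filtration_module_decomposition\<close>); it is
  the only one, because the intervals can be recovered from the ranks of the structure maps
  (\<open>barcode_unique\<close>). Birth and death happen at radii of simplices, so a single list of pairs
  (birth simplex, death simplex) gives the barcodes of all clouds \<open>Q\<close> order-equivalent to \<open>P\<close>, by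
  inserting the radii of \<open>Q\<close> (\<open>PH_eq_simplex_bars\<close>). Hence \<open>PH(Q) = PH(P)\<close> holds if and only if
  \<open>\<rho>\<^sub>\<sigma>(Q) = \<rho>\<^sub>\<sigma>(P)\<close> for all critical \<open>\<sigma>\<close> of \<open>P\<close> (\<open>PH_eq_iff_critical_radii\<close>): an order isomorphism that
  maps the finite set of endpoints onto itself fixes every endpoint, and every endpoint is the radius
  of a critical simplex.

  The geometric half compares radii with determinants. If all proper faces of \<open>\<sigma>\<close> have smaller
  radius, then the smallest ball enclosing \<open>\<sigma>\<close> has all vertices of \<open>\<sigma>\<close> on its boundary and its centre
  in their convex hull, so that \<open>\<rho>\<^sub>\<sigma>\<close> is a circumradius and \<open>det \<Lambda> = -2 \<rho>\<^sub>\<sigma>\<^sup>2 det \<Delta>\<close>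
  (\<open>minimal_simplex_Lambda_det\<close>). Generic means: on simplices with \<open>2\<close> to \<open>d + 1\<close> vertices no \<open>det \<Delta>\<close>
  vanishes, and different simplices have different quotients \<open>det \<Lambda> / det \<Delta>\<close>. These are finitely many
  polynomial conditions, each of which some cloud satisfies, and the product of the polynomials
  defines the exceptional set. For generic \<open>P\<close> two simplices with equal positive radii share the face
  that determines this radius, and the equality persists near \<open>P\<close>; so all clouds near \<open>P\<close> are
  order-equivalent to \<open>P\<close> (\<open>eventually_same_radius_order\<close>). For these clouds, equivalence of
  frameworks on the critical hypergraph says that the critical radii agree, which by the algebraic
  half means that the barcodes agree. Finally, generic clouds have pairwise different distances, so
  that a cloud near \<open>P\<close> and isometric to \<open>P\<close> is congruent to \<open>P\<close>. Local identifiability and rigidity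
  thus make the same assertion about the clouds near \<open>P\<close>.
\<close>

no_notation Matrix.scalar_prod (infix \<open>\<bullet>\<close> 70)

section \<open>Bases adapted to two chains of subspaces\<close>

context vector_space begin

text \<open>
  A maximal independent subset of one stage extends to one of the next stage, and the part of the
  final basis that lies in an earlier stage still contains the subset chosen there.
\<close>

lemma independent_filtration_basis:
  fixes A :: "nat \<Rightarrow> 'b set"
  assumes "mono A"
  obtains S where "independent S" "S \<subseteq> A N" "\<And>j. j \<le> N \<Longrightarrow> A j \<subseteq> span (S \<inter> A j)"
proof -
  have "\<exists>S. independent S \<and> S \<subseteq> A N \<and> (\<forall>j\<le>N. A j \<subseteq> span (S \<inter> A j))"
  proof (induction N)
    case 0
    obtain B where "B \<subseteq> A 0" "independent B" "A 0 \<subseteq> span B"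
      using maximal_independent_subset by blast
    then show ?case by (intro exI[of _ B]) (auto simp: Int_absorb2)
  next
    case (Suc N)
    then obtain S where S: "independent S" "S \<subseteq> A N" "\<forall>j\<le>N. A j \<subseteq> span (S \<inter> A j)" by blast
    have "S \<subseteq> A (Suc N)" using S(2) monoD[OF assms, of N "Suc N"] by auto
    then obtain B where B: "S \<subseteq> B" "B \<subseteq> A (Suc N)" "independent B" "A (Suc N) \<subseteq> span B"
      using maximal_independent_subset_extend S(1) by blast
    have "A j \<subseteq> span (B \<inter> A j)" if "j \<le> Suc N" for j
    proof (cases "j = Suc N")
      case True then show ?thesis using B by (simp add: Int_absorb2)
    next
      case False
      then have "A j \<subseteq> span (S \<inter> A j)" using S(3) that by auto
      also have "\<dots> \<subseteq> span (B \<inter> A j)" by (intro span_mono) (use B in auto)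
      finally show ?thesis .
    qed
    then show ?case using B by blast
  qed
  then show ?thesis using that by blast
qed

text \<open>
  The number of members of a chain that miss a vector tells how late the vector enters the chain.
  This turns a chain of subspaces into a filtration indexed by natural numbers.
\<close>

lemma mem_chain_of_key_le:
  assumes fin: "finite \<C>" and chain: "\<And>X Y. X \<in> \<C> \<Longrightarrow> Y \<in> \<C> \<Longrightarrow> X \<subseteq> Y \<or> Y \<subseteq> X"
    and le: "card {C\<in>\<C>. x \<notin> C} \<le> card {C\<in>\<C>. z \<notin> C}" and C: "C \<in> \<C>" "z \<in> C"
  shows "x \<in> C"
proof (rule ccontr)
  assume "x \<notin> C"
  then have "{C\<in>\<C>. z \<notin> C} \<subset> {C\<in>\<C>. x \<notin> C}" using C chain by blast
  then have "card {C\<in>\<C>. z \<notin> C} < card {C\<in>\<C>. x \<notin> C}"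
    by (intro psubset_card_mono) (use fin in auto)
  then show False using le by simp
qed

lemma subspace_key_le:
  assumes fin: "finite \<C>" and chain: "\<And>X Y. X \<in> \<C> \<Longrightarrow> Y \<in> \<C> \<Longrightarrow> X \<subseteq> Y \<or> Y \<subseteq> X"
    and sub: "\<And>C. C \<in> \<C> \<Longrightarrow> subspace C"
  shows "subspace {x. card {C\<in>\<C>. x \<notin> C} \<le> m}"
proof (rule subspaceI)
  have "{C\<in>\<C>. 0 \<notin> C} = {}" using sub subspace_0 by auto
  then have "card {C\<in>\<C>. 0 \<notin> C} = 0" by (simp only: card.empty)
  then show "0 \<in> {x. card {C\<in>\<C>. x \<notin> C} \<le> m}" by (simp only: mem_Collect_eq le0)
next
  fix x y assume xy: "x \<in> {x. card {C\<in>\<C>. x \<notin> C} \<le> m}" "y \<in> {x. card {C\<in>\<C>. x \<notin> C} \<le> m}"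
  have "{C\<in>\<C>. x + y \<notin> C} \<subseteq> {C\<in>\<C>. x \<notin> C} \<or> {C\<in>\<C>. x + y \<notin> C} \<subseteq> {C\<in>\<C>. y \<notin> C}"
  proof (rule ccontr)
    assume "\<not> ?thesis"
    then obtain C C' where C: "C \<in> \<C>" "x + y \<notin> C" "x \<in> C" "C' \<in> \<C>" "x + y \<notin> C'" "y \<in> C'" by auto
    then have "x + y \<in> C \<or> x + y \<in> C'"
      using chain[of C C'] sub[of C] sub[of C'] subspace_add by blast
    then show False using C by blast
  qed
  then have "card {C\<in>\<C>. x + y \<notin> C} \<le> card {C\<in>\<C>. x \<notin> C} \<or> card {C\<in>\<C>. x + y \<notin> C} \<le> card {C\<in>\<C>. y \<notin> C}"
    using card_mono[of "{C\<in>\<C>. x \<notin> C}" "{C\<in>\<C>. x + y \<notin> C}"]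
      card_mono[of "{C\<in>\<C>. y \<notin> C}" "{C\<in>\<C>. x + y \<notin> C}"] fin by auto
  then show "x + y \<in> {x. card {C\<in>\<C>. x \<notin> C} \<le> m}" using xy by auto
next
  fix c x assume x: "x \<in> {x. card {C\<in>\<C>. x \<notin> C} \<le> m}"
  have "{C\<in>\<C>. scale c x \<notin> C} \<subseteq> {C\<in>\<C>. x \<notin> C}" using sub subspace_scale by blast
  then have "card {C\<in>\<C>. scale c x \<notin> C} \<le> card {C\<in>\<C>. x \<notin> C}" using fin by (intro card_mono) auto
  then show "scale c x \<in> {x. card {C\<in>\<C>. x \<notin> C} \<le> m}" using x by auto
qed

text \<open>
  Order the vectors by their level in \<open>\<B>\<close>, and within one level of \<open>\<B>\<close> by their level in \<open>\<Z>\<close>, and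
  choose a basis adapted to this refined filtration. It is adapted to \<open>\<B>\<close> because the filtration
  refines \<open>\<B>\<close>. For a vector \<open>z\<close> of \<open>Z \<in> \<Z>\<close> the basis vectors used in \<open>z\<close> that have the same level in \<open>\<B>\<close>
  as \<open>z\<close> enter \<open>\<Z>\<close> no later than \<open>z\<close>, so they lie in \<open>Z\<close>; what remains of \<open>z\<close> lies in \<open>Z\<close> and has a
  lower level in \<open>\<B>\<close>, and induction applies. (For two full flags this is the Bruhat decomposition.)
\<close>

proposition common_adapted_basis:
  assumes fin: "finite \<Z>" "finite \<B>"
    and chainZ: "\<And>X Y. X \<in> \<Z> \<Longrightarrow> Y \<in> \<Z> \<Longrightarrow> X \<subseteq> Y \<or> Y \<subseteq> X"
    and chainB: "\<And>X Y. X \<in> \<B> \<Longrightarrow> Y \<in> \<B> \<Longrightarrow> X \<subseteq> Y \<or> Y \<subseteq> X"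
    and subZ: "\<And>X. X \<in> \<Z> \<Longrightarrow> subspace X" and subB: "\<And>X. X \<in> \<B> \<Longrightarrow> subspace X"
  obtains S where "independent S" "\<And>X. X \<in> \<Z> \<union> \<B> \<Longrightarrow> X \<subseteq> span (S \<inter> X)"
proof -
  define ka where "ka x = card {C\<in>\<Z>. x \<notin> C}" for x
  define kb where "kb x = card {C\<in>\<B>. x \<notin> C}" for x
  define m where "m = card \<Z> + 1"
  \<comment> \<open>Since \<open>ka < m\<close>, comparing keys is comparing \<open>(kb, ka)\<close> lexicographically.\<close>
  define key where "key x = m * kb x + ka x" for x
  define N where "N = m * card \<B> + m"
  have ka_le: "ka x < m" for x
    unfolding ka_def m_def using card_mono[of \<Z> "{C\<in>\<Z>. x \<notin> C}"] fin by auto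
  have kb_le: "kb x \<le> card \<B>" for x
    unfolding kb_def using card_mono[of \<B> "{C\<in>\<B>. x \<notin> C}"] fin by auto
  have key_div: "key x div m = kb x" for x
    using ka_le[of x] by (auto simp: key_def)
  have key_N: "key x \<le> N" for x
    unfolding key_def N_def using ka_le[of x] kb_le[of x] by (intro add_mono) auto
  have lex: "kb x < kb z \<or> kb x = kb z \<and> ka x \<le> ka z" if "key x \<le> key z" for x z
  proof -
    have "kb x \<le> kb z" using div_le_mono[OF that, of m] by (simp add: key_div)
    then show ?thesis using that by (auto simp: key_def)
  qed
  have "mono (\<lambda>j. {x. key x \<le> j})" by (auto simp: mono_def)
  then obtain S where S: "independent S" "\<And>j. j \<le> N \<Longrightarrow> {x. key x \<le> j} \<subseteq> span (S \<inter> {x. key x \<le> j})"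
    using independent_filtration_basis[of "\<lambda>j. {x. key x \<le> j}" N] by metis
  have gen: "z \<in> span (S \<inter> {x. key x \<le> key z})" for z using S(2)[OF key_N[of z]] by auto
  have "z \<in> span (S \<inter> B)" if "B \<in> \<B>" "z \<in> B" for B z
  proof -
    have "S \<inter> {x. key x \<le> key z} \<subseteq> S \<inter> B"
      using lex mem_chain_of_key_le[OF fin(2) chainB, of _ z B] that
      by (force simp: kb_def)
    then show ?thesis using gen span_mono by blast
  qed
  moreover have "z \<in> Z \<longrightarrow> z \<in> span (S \<inter> Z)" if Z: "Z \<in> \<Z>" for Z z
  proof (induction "kb z" arbitrary: z rule: less_induct)
    case less
    show ?case
    proof
      assume z: "z \<in> Z"
      define T1 where "T1 = {s\<in>S. kb s < kb z}"
      define T2 where "T2 = {s\<in>S. kb s = kb z \<and> ka s \<le> ka z}"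
      have T2: "T2 \<subseteq> S \<inter> Z"
        using mem_chain_of_key_le[OF fin(1) chainZ, of _ z Z] Z z by (auto simp: T2_def ka_def)
      have "S \<inter> {x. key x \<le> key z} \<subseteq> T1 \<union> T2" using lex by (auto simp: T1_def T2_def)
      then have "z \<in> span (T1 \<union> T2)" using gen span_mono by blast
      then obtain x y where xy: "z = x + y" "x \<in> span T1" "y \<in> span T2" by (auto simp: span_Un)
      have y: "y \<in> span (S \<inter> Z)" using xy(3) T2 span_mono by blast
      then have "y \<in> Z" using span_minimal[of "S \<inter> Z" Z] subZ[OF Z] by auto
      then have x: "x \<in> Z" using subspace_diff[OF subZ[OF Z] z, of y] xy(1) by simp
      have "x \<in> span (S \<inter> Z)"
      proof (cases "kb z = 0")
        case True
        then have "T1 = {}" by (auto simp: T1_def)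
        then show ?thesis using xy(2) by (simp add: span_zero)
      next
        case False
        have "span T1 \<subseteq> {x. kb x \<le> kb z - 1}"
          unfolding kb_def using T1_def
          by (intro span_minimal subspace_key_le fin chainB subB) (auto simp: kb_def)
        then have "kb x < kb z" using xy(2) False by (auto simp: subset_iff) 
        then show ?thesis using less x by blast
      qed
      then show "z \<in> span (S \<inter> Z)" using y xy(1) span_add by blast
    qed
  qed
  ultimately show ?thesis using that[of S] S(1) by blast
qed

end

text \<open>
  Chains are functions on simplices, and elements of barcode modules are functions on intervals. For
  both, linear algebra takes place in spaces of all functions with pointwise operations.
\<close>

abbreviation fun_scale :: "'f::field \<Rightarrow> ('x \<Rightarrow> 'f) \<Rightarrow> 'x \<Rightarrow> 'f"
  where "fun_scale a c \<equiv> (\<lambda>x. a * c x)"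

interpretation fs: vector_space fun_scale
  by unfold_locales (auto simp: fun_eq_iff algebra_simps)

lemma sum_fun_apply: "(\<Sum>i\<in>A. f i) x = (\<Sum>i\<in>A. f i x)"
  for f :: "'i \<Rightarrow> 'x \<Rightarrow> 'f::comm_monoid_add"
  by (induction A rule: infinite_finite_induct) auto

lemma fun_in_span_unit_functions:
  fixes x :: "'x \<Rightarrow> 'f::field"
  assumes "finite A" "\<And>k. x k \<noteq> 0 \<Longrightarrow> k \<in> A"
  shows "x \<in> fs.span ((\<lambda>j k. if k = j then 1 else 0) ` A)"
proof -
  have "x = (\<Sum>j\<in>A. fun_scale (x j) (\<lambda>k. if k = j then 1 else 0))"
    using assms by (auto simp: fun_eq_iff sum_fun_apply if_distrib[of "\<lambda>t. _ * t"] cong: if_cong)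
  also have "\<dots> \<in> fs.span ((\<lambda>j k. if k = j then 1 else 0) ` A)"
    by (intro fs.span_sum fs.span_scale fs.span_base) auto
  finally show ?thesis .
qed

lemma finite_independent_functions:
  fixes S :: "('x::finite \<Rightarrow> 'f::field) set"
  assumes "fs.independent S" shows "finite S"
proof -
  have "S \<subseteq> fs.span ((\<lambda>j k. if k = j then 1 else 0) ` UNIV)"
    by (intro subsetI fun_in_span_unit_functions) auto
  then show ?thesis using fs.independent_span_bound[OF finite_imageI[OF finite] assms] by blast
qed

text \<open>
  Invariance of dimension. The hypotheses speak about functions with support in \<open>A\<close> only, but \<open>G\<close> is
  linear everywhere, which avoids a separate type for each coordinate space.
\<close>

lemma card_le_of_injective_linear:
  fixes G :: "('a \<Rightarrow> 'f::field) \<Rightarrow> ('b \<Rightarrow> 'f)"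
  assumes add: "\<And>x y. G (x + y) = G x + G y" and scale: "\<And>c x. G (fun_scale c x) = fun_scale c (G x)"
    and fin: "finite A" "finite B"
    and supp: "\<And>x k. (\<And>j. x j \<noteq> 0 \<Longrightarrow> j \<in> A) \<Longrightarrow> G x k \<noteq> 0 \<Longrightarrow> k \<in> B"
    and inj: "\<And>x. (\<And>j. x j \<noteq> 0 \<Longrightarrow> j \<in> A) \<Longrightarrow> G x = 0 \<Longrightarrow> x = 0"
  shows "card A \<le> card B"
proof -
  interpret p: vector_space_pair "fun_scale :: 'f \<Rightarrow> ('a \<Rightarrow> 'f) \<Rightarrow> _" "fun_scale :: 'f \<Rightarrow> ('b \<Rightarrow> 'f) \<Rightarrow> _"
    by unfold_locales
  have lin: "Vector_Spaces.linear fun_scale fun_scale G"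
    by unfold_locales (auto simp: add scale)
  interpret l: Vector_Spaces.linear "fun_scale :: 'f \<Rightarrow> ('a \<Rightarrow> 'f) \<Rightarrow> _" "fun_scale :: 'f \<Rightarrow> ('b \<Rightarrow> 'f) \<Rightarrow> _" G
    by (rule lin)
  define u :: "'a \<Rightarrow> 'a \<Rightarrow> 'f" where "u j = (\<lambda>k. if k = j then 1 else 0)" for j
  have inju: "inj_on u X" for X by (rule inj_onI) (auto simp: u_def fun_eq_iff split: if_splits)
  have supp_sub: "fs.subspace {x :: 'a \<Rightarrow> 'f. \<forall>j. x j \<noteq> 0 \<longrightarrow> j \<in> A}"
    by (rule fs.subspaceI) (auto, metis add.right_neutral)
  have sp: "fs.span (u ` A) \<subseteq> {x. \<forall>j. x j \<noteq> 0 \<longrightarrow> j \<in> A}"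
    by (intro fs.span_minimal supp_sub) (auto simp: u_def split: if_splits)
  have "fs.independent (u ` A)"
  proof (rule fs.independent_if_scalars_zero)
    fix f x assume "(\<Sum>x\<in>u ` A. fun_scale (f x) x) = 0" "x \<in> u ` A"
    then obtain j where j: "x = u j" "j \<in> A" by auto
    have "0 = (\<Sum>i\<in>A. fun_scale (f (u i)) (u i))"
      using \<open>_ = 0\<close> by (simp add: sum.reindex inju)
    then have "0 = (\<Sum>i\<in>A. f (u i) * u i j)" by (simp add: fun_eq_iff sum_fun_apply)
    also have "\<dots> = f (u j)" using j fin by (simp add: u_def if_distrib[of "\<lambda>t. _ * t"] cong: if_cong)
    finally show "f x = 0" using j by simp
  qed (use fin in auto)
  moreover have "inj_on G (fs.span (u ` A))"
    using inj sp by (auto simp: l.inj_on_iff_eq_0[OF fs.subspace_span])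
  ultimately have "fs.independent (G ` u ` A)"
    by (rule p.linear_independent_injective_image[OF lin])
  moreover have "G ` u ` A \<subseteq> fs.span ((\<lambda>j k. if k = j then 1 else 0) ` B)"
  proof clarify
    fix j assume j: "j \<in> A"
    have "\<And>i. u j i \<noteq> 0 \<Longrightarrow> i \<in> A" using j by (simp add: u_def split: if_splits)
    then show "G (u j) \<in> fs.span ((\<lambda>j k. if k = j then 1 else 0) ` B)"
      using supp[of "u j"] fin by (intro fun_in_span_unit_functions) blast+
  qed
  ultimately have "card (G ` u ` A) \<le> card ((\<lambda>j k. if k = j then 1 else 0 :: 'f) ` B)"
    using fs.independent_span_bound[of "(\<lambda>j k. if k = j then 1 else 0 :: 'f) ` B"] fin by auto
  also have "\<dots> \<le> card B" using fin by (simp add: card_image_le)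
  also have "card (G ` u ` A) = card A"
  proof (subst card_image)
    show "inj_on G (u ` A)" using \<open>inj_on G _\<close> by (rule inj_on_subset) (auto intro: fs.span_base)
  qed (simp add: card_image inju)
  finally show ?thesis .
qed

section \<open>Uniqueness of barcodes\<close>

text \<open>
  Remove the common intervals and suppose that something remains. Let \<open>I\<close> be maximal under inclusion
  among the remaining intervals, say on the left. No remaining interval on the right contains \<open>I\<close>, so
  each misses a point of \<open>I\<close>. The least and the greatest of these missed points form a pair \<open>r \<le> s\<close> in
  \<open>I\<close> that no remaining interval on the right contains, and the counts for this pair differ.
\<close>

lemma barcode_eq_of_rank:
  assumes bar: "barcode D" "barcode D'"
    and rank: "\<And>r s. r \<le> s \<Longrightarrow> size {#I\<in>#D. r \<in> I \<and> s \<in> I#} = size {#I\<in>#D'. r \<in> I \<and> s \<in> I#}"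
  shows "D = D'"
proof -
  have no_max: False
    if b: "barcode E" "barcode E'" and dis: "set_mset E \<inter> set_mset E' = {}"
      and rk: "\<And>r s. r \<le> s \<Longrightarrow> size {#I\<in>#E. r \<in> I \<and> s \<in> I#} = size {#I\<in>#E'. r \<in> I \<and> s \<in> I#}"
      and I: "I \<in># E" and mx: "\<And>J. J \<in># E + E' \<Longrightarrow> \<not> I \<subset> J" for E E' :: "real set multiset" and I
  proof -
    have "\<forall>J\<in>#E'. \<exists>x\<in>I. x \<notin> J" using mx I dis by fastforce
    then obtain x where x: "\<And>J. J \<in># E' \<Longrightarrow> x J \<in> I \<and> x J \<notin> J" by metis
    obtain y where y: "y \<in> I" using b(1) I by (auto simp: barcode_def)
    \<comment> \<open>The point \<open>y\<close> ensures that \<open>X\<close> is nonempty when nothing remains on the right.\<close>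
    define X where "X = insert y (x ` set_mset E')"
    have X: "finite X" "X \<noteq> {}" "X \<subseteq> I" using x y by (auto simp: X_def)
    have "Min X \<in> I" "Max X \<in> I" using X by (meson Max_in Min_in subset_iff)+
    moreover have le: "Min X \<le> Max X" using X by (meson Max_ge Min_in)
    ultimately have "I \<in># {#I\<in>#E. Min X \<in> I \<and> Max X \<in> I#}" using I by auto
    then have "size {#I\<in>#E. Min X \<in> I \<and> Max X \<in> I#} \<noteq> 0" by (metis empty_iff set_mset_empty size_eq_0_iff_empty)
    then have "{#I\<in>#E'. Min X \<in> I \<and> Max X \<in> I#} \<noteq> {#}" unfolding rk[OF le] by simp
    then obtain J where J: "J \<in># {#I\<in>#E'. Min X \<in> I \<and> Max X \<in> I#}" by blast
    then have J: "J \<in># E'" "Min X \<in> J" "Max X \<in> J" by auto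
    have "is_interval J" using b(2) J(1) by (auto simp: barcode_def)
    moreover have "x J \<in> X" using J(1) by (auto simp: X_def)
    then have "Min X \<le> x J" "x J \<le> Max X" using X(1) by auto
    ultimately have "x J \<in> J" using J by (meson mem_is_interval_1_I)
    then show False using x J(1) by blast
  qed
  define E where "E = D - D'"
  define E' where "E' = D' - D"
  have DE: "D = (D \<inter># D') + E" "D' = (D \<inter># D') + E'"
    by (auto simp: E_def E'_def multiset_eq_iff)
  have b: "barcode E" "barcode E'" using bar by (auto simp: barcode_def E_def E'_def dest: in_diffD)
  have dis: "set_mset E \<inter> set_mset E' = {}"
    by (auto simp: E_def E'_def in_diff_count)
  have rk: "size {#I\<in>#E. r \<in> I \<and> s \<in> I#} = size {#I\<in>#E'. r \<in> I \<and> s \<in> I#}" if "r \<le> s" for r s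
  proof -
    have "size (filter_mset P A) = size (filter_mset P B) + size (filter_mset P C)"
      if "A = B + C" for P and A B C :: "real set multiset"
      using that by simp
    from this[OF DE(1), of "\<lambda>I. r \<in> I \<and> s \<in> I"] this[OF DE(2), of "\<lambda>I. r \<in> I \<and> s \<in> I"]
    show ?thesis using rank[OF that] by linarith
  qed
  have "E + E' = {#}"
  proof (rule ccontr)
    assume "E + E' \<noteq> {#}"
    then have "set_mset (E + E') \<noteq> {}" by (metis set_mset_eq_empty_iff)
    then obtain I where I: "I \<in> set_mset (E + E')" "\<And>J. J \<in> set_mset (E + E') \<Longrightarrow> \<not> I \<subset> J"
      using finite_has_maximal[OF finite_set_mset, of "E + E'"] by auto
    then consider "I \<in># E" | "I \<in># E'" by auto
    then show False
    proof cases
      case 1 then show False using no_max[OF b dis rk _ I(2)] by simp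
    next
      case 2
      have "set_mset E' \<inter> set_mset E = {}" using dis by blast
      moreover have "\<not> I \<subset> J" if "J \<in># E' + E" for J using I(2)[of J] that by auto
      ultimately show False using no_max[OF b(2,1) _ rk[symmetric] 2] by blast
    qed
  qed
  then have "E = {#}" "E' = {#}" by simp_all
  from DE(1)[unfolded this add_0_right] DE(2)[unfolded this add_0_right] show ?thesis by (rule trans[OF _ sym])
qed

text \<open>The index set of the direct sum in \<open>barcode_module\<close>.\<close>

definition bars :: "real set multiset \<Rightarrow> (real set \<times> nat) set"
  where "bars D = {(I, k). k < count D I}"

lemma finite_bars: "finite (bars D)"
proof -
  have "bars D = (SIGMA I:set_mset D. {..<count D I})" by (auto simp: bars_def simp flip: count_greater_zero_iff)
  then show ?thesis by simp
qed

lemma card_bars: "card {j \<in> bars D. P (fst j)} = size {#I\<in>#D. P I#}"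
proof -
  have "{j \<in> bars D. P (fst j)} = (SIGMA I:set_mset (filter_mset P D). {..<count (filter_mset P D) I})"
    by (auto simp: bars_def simp flip: count_greater_zero_iff)
  then show ?thesis by (simp add: size_multiset_overloaded_eq)
qed

lemma barcode_module_space:
  "carrier (pm_space (barcode_module D) r) = (\<Pi>\<^sub>E j\<in>bars D. if r \<in> fst j then UNIV else {0})"
  "x \<oplus>\<^bsub>pm_space (barcode_module D) r\<^esub> y = (\<lambda>j\<in>bars D. x j + y j)"
  "a \<odot>\<^bsub>pm_space (barcode_module D) r\<^esub> x = (\<lambda>j\<in>bars D. a * x j)"
  "pm_map (barcode_module D) r s x = (\<lambda>j\<in>bars D. if r \<in> fst j \<and> s \<in> fst j then x j else 0)"
  by (auto simp: barcode_module_def pm_direct_sum_def interval_module_def bars_def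
      split_beta fun_eq_iff restrict_def PiE_iff extensional_def split: if_splits)

text \<open>
  The type of persistence modules does not force the operations to respect the carriers. This much of
  it makes the inverse of an isomorphism linear and natural.
\<close>

definition pm_closed :: "('f::field, 'v) persistence_module \<Rightarrow> bool" where
  "pm_closed M \<longleftrightarrow>
    (\<forall>r. \<forall>x\<in>carrier (pm_space M r). \<forall>y\<in>carrier (pm_space M r). x \<oplus>\<^bsub>pm_space M r\<^esub> y \<in> carrier (pm_space M r)) \<and>
    (\<forall>r a. \<forall>x\<in>carrier (pm_space M r). a \<odot>\<^bsub>pm_space M r\<^esub> x \<in> carrier (pm_space M r)) \<and>
    (\<forall>r s. r \<le> s \<longrightarrow> pm_map M r s ` carrier (pm_space M r) \<subseteq> carrier (pm_space M s))"

lemma pm_closedD: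
  assumes "pm_closed M"
  shows "x \<in> carrier (pm_space M r) \<Longrightarrow> y \<in> carrier (pm_space M r) \<Longrightarrow> x \<oplus>\<^bsub>pm_space M r\<^esub> y \<in> carrier (pm_space M r)"
    "x \<in> carrier (pm_space M r) \<Longrightarrow> a \<odot>\<^bsub>pm_space M r\<^esub> x \<in> carrier (pm_space M r)"
    "r \<le> s \<Longrightarrow> x \<in> carrier (pm_space M r) \<Longrightarrow> pm_map M r s x \<in> carrier (pm_space M s)"
  using assms unfolding pm_closed_def by blast+

text \<open>
  The number of intervals that contain \<open>r\<close> and \<open>s\<close> is the rank of the map from stage \<open>r\<close> to stage \<open>s\<close>.
  To compare two decompositions of \<open>M\<close>, go from the image of this map in the first one back to \<open>M\<close>
  and on to the second one. By naturality one lands in the image of the corresponding map, and the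
  passage is injective.
\<close>

lemma interval_rank_le:
  fixes M :: "('f::field, 'v) persistence_module" and D D' :: "real set multiset"
  assumes iso: "pm_isomorphic M (barcode_module D)" "pm_isomorphic M (barcode_module D')"
    and closed: "pm_closed M"
    and rs: "r \<le> s"
  shows "size {#I\<in>#D. r \<in> I \<and> s \<in> I#} \<le> size {#I\<in>#D'. r \<in> I \<and> s \<in> I#}"
proof -
  note add = pm_closedD(1)[OF closed] and smult = pm_closedD(2)[OF closed] and map = pm_closedD(3)[OF closed]
  let ?N = "barcode_module D :: ('f, real set \<times> nat \<Rightarrow> 'f) persistence_module"
  let ?N' = "barcode_module D' :: ('f, real set \<times> nat \<Rightarrow> 'f) persistence_module"
  obtain \<phi> where \<phi>: "\<And>r. \<phi> r \<in> module_hom class_ring (pm_space M r) (pm_space ?N r)"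
      "\<And>r. bij_betw (\<phi> r) (carrier (pm_space M r)) (carrier (pm_space ?N r))"
      "\<And>r s x. r \<le> s \<Longrightarrow> x \<in> carrier (pm_space M r) \<Longrightarrow> \<phi> s (pm_map M r s x) = pm_map ?N r s (\<phi> r x)"
    using iso(1) unfolding pm_isomorphic_def by blast
  obtain \<phi>' where \<phi>': "\<And>r. \<phi>' r \<in> module_hom class_ring (pm_space M r) (pm_space ?N' r)"
      "\<And>r. bij_betw (\<phi>' r) (carrier (pm_space M r)) (carrier (pm_space ?N' r))"
      "\<And>r s x. r \<le> s \<Longrightarrow> x \<in> carrier (pm_space M r) \<Longrightarrow> \<phi>' s (pm_map M r s x) = pm_map ?N' r s (\<phi>' r x)"
    using iso(2) unfolding pm_isomorphic_def by blast
  define \<psi> where "\<psi> r = inv_into (carrier (pm_space M r)) (\<phi> r)" for r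
  have \<psi>: "\<psi> r x \<in> carrier (pm_space M r)" "\<phi> r (\<psi> r x) = x" if "x \<in> carrier (pm_space ?N r)" for r x
    using that \<phi>(2)[of r] unfolding \<psi>_def bij_betw_def by (auto simp: inv_into_into f_inv_into_f)
  have \<psi>\<phi>: "\<psi> r (\<phi> r x) = x" if "x \<in> carrier (pm_space M r)" for r x
    using that \<phi>(2)[of r] unfolding \<psi>_def by (simp add: bij_betw_def)
  \<comment> \<open>The projection onto the image of the map from stage \<open>r\<close> to stage \<open>s\<close>; it has all functions as domain.\<close>
  define m where "m x = (\<lambda>j\<in>bars D. if r \<in> fst j \<and> s \<in> fst j then x j else 0)" for x :: "real set \<times> nat \<Rightarrow> 'f"
  have m_car: "m x \<in> carrier (pm_space ?N r)" "m x \<in> carrier (pm_space ?N s)" for x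
    by (auto simp: m_def barcode_module_space)
  have m_map: "pm_map ?N r s (m x) = m x" for x
    by (auto simp: m_def barcode_module_space fun_eq_iff restrict_def)
  have \<psi>m: "\<psi> s (m x) = pm_map M r s (\<psi> r (m x))" for x
  proof -
    have "\<phi> s (pm_map M r s (\<psi> r (m x))) = m x"
      by (simp add: \<phi>(3)[OF rs \<psi>(1)[OF m_car(1)]] \<psi>(2)[OF m_car(1)] m_map)
    then show ?thesis using \<psi>\<phi>[OF map[OF rs \<psi>(1)[OF m_car(1)]], of x] by simp
  qed
  have \<psi>_add: "\<psi> s (m (x + y)) = \<psi> s (m x) \<oplus>\<^bsub>pm_space M s\<^esub> \<psi> s (m y)" for x y
  proof -
    have "\<phi> s (\<psi> s (m x) \<oplus>\<^bsub>pm_space M s\<^esub> \<psi> s (m y)) = m x \<oplus>\<^bsub>pm_space ?N s\<^esub> m y"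
      by (simp add: LinearCombinations.module_hom_add[OF \<phi>(1)] \<psi> m_car)
    also have "\<dots> = m (x + y)" by (auto simp: barcode_module_space m_def fun_eq_iff)
    finally show ?thesis using \<psi>\<phi>[OF add[OF \<psi>(1)[OF m_car(2)] \<psi>(1)[OF m_car(2)]], of x y] by simp
  qed
  have \<psi>_scale: "\<psi> s (m (fun_scale c x)) = c \<odot>\<^bsub>pm_space M s\<^esub> \<psi> s (m x)" for c x
  proof -
    have "\<phi> s (c \<odot>\<^bsub>pm_space M s\<^esub> \<psi> s (m x)) = c \<odot>\<^bsub>pm_space ?N s\<^esub> m x"
      by (subst LinearCombinations.module_hom_smult[OF \<phi>(1)]) (auto simp: \<psi> m_car)
    also have "\<dots> = m (fun_scale c x)" by (auto simp: barcode_module_space m_def fun_eq_iff)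
    finally show ?thesis using \<psi>\<phi>[OF smult[OF \<psi>(1)[OF m_car(2)]], of c x] by simp
  qed
  \<comment> \<open>Outside the index set the elements of a direct sum are undefined, so they are cut off there.\<close>
  define G where "G x = (\<lambda>k. if k \<in> bars D' then \<phi>' s (\<psi> s (m x)) k else 0)" for x
  have G_add: "G (x + y) = G x + G y" for x y
  proof -
    have "\<phi>' s (\<psi> s (m (x + y))) = \<phi>' s (\<psi> s (m x)) \<oplus>\<^bsub>pm_space ?N' s\<^esub> \<phi>' s (\<psi> s (m y))"
      unfolding \<psi>_add by (intro LinearCombinations.module_hom_add[OF \<phi>'(1)] \<psi>(1) m_car)
    then show ?thesis unfolding barcode_module_space by (simp add: G_def fun_eq_iff)
  qed
  have G_scale: "G (fun_scale c x) = fun_scale c (G x)" for c x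
  proof -
    have "\<phi>' s (\<psi> s (m (fun_scale c x))) = c \<odot>\<^bsub>pm_space ?N' s\<^esub> \<phi>' s (\<psi> s (m x))"
      unfolding \<psi>_scale
      by (intro LinearCombinations.module_hom_smult[OF \<phi>'(1)] \<psi>(1) m_car) simp
    then show ?thesis unfolding barcode_module_space by (simp add: G_def fun_eq_iff)
  qed
  have "card {j \<in> bars D. r \<in> fst j \<and> s \<in> fst j} \<le> card {j \<in> bars D'. r \<in> fst j \<and> s \<in> fst j}"
  proof (rule card_le_of_injective_linear[of G])
    fix x k assume "G x k \<noteq> 0"
    then show "k \<in> {j \<in> bars D'. r \<in> fst j \<and> s \<in> fst j}"
      unfolding G_def \<psi>m \<phi>'(3)[OF rs \<psi>(1)[OF m_car(1)]] barcode_module_space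
      by (auto split: if_splits)
  next
    fix x assume supp: "\<And>j. x j \<noteq> 0 \<Longrightarrow> j \<in> {j \<in> bars D. r \<in> fst j \<and> s \<in> fst j}" and G0: "G x = 0"
    have "G 0 = 0" using G_add[of 0 0] by (simp only: add_0_left add_cancel_right_right)
    have car: "\<phi>' s (\<psi> s (m y)) \<in> carrier (pm_space ?N' s)" for y
      using module_hom_closed[OF \<phi>'(1)] \<psi>(1)[OF m_car(2)] by blast
    have "\<phi>' s (\<psi> s (m x)) = \<phi>' s (\<psi> s (m 0))"
    proof (rule PiE_ext[OF car[unfolded barcode_module_space(1)] car[unfolded barcode_module_space(1)]])
      fix k assume "k \<in> bars D'"
      then show "\<phi>' s (\<psi> s (m x)) k = \<phi>' s (\<psi> s (m 0)) k"
        using fun_cong[OF trans[OF G0 \<open>G 0 = 0\<close>[symmetric]], of k] by (simp only: G_def if_True)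
    qed
    then have "\<psi> s (m x) = \<psi> s (m 0)"
      by (rule inj_onD[OF bij_betw_imp_inj_on[OF \<phi>'(2)[of s]]]) (intro \<psi>(1) m_car)+
    moreover have "\<phi> s (\<psi> s (m y)) = m y" for y by (rule \<psi>(2)[OF m_car(2)])
    ultimately have "m x = m 0" by metis
    show "x = 0"
    proof
      fix j
      show "x j = 0 j"
      proof (rule ccontr)
        assume "x j \<noteq> 0 j"
        moreover from this have "j \<in> {j \<in> bars D. r \<in> fst j \<and> s \<in> fst j}" by (intro supp) simp
        ultimately show False using fun_cong[OF \<open>m x = m 0\<close>, of j] by (simp add: m_def)
      qed
    qed
  next
    show "finite {j \<in> bars D. r \<in> fst j \<and> s \<in> fst j}" "finite {j \<in> bars D'. r \<in> fst j \<and> s \<in> fst j}"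
      by (rule finite_subset[OF _ finite_bars], blast)+
  qed (rule G_add G_scale)+
  then show ?thesis
    using card_bars[of D "\<lambda>I. r \<in> I \<and> s \<in> I"] card_bars[of D' "\<lambda>I. r \<in> I \<and> s \<in> I"] by linarith
qed

theorem barcode_unique:
  fixes M :: "('f::field, 'v) persistence_module"
  assumes "barcode D" "barcode D'" "pm_isomorphic M (barcode_module D)" "pm_isomorphic M (barcode_module D')"
    and "pm_closed M"
  shows "D = D'"
proof (rule barcode_eq_of_rank[OF assms(1,2)])
  fix r s :: real assume "r \<le> s"
  note le = interval_rank_le[OF _ _ assms(5) \<open>r \<le> s\<close>]
  show "size {#I\<in>#D. r \<in> I \<and> s \<in> I#} = size {#I\<in>#D'. r \<in> I \<and> s \<in> I#}"
    by (rule antisym[OF le[OF assms(3,4)] le[OF assms(4,3)]])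
qed

section \<open>Interval decomposition of the homology of a filtration\<close>

text \<open>
  The Cech module is the special case of the complexes \<open>cech_complex P r\<close>. The decomposition is
  independent of where the filtration comes from.
\<close>

definition filtration_module ::
  "nat \<Rightarrow> (real \<Rightarrow> 'n::{finite,linorder} set set) \<Rightarrow> ('f::field, ('n set \<Rightarrow> 'f) set) persistence_module" where
  "filtration_module i K =
    \<lparr>pm_space = (\<lambda>r. homology i (K r)), pm_map = (\<lambda>r s. homology_map i (K s))\<rparr>"

lemma boundary_add: "boundary (b + c) = boundary b + boundary c"
  by (auto simp: boundary_def fun_eq_iff algebra_simps sum.distrib)

lemma boundary_scale: "boundary (fun_scale a c) = fun_scale a (boundary c)"
  by (auto simp: boundary_def fun_eq_iff algebra_simps sum_distrib_left)

lemma subspace_chains: "fs.subspace (carrier (chain_module i K))"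
  by (rule fs.subspaceI) (auto simp: chain_module_def, (metis add.right_neutral)+)

lemma subspace_cycles: "fs.subspace (cycles i K)"
proof -
  have "boundary 0 = (\<lambda>\<tau>. 0)" by (auto simp: boundary_def)
  then show ?thesis
    using subspace_chains[of i K]
    by (auto simp: cycles_def fs.subspace_def boundary_add boundary_scale fun_eq_iff)
qed

lemma subspace_boundaries: "fs.subspace (boundaries i K)"
proof -
  have "boundary 0 = 0" by (auto simp: boundary_def)
  then show ?thesis
    using subspace_chains[of "Suc i" K] unfolding fs.subspace_def boundaries_def
    by (auto simp: image_iff simp flip: boundary_add boundary_scale)
qed

lemma cycles_mono: "K \<subseteq> L \<Longrightarrow> cycles i K \<subseteq> cycles i L"
  by (auto simp: cycles_def chain_module_def)

lemma boundaries_mono: "K \<subseteq> L \<Longrightarrow> boundaries i K \<subseteq> boundaries i L"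
  by (auto simp: boundaries_def chain_module_def)

definition coset :: "('x \<Rightarrow> 'f::field) set \<Rightarrow> ('x \<Rightarrow> 'f) \<Rightarrow> ('x \<Rightarrow> 'f) set"
  where "coset B c = {b + c | b. b \<in> B}"

text \<open>
  Homology classes are translates of the space of boundaries. The operations of the quotient module
  are unfolded into plain set operations, which the lemmas below evaluate on translates.
\<close>

lemma homology_simps:
  "carrier (homology i K) = coset (boundaries i K) ` cycles i K"
  "X \<oplus>\<^bsub>homology i K\<^esub> Y = {x + y | x y. x \<in> X \<and> y \<in> Y}"
  "a \<odot>\<^bsub>homology i K\<^esub> X = (\<Union>x\<in>X. coset (boundaries i K) (fun_scale a x))"
  "homology_map i K X = (\<Union>c\<in>X. coset (boundaries i K) c)"
  by (auto simp: homology_def quotient_module_def coset_def A_RCOSETS_def RCOSETS_def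
      a_r_coset_def r_coset_def set_add_def set_mult_def chain_module_def homology_map_def plus_fun_def image_iff)

lemma coset_eq_iff:
  assumes "fs.subspace B" shows "coset B c = coset B c' \<longleftrightarrow> c - c' \<in> B"
proof
  assume "coset B c = coset B c'"
  moreover have "c \<in> coset B c" using fs.subspace_0[OF assms] by (force simp: coset_def)
  ultimately show "c - c' \<in> B" by (auto simp: coset_def)
next
  assume d: "c - c' \<in> B"
  have "b + c = (b + (c - c')) + c'" "b + c' = (b - (c - c')) + c" for b by auto
  then show "coset B c = coset B c'"
    using fs.subspace_add[OF assms _ d] fs.subspace_diff[OF assms _ d] unfolding coset_def by blast
qed

lemma coset_add:
  assumes "fs.subspace B" shows "{x + y | x y. x \<in> coset B c \<and> y \<in> coset B c'} = coset B (c + c')"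
proof (intro equalityI subsetI)
  fix z assume "z \<in> {x + y | x y. x \<in> coset B c \<and> y \<in> coset B c'}"
  then obtain b b' where "z = (b + c) + (b' + c')" "b \<in> B" "b' \<in> B" by (auto simp: coset_def)
  then have "z = (b + b') + (c + c')" "b + b' \<in> B" using fs.subspace_add[OF assms] by auto
  then show "z \<in> coset B (c + c')" by (auto simp: coset_def)
next
  fix z assume "z \<in> coset B (c + c')"
  then obtain b where "z = (b + c) + (0 + c')" "b \<in> B" by (auto simp: coset_def add.assoc)
  then show "z \<in> {x + y | x y. x \<in> coset B c \<and> y \<in> coset B c'}"
    using fs.subspace_0[OF assms] unfolding coset_def by blast
qed

lemma coset_scale:
  assumes "fs.subspace B" shows "(\<Union>x\<in>coset B c. coset B (fun_scale a x)) = coset B (fun_scale a c)"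
proof -
  have "coset B (fun_scale a (b + c)) = coset B (fun_scale a c)" if "b \<in> B" for b
  proof -
    have "fun_scale a (b + c) - fun_scale a c = fun_scale a b" by (auto simp: fun_eq_iff algebra_simps)
    then show ?thesis using fs.subspace_scale[OF assms that, of a] by (simp add: coset_eq_iff[OF assms])
  qed
  then show ?thesis using fs.subspace_0[OF assms] by (auto simp: coset_def[of B c])
qed

lemma coset_map:
  assumes "fs.subspace B" "fs.subspace B'" "B \<subseteq> B'" shows "(\<Union>x\<in>coset B c. coset B' x) = coset B' c"
proof -
  have "coset B' (b + c) = coset B' c" if "b \<in> B" for b
    using assms that by (auto simp: coset_eq_iff)
  then show ?thesis using fs.subspace_0[OF assms(1)] by (auto simp: coset_def[of B c])
qed

lemma pm_closed_filtration_module: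
  fixes K :: "real \<Rightarrow> 'n::{finite,linorder} set set"
  assumes "mono K"
  shows "pm_closed (filtration_module i K :: ('f::field, ('n set \<Rightarrow> 'f) set) persistence_module)"
proof -
  let ?Z = "\<lambda>r. cycles i (K r) :: ('n set \<Rightarrow> 'f) set" and ?B = "\<lambda>r. boundaries i (K r) :: ('n set \<Rightarrow> 'f) set"
  have "{x + y | x y. x \<in> coset (?B r) c \<and> y \<in> coset (?B r) c'} \<in> coset (?B r) ` ?Z r"
    if "c \<in> ?Z r" "c' \<in> ?Z r" for r c c'
    using fs.subspace_add[OF subspace_cycles that] by (simp add: coset_add[OF subspace_boundaries])
  moreover have "(\<Union>x\<in>coset (?B r) c. coset (?B r) (fun_scale a x)) \<in> coset (?B r) ` ?Z r"
    if "c \<in> ?Z r" for r a c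
    using fs.subspace_scale[OF subspace_cycles that] by (simp add: coset_scale[OF subspace_boundaries])
  moreover have "(\<Union>x\<in>coset (?B r) c. coset (?B s) x) \<in> coset (?B s) ` ?Z s"
    if "c \<in> ?Z r" "r \<le> s" for r s c
  proof -
    have "K r \<subseteq> K s" using monoD[OF assms that(2)] by simp
    then have "(\<Union>x\<in>coset (?B r) c. coset (?B s) x) = coset (?B s) c" "c \<in> ?Z s"
      using coset_map[OF subspace_boundaries subspace_boundaries boundaries_mono] cycles_mono that(1)
      by blast+
    then show ?thesis by simp
  qed
  ultimately show ?thesis
    unfolding pm_closed_def by (simp add: filtration_module_def homology_simps image_subset_iff)
qed

text \<open>
  The index set numbers the copies of an interval \<open>I\<close>; the elements that \<open>f\<close> maps to \<open>I\<close> are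
  enumerated accordingly.
\<close>

lemma bars_image_mset_mset_set:
  assumes "finite S"
  obtains \<beta> where "bij_betw \<beta> (bars (image_mset f (mset_set S))) S"
    "\<And>j. j \<in> bars (image_mset f (mset_set S)) \<Longrightarrow> f (\<beta> j) = fst j"
proof -
  let ?D = "image_mset f (mset_set S)"
  have cnt: "count ?D I = card {s\<in>S. f s = I}" for I
    using assms by (simp add: count_image_mset vimage_def Int_def conj_commute)
  have "\<exists>g. bij_betw g {..<card {s\<in>S. f s = I}} {s\<in>S. f s = I}" for I
    using assms by (intro finite_same_card_bij) auto
  then obtain g where g: "\<And>I. bij_betw (g I) {..<card {s\<in>S. f s = I}} {s\<in>S. f s = I}" by metis
  define \<beta> where "\<beta> = (\<lambda>(I, k). g I k)"
  have gI: "g I k \<in> S \<and> f (g I k) = I" if "k < card {s\<in>S. f s = I}" for I k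
    using bij_betwE[OF g[of I]] that by blast
  have "inj_on \<beta> (bars ?D)"
  proof (rule inj_onI)
    fix x y assume xy: "x \<in> bars ?D" "y \<in> bars ?D" "\<beta> x = \<beta> y"
    obtain I k J l where [simp]: "x = (I, k)" "y = (J, l)" by (metis surj_pair)
    have kl: "k < card {s\<in>S. f s = I}" "l < card {s\<in>S. f s = J}" using xy by (auto simp: bars_def cnt)
    then have "I = J" using gI[OF kl(1)] gI[OF kl(2)] xy(3) by (auto simp: \<beta>_def)
    then show "x = y" using bij_betw_imp_inj_on[OF g[of I]] kl xy(3) by (auto simp: \<beta>_def inj_on_def)
  qed
  moreover have "\<beta> ` bars ?D = S"
  proof (intro equalityI subsetI)
    fix s assume "s \<in> \<beta> ` bars ?D"
    then show "s \<in> S" using gI by (auto simp: bars_def \<beta>_def cnt)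
  next
    fix s assume "s \<in> S"
    then have "s \<in> g (f s) ` {..<card {t\<in>S. f t = f s}}" using g[of "f s"] by (auto simp: bij_betw_def)
    then obtain k where "k < card {t\<in>S. f t = f s}" "s = g (f s) k" by auto
    then show "s \<in> \<beta> ` bars ?D" by (intro image_eqI[of _ _ "(f s, k)"]) (auto simp: \<beta>_def bars_def cnt)
  qed
  moreover have "f (\<beta> j) = fst j" if "j \<in> bars ?D" for j
    using that gI by (auto simp: bars_def \<beta>_def cnt)
  ultimately show ?thesis using that by (auto simp: bij_betw_def)
qed

lemma (in vector_space) representation_eq_0_outside:
  assumes "independent S" "T \<subseteq> S" "v \<in> span T" "s \<notin> T"
  shows "representation S v s = 0"
proof -
  have "representation S v = representation T v" by (rule representation_extend) (use assms in auto)
  then show ?thesis using representation_ne_zero[of T v s] assms(4) by auto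
qed

text \<open>
  For a vector of an adapted basis this is the lifetime of its homology class.
\<close>

definition bar :: "nat \<Rightarrow> (real \<Rightarrow> 'n::{finite,linorder} set set) \<Rightarrow> ('n set \<Rightarrow> 'f::field) \<Rightarrow> real set"
  where "bar i K s = {r. s \<in> cycles i (K r) \<and> s \<notin> boundaries i (K r)}"

text \<open>
  At stage \<open>r\<close> the cycles are spanned by the basis vectors that are cycles, and the boundaries by those
  that are boundaries. So the class of a cycle is determined by its coefficients at the basis vectors
  that are cycles and not boundaries, and these coefficients are arbitrary. Such basis vectors are
  exactly those whose bar contains \<open>r\<close>, which identifies homology at stage \<open>r\<close> with stage \<open>r\<close> of the
  barcode module.
\<close>

theorem filtration_module_decomposition:
  fixes K :: "real \<Rightarrow> 'n::{finite,linorder} set set" and S :: "('n set \<Rightarrow> 'f::field) set"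
  assumes mono: "mono K" and ind: "fs.independent S"
    and Z: "\<And>r. cycles i (K r) \<subseteq> fs.span (S \<inter> cycles i (K r))"
    and B: "\<And>r. boundaries i (K r) \<subseteq> fs.span (S \<inter> boundaries i (K r))"
  defines "D \<equiv> image_mset (bar i K) (mset_set {s\<in>S. bar i K s \<noteq> {}})"
  shows "barcode D"
    and "pm_isomorphic (filtration_module i K :: ('f, ('n set \<Rightarrow> 'f) set) persistence_module) (barcode_module D)"
proof -
  define S' where "S' = {s\<in>S. bar i K s \<noteq> {}}"
  have fin: "finite S'" using finite_independent_functions[OF ind] by (simp add: S'_def)
  have Kmono: "K r \<subseteq> K s" if "r \<le> s" for r s using monoD[OF mono that] .
  have "is_interval (bar i K s)" for s :: "'n set \<Rightarrow> 'f"
    unfolding is_interval_1 bar_def using cycles_mono[OF Kmono] boundaries_mono[OF Kmono] by blast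
  then show "barcode D" using fin by (auto simp: barcode_def D_def S'_def[symmetric]) (auto simp: S'_def)
  obtain \<beta> where \<beta>: "bij_betw \<beta> (bars D) S'" "\<And>j. j \<in> bars D \<Longrightarrow> bar i K (\<beta> j) = fst j"
    using bars_image_mset_mset_set[OF fin, of "bar i K"] unfolding D_def S'_def[symmetric] by blast
  have \<beta>S: "\<beta> j \<in> S" if "j \<in> bars D" for j using \<beta>(1) that by (auto simp: bij_betw_def S'_def)
  let ?M = "filtration_module i K :: ('f, ('n set \<Rightarrow> 'f) set) persistence_module"
  let ?N = "barcode_module D :: ('f, real set \<times> nat \<Rightarrow> 'f) persistence_module"
  let ?Z = "\<lambda>r. cycles i (K r) :: ('n set \<Rightarrow> 'f) set" and ?B = "\<lambda>r. boundaries i (K r) :: ('n set \<Rightarrow> 'f) set"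
  have Zspan: "c \<in> fs.span S" if "c \<in> ?Z r" for c r using Z that fs.span_mono[of "S \<inter> ?Z r" S] by blast
  have Bspan: "c \<in> fs.span S" if "c \<in> ?B r" for c r using B that fs.span_mono[of "S \<inter> ?B r" S] by blast
  \<comment> \<open>The coefficients that survive at stage \<open>r\<close>. They do not change when a boundary is added, so any
    representative of a class gives the same result.\<close>
  define \<pi> where "\<pi> r c = (\<lambda>j\<in>bars D. if r \<in> fst j then fs.representation S c (\<beta> j) else 0)" for r c
  have \<pi>_coset: "\<pi> r (SOME x. x \<in> coset (?B r) c) = \<pi> r c" if c: "c \<in> ?Z r" for r c
  proof -
    have "c \<in> coset (?B r) c" using fs.subspace_0[OF subspace_boundaries] by (force simp: coset_def)
    then have "(SOME x. x \<in> coset (?B r) c) \<in> coset (?B r) c"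
      by (rule someI[where P = "\<lambda>x. x \<in> coset (?B r) c"])
    then obtain b where b: "(SOME x. x \<in> coset (?B r) c) = b + c" "b \<in> ?B r" by (auto simp: coset_def)
    have "fs.representation S (b + c) (\<beta> j) = fs.representation S c (\<beta> j)" if j: "j \<in> bars D" "r \<in> fst j" for j
    proof -
      have "\<beta> j \<notin> ?B r" using \<beta>(2)[OF j(1)] j(2) by (auto simp: bar_def)
      then have "fs.representation S b (\<beta> j) = 0"
        using fs.representation_eq_0_outside[OF ind, of "S \<inter> ?B r" b] B b(2) by blast
      then show ?thesis by (simp add: fs.representation_add[OF ind Zspan[OF c] Bspan[OF b(2)]])
    qed
    then show ?thesis unfolding b(1) by (auto simp: \<pi>_def fun_eq_iff)
  qed
  define \<phi> where "\<phi> r X = \<pi> r (SOME x. x \<in> X)" for r X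
  have \<phi>: "\<phi> r (coset (?B r) c) = \<pi> r c" if "c \<in> ?Z r" for r c using \<pi>_coset[OF that] by (simp add: \<phi>_def)
  have M: "carrier (pm_space ?M r) = coset (?B r) ` ?Z r" for r by (simp add: filtration_module_def homology_simps)
  have \<pi>_car: "\<pi> r c \<in> carrier (pm_space ?N r)" for r c by (auto simp: \<pi>_def barcode_module_space)
  have inj: "coset (?B r) c = coset (?B r) c'" if c: "c \<in> ?Z r" "c' \<in> ?Z r" and eq: "\<pi> r c = \<pi> r c'" for r c c'
  proof -
    define v where "v = c - c'"
    have v: "v \<in> ?Z r" unfolding v_def by (rule fs.subspace_diff[OF subspace_cycles c])
    have supp: "s \<in> ?B r" if s: "fs.representation S v s \<noteq> 0" for s
    proof (rule ccontr)
      assume nB: "s \<notin> ?B r"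
      have sZ: "s \<in> S \<inter> ?Z r"
        using fs.representation_eq_0_outside[OF ind, of "S \<inter> ?Z r" v s] Z v s by blast
      then have "s \<in> S'" "r \<in> bar i K s" using nB by (auto simp: S'_def bar_def)
      then obtain j where j: "j \<in> bars D" "s = \<beta> j" using \<beta>(1) by (auto simp: bij_betw_def)
      then have "r \<in> fst j" using \<beta>(2) \<open>r \<in> bar i K s\<close> by auto
      then have "fs.representation S c s = fs.representation S c' s"
        using fun_cong[OF eq, of j] j by (simp add: \<pi>_def)
      then show False using s by (simp add: v_def fs.representation_diff[OF ind Zspan[OF c(2)] Zspan[OF c(1)]])
    qed
    have "v = (\<Sum>s | fs.representation S v s \<noteq> 0. fun_scale (fs.representation S v s) s)"
      using fs.sum_nonzero_representation_eq[OF ind Zspan[OF v]] by simp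
    also have "\<dots> \<in> ?B r"
      by (intro fs.subspace_sum[OF subspace_boundaries] fs.subspace_scale[OF subspace_boundaries]) (use supp in auto)
    finally show ?thesis by (simp add: coset_eq_iff[OF subspace_boundaries] v_def)
  qed
  have surj: "\<exists>c\<in>?Z r. \<pi> r c = x" if x: "x \<in> carrier (pm_space ?N r)" for r x
  proof -
    define J where "J = {j\<in>bars D. r \<in> fst j}"
    define c where "c = (\<Sum>j\<in>J. fun_scale (x j) (\<beta> j))"
    have J: "finite J" "J \<subseteq> bars D" using finite_bars by (auto simp: J_def)
    have "\<beta> j \<in> ?Z r" if "j \<in> J" for j using that \<beta>(2)[of j] by (auto simp: J_def bar_def)
    then have cZ: "c \<in> ?Z r"
      unfolding c_def by (intro fs.subspace_sum[OF subspace_cycles] fs.subspace_scale[OF subspace_cycles])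
    have "fs.representation S c (\<beta> k) = x k" if k: "k \<in> J" for k
    proof -
      have "fs.representation S c (\<beta> k) = (\<Sum>j\<in>J. fs.representation S (fun_scale (x j) (\<beta> j)) (\<beta> k))"
      proof -
        have "fun_scale (x j) (\<beta> j) \<in> fs.span S" if "j \<in> J" for j
          using that \<beta>S[of j] J by (intro fs.span_scale fs.span_base) auto
        then show ?thesis unfolding c_def by (subst fs.representation_sum[OF ind]) auto
      qed
      also have "\<dots> = (\<Sum>j\<in>J. if j = k then x j else 0)"
      proof (rule sum.cong[OF refl])
        fix j assume j: "j \<in> J"
        have "\<beta> j = \<beta> k \<longleftrightarrow> j = k" using \<beta>(1) J j k by (auto simp: bij_betw_def inj_on_def)
        then show "fs.representation S (fun_scale (x j) (\<beta> j)) (\<beta> k) = (if j = k then x j else 0)"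
          using fs.representation_scale[OF ind fs.span_base[OF \<beta>S[of j]], of "x j"]
            fs.representation_basis[OF ind \<beta>S[of j]] J j by auto
      qed
      also have "\<dots> = x k" using J k by simp
      finally show ?thesis .
    qed
    then have "\<pi> r c = x"
      using x by (fastforce simp: \<pi>_def J_def fun_eq_iff barcode_module_space PiE_iff extensional_def split: if_splits)
    then show ?thesis using cZ by blast
  qed
  have "\<phi> r \<in> module_hom class_ring (pm_space ?M r) (pm_space ?N r)" for r
  proof -
    have "\<pi> r (c + c') = \<pi> r c \<oplus>\<^bsub>pm_space ?N r\<^esub> \<pi> r c'" if "c \<in> ?Z r" "c' \<in> ?Z r" for c c'
      using fs.representation_add[OF ind Zspan[OF that(2)] Zspan[OF that(1)]]
      by (auto simp: \<pi>_def barcode_module_space fun_eq_iff)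
    moreover have "\<pi> r (fun_scale a c) = a \<odot>\<^bsub>pm_space ?N r\<^esub> \<pi> r c" if "c \<in> ?Z r" for a c
      using fs.representation_scale[OF ind Zspan[OF that]]
      by (auto simp: \<pi>_def barcode_module_space fun_eq_iff)
    ultimately show ?thesis
      unfolding module_hom_def
      by (auto simp: M \<phi> \<pi>_car filtration_module_def homology_simps coset_add[OF subspace_boundaries]
          coset_scale[OF subspace_boundaries] fs.subspace_add[OF subspace_cycles] fs.subspace_scale[OF subspace_cycles])
  qed
  moreover have "bij_betw (\<phi> r) (carrier (pm_space ?M r)) (carrier (pm_space ?N r))" for r
    unfolding bij_betw_def
  proof
    show "inj_on (\<phi> r) (carrier (pm_space ?M r))"
    proof (rule inj_onI)
      fix X Y assume XY: "X \<in> carrier (pm_space ?M r)" "Y \<in> carrier (pm_space ?M r)" "\<phi> r X = \<phi> r Y"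
      then obtain c c' where c: "X = coset (?B r) c" "Y = coset (?B r) c'" "c \<in> ?Z r" "c' \<in> ?Z r"
        by (auto simp: M)
      then have "\<pi> r c = \<pi> r c'" using XY(3) by (simp add: \<phi>)
      then show "X = Y" using inj c by blast
    qed
    show "\<phi> r ` carrier (pm_space ?M r) = carrier (pm_space ?N r)"
    proof (intro equalityI subsetI)
      fix x assume "x \<in> \<phi> r ` carrier (pm_space ?M r)"
      then show "x \<in> carrier (pm_space ?N r)" by (auto simp: M \<phi> \<pi>_car)
    next
      fix x assume "x \<in> carrier (pm_space ?N r)"
      then obtain c where "c \<in> ?Z r" "\<pi> r c = x" using surj by blast
      then show "x \<in> \<phi> r ` carrier (pm_space ?M r)" unfolding M image_image by (intro image_eqI[of _ _ c]) (auto simp: \<phi>)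
    qed
  qed
  moreover have "\<phi> s (pm_map ?M r s X) = pm_map ?N r s (\<phi> r X)" if rs: "r \<le> s" and X: "X \<in> carrier (pm_space ?M r)" for r s X
  proof -
    obtain c where c: "X = coset (?B r) c" "c \<in> ?Z r" using X by (auto simp: M)
    have cs: "c \<in> ?Z s" using cycles_mono[OF Kmono[OF rs]] c(2) by blast
    have "pm_map ?M r s X = coset (?B s) c"
      by (simp add: filtration_module_def homology_simps c coset_map[OF subspace_boundaries subspace_boundaries boundaries_mono[OF Kmono[OF rs]]])
    then have "\<phi> s (pm_map ?M r s X) = \<pi> s c" by (simp add: \<phi>[OF cs])
    also have "\<dots> = pm_map ?N r s (\<pi> r c)"
    proof -
      have "fs.representation S c (\<beta> j) = 0" if j: "j \<in> bars D" "s \<in> fst j" "r \<notin> fst j" for j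
      proof -
        have "\<beta> j \<notin> ?B s" using \<beta>(2)[OF j(1)] j(2) by (auto simp: bar_def)
        then have "\<beta> j \<notin> ?B r" using boundaries_mono[OF Kmono[OF rs]] by blast
        then have "\<beta> j \<notin> ?Z r" using \<beta>(2)[OF j(1)] j(3) by (auto simp: bar_def)
        then show ?thesis
          using fs.representation_eq_0_outside[OF ind, of "S \<inter> ?Z r" c] Z c(2) by blast
      qed
      then show ?thesis by (auto simp: \<pi>_def barcode_module_space fun_eq_iff)
    qed
    finally show ?thesis by (simp add: c \<phi>)
  qed
  ultimately show "pm_isomorphic ?M ?N" unfolding pm_isomorphic_def by blast
qed

section \<open>Minimal enclosing balls\<close>

text \<open>
  The largest distance from a point \<open>q\<close> to the points of \<open>\<sigma>\<close> is continuous in \<open>q\<close>, and it has a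
  minimum: a point far away from some point of \<open>\<sigma>\<close> is a worse centre than that point itself.
\<close>

lemma enclosing_radius_is_least:
  fixes P :: "real^'d^'n"
  assumes "\<sigma> \<noteq> {}"
  shows "(\<exists>q. \<forall>i\<in>\<sigma>. norm (P $ i - q) \<le> enclosing_radius P \<sigma>) \<and>
    (\<forall>q r. (\<forall>i\<in>\<sigma>. norm (P $ i - q) \<le> r) \<longrightarrow> enclosing_radius P \<sigma> \<le> r)"
proof -
  have fin: "finite \<sigma>" by simp
  define m where "m q = Max ((\<lambda>i. norm (P $ i - q)) ` \<sigma>)" for q
  have m_le: "m q \<le> r \<longleftrightarrow> (\<forall>i\<in>\<sigma>. norm (P $ i - q) \<le> r)" for q r
    using assms fin by (simp add: m_def)
  have cont: "continuous_on A m" for A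
  proof -
    have "continuous_on A (\<lambda>q. Max ((\<lambda>i. norm (P $ i - q)) ` \<sigma>))"
      using fin assms
    proof (induction \<sigma> rule: finite_ne_induct)
      case (singleton i)
      then show ?case by (auto intro!: continuous_intros)
    next
      case (insert i \<tau>)
      then have "(\<lambda>q. Max ((\<lambda>i. norm (P $ i - q)) ` insert i \<tau>)) =
          (\<lambda>q. max (norm (P $ i - q)) (Max ((\<lambda>i. norm (P $ i - q)) ` \<tau>)))"
        by (simp add: fun_eq_iff)
      then show ?case using insert by (auto intro!: continuous_intros)
    qed
    then show ?thesis by (simp add: m_def[abs_def])
  qed
  obtain i where i: "i \<in> \<sigma>" using assms by auto
  define R where "R = m (P $ i)"
  have "m (P $ i) \<le> R" by (simp add: R_def)
  then have "norm (P $ i - P $ i) \<le> R" using i m_le by blast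
  then have "cball (P $ i) R \<noteq> {}" by simp
  then obtain q where q: "\<And>y. y \<in> cball (P $ i) R \<Longrightarrow> m q \<le> m y"
    using continuous_attains_inf[OF compact_cball _ cont, of "P $ i" R] by blast
  have min: "m q \<le> m y" for y
  proof (cases "y \<in> cball (P $ i) R")
    case False
    then have "R < norm (P $ i - y)" by (simp add: dist_norm)
    also have "\<dots> \<le> m y" using m_le i by blast
    also have "m q \<le> R" unfolding R_def by (rule q) (use \<open>cball _ _ \<noteq> {}\<close> in simp)
    ultimately show ?thesis by simp
  qed (use q in blast)
  have "enclosing_radius P \<sigma> = m q"
    unfolding enclosing_radius_def
  proof (rule Least_equality)
    show "\<exists>q'. \<forall>i\<in>\<sigma>. norm (P $ i - q') \<le> m q" using m_le by blast
    show "m q \<le> r" if "\<exists>q'. \<forall>i\<in>\<sigma>. norm (P $ i - q') \<le> r" for r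
      using that min m_le order_trans by blast
  qed
  show ?thesis
  proof (intro conjI allI impI)
    show "\<exists>q. \<forall>i\<in>\<sigma>. norm (P $ i - q) \<le> enclosing_radius P \<sigma>"
      using m_le[of q "m q"] \<open>_ = m q\<close> by auto
    fix q' r assume "\<forall>i\<in>\<sigma>. norm (P $ i - q') \<le> r"
    then have "m q' \<le> r" unfolding m_le by simp
    with min[of q'] show "enclosing_radius P \<sigma> \<le> r" unfolding \<open>_ = m q\<close> by (rule order_trans)
  qed
qed

lemma enclosing_radius_attained:
  assumes "\<sigma> \<noteq> {}"
  obtains q where "\<And>i. i \<in> \<sigma> \<Longrightarrow> norm (P $ i - q) \<le> enclosing_radius P \<sigma>"
  using enclosing_radius_is_least[OF assms, of P] by blast

lemma enclosing_radius_le: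
  assumes "\<sigma> \<noteq> {}" "\<And>i. i \<in> \<sigma> \<Longrightarrow> norm (P $ i - q) \<le> r"
  shows "enclosing_radius P \<sigma> \<le> r"
  by (rule enclosing_radius_is_least[OF assms(1), THEN conjunct2, rule_format, of P q r]) (rule assms(2))

lemma enclosing_radius_nonneg:
  assumes "\<sigma> \<noteq> {}" shows "0 \<le> enclosing_radius P \<sigma>"
proof -
  obtain q where q: "\<And>i. i \<in> \<sigma> \<Longrightarrow> norm (P $ i - q) \<le> enclosing_radius P \<sigma>"
    using enclosing_radius_attained[OF assms, of P] by blast
  obtain i where "i \<in> \<sigma>" using assms by blast
  then show ?thesis using order_trans[OF norm_ge_zero q] by simp
qed

lemma enclosing_radius_mono:
  assumes "\<tau> \<noteq> {}" "\<tau> \<subseteq> \<sigma>"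
  shows "enclosing_radius P \<tau> \<le> enclosing_radius P \<sigma>"
proof -
  obtain q where "\<And>i. i \<in> \<sigma> \<Longrightarrow> norm (P $ i - q) \<le> enclosing_radius P \<sigma>"
    using enclosing_radius_attained[of \<sigma> P] assms by blast
  then show ?thesis using assms by (intro enclosing_radius_le) auto
qed

lemma enclosing_radius_singleton: "enclosing_radius P {i} = 0"
  by (intro antisym enclosing_radius_nonneg enclosing_radius_le[of _ _ "P $ i"]) auto

lemma enclosing_radius_pos:
  assumes "P \<in> point_clouds" "2 \<le> card \<sigma>"
  shows "0 < enclosing_radius P \<sigma>"
proof -
  obtain i j where ij: "i \<in> \<sigma>" "j \<in> \<sigma>" "i \<noteq> j"
    using assms(2) by (metis card_le_Suc0_iff_eq finite_code not_less_eq_eq numeral_2_eq_2)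
  then obtain q where q: "\<And>i. i \<in> \<sigma> \<Longrightarrow> norm (P $ i - q) \<le> enclosing_radius P \<sigma>"
    using enclosing_radius_attained[of \<sigma> P] by blast
  have "0 < norm (P $ i - P $ j)" using assms(1) ij by (auto simp: point_clouds_def)
  also have "\<dots> \<le> norm (P $ i - q) + norm (P $ j - q)"
    using norm_triangle_ineq4[of "P $ i - q" "P $ j - q"] by simp
  also have "\<dots> \<le> 2 * enclosing_radius P \<sigma>" using q[OF ij(1)] q[OF ij(2)] by simp
  finally show ?thesis by simp
qed

text \<open>
  A centre for one cloud is a centre for the other if the radius grows by the displacement.
\<close>

lemma enclosing_radius_lipschitz:
  fixes P Q :: "real^'d^'n"
  assumes "\<sigma> \<noteq> {}"
  shows "\<bar>enclosing_radius Q \<sigma> - enclosing_radius P \<sigma>\<bar> \<le> norm (Q - P)"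
proof -
  have *: "enclosing_radius Q \<sigma> \<le> enclosing_radius P \<sigma> + norm (Q - P)" for P Q :: "real^'d^'n"
  proof -
    obtain q where q: "\<And>i. i \<in> \<sigma> \<Longrightarrow> norm (P $ i - q) \<le> enclosing_radius P \<sigma>"
      using enclosing_radius_attained[OF assms, of P] by blast
    have "norm (Q $ i - q) \<le> enclosing_radius P \<sigma> + norm (Q - P)" if "i \<in> \<sigma>" for i
    proof -
      have "norm (Q $ i - q) \<le> norm (P $ i - q) + norm (Q $ i - P $ i)"
        using norm_triangle_ineq[of "P $ i - q" "Q $ i - P $ i"] by simp
      moreover have "norm (Q $ i - P $ i) \<le> norm (Q - P)"
        using Finite_Cartesian_Product.norm_nth_le[of "Q - P" i] by simp
      ultimately show ?thesis using q[OF that] by linarith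
    qed
    then show ?thesis by (rule enclosing_radius_le[OF assms])
  qed
  from *[of Q P] *[of P Q] show ?thesis by (simp add: norm_minus_commute abs_le_iff)
qed

lemma continuous_enclosing_radius:
  fixes \<sigma> :: "'n::finite set"
  assumes "\<sigma> \<noteq> {}"
  shows "continuous_on A (\<lambda>P :: real^'d^'n. enclosing_radius P \<sigma>)"
proof -
  have "1-lipschitz_on A (\<lambda>P :: real^'d^'n. enclosing_radius P \<sigma>)"
  proof (rule lipschitz_onI)
    fix P Q :: "real^'d^'n"
    show "dist (enclosing_radius P \<sigma>) (enclosing_radius Q \<sigma>) \<le> 1 * dist P Q"
      using enclosing_radius_lipschitz[OF assms, of P Q] by (simp add: dist_norm)
  qed simp
  then show ?thesis by (rule lipschitz_on_continuous_on)
qed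

text \<open>
  The second condition in the definition of a critical simplex.
\<close>

definition minimal_simplex :: "real^'d^'n \<Rightarrow> 'n set \<Rightarrow> bool" where
  "minimal_simplex P \<sigma> \<longleftrightarrow> \<sigma> \<noteq> {} \<and>
    (\<forall>\<tau>. \<tau> \<noteq> {} \<and> \<tau> \<subset> \<sigma> \<longrightarrow> enclosing_radius P \<tau> < enclosing_radius P \<sigma>)"

lemma minimal_face:
  fixes P :: "real^'d^'n::finite"
  assumes "\<sigma> \<noteq> {}"
  obtains \<tau> where "\<tau> \<subseteq> \<sigma>" "minimal_simplex P \<tau>" "enclosing_radius P \<tau> = enclosing_radius P \<sigma>"
proof -
  define X where "X = {\<tau>. \<tau> \<noteq> {} \<and> \<tau> \<subseteq> \<sigma> \<and> enclosing_radius P \<tau> = enclosing_radius P \<sigma>}"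
  have "finite X" "\<sigma> \<in> X" using assms by (auto simp: X_def)
  from finite_has_minimal2[OF this]
  obtain \<tau> where \<tau>: "\<tau> \<in> X" "\<And>\<tau>'. \<tau>' \<in> X \<Longrightarrow> \<tau>' \<subseteq> \<tau> \<Longrightarrow> \<tau> = \<tau>'" by blast
  have "enclosing_radius P \<tau>' < enclosing_radius P \<tau>" if "\<tau>' \<noteq> {}" "\<tau>' \<subset> \<tau>" for \<tau>'
  proof -
    have "enclosing_radius P \<tau>' \<noteq> enclosing_radius P \<tau>" using \<tau>(2)[of \<tau>'] \<tau>(1) that by (auto simp: X_def)
    moreover have "enclosing_radius P \<tau>' \<le> enclosing_radius P \<tau>"
      using enclosing_radius_mono that by blast
    ultimately show ?thesis by simp
  qed
  then have "minimal_simplex P \<tau>" using \<tau>(1) unfolding minimal_simplex_def X_def by blast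
  with \<tau>(1) show ?thesis unfolding X_def by (intro that[of \<tau>]) simp_all
qed

text \<open>
  If \<open>\<sigma>\<close> had more than \<open>d + 1\<close> points, any \<open>d + 1\<close> of them would form a proper face. Let \<open>r\<close> be the
  largest radius of a proper face. Any \<open>d + 1\<close> of the balls of radius \<open>r\<close> about the points of \<open>\<sigma>\<close> then
  have a common point, so by Helly's theorem all of them have one, and \<open>r\<close> would be an enclosing radius
  for \<open>\<sigma>\<close>.
\<close>

lemma minimal_simplex_card_le:
  fixes P :: "real^'d^'n"
  assumes P: "P \<in> point_clouds" and min: "minimal_simplex P \<sigma>"
  shows "card \<sigma> \<le> CARD('d) + 1"
proof (rule ccontr)
  assume "\<not> ?thesis"
  then have big: "CARD('d) + 2 \<le> card \<sigma>" by simp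
  define X where "X = enclosing_radius P ` {\<tau>. \<tau> \<noteq> {} \<and> \<tau> \<subset> \<sigma>}"
  define r where "r = Max X"
  have fin: "finite X" by (simp add: X_def)
  obtain i where i: "i \<in> \<sigma>" using min by (auto simp: minimal_simplex_def)
  have "{i} \<subset> \<sigma>" using i big by (auto simp: psubset_eq)
  then have "0 \<in> X" unfolding X_def by (intro image_eqI[of _ _ "{i}"]) (auto simp: enclosing_radius_singleton)
  then have "r \<in> X" "0 \<le> r" using fin unfolding r_def by (auto intro: Max_in)
  then have r_less: "r < enclosing_radius P \<sigma>" using min by (auto simp: X_def minimal_simplex_def)
  have r_ge: "enclosing_radius P \<tau> \<le> r" if "\<tau> \<noteq> {}" "\<tau> \<subset> \<sigma>" for \<tau>
    unfolding r_def using fin that by (intro Max_ge) (auto simp: X_def)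
  let ?F = "(\<lambda>i. cball (P $ i) r) ` \<sigma>"
  have inj: "inj_on (\<lambda>i. cball (P $ i) r) A" for A
    using P \<open>0 \<le> r\<close> by (auto simp: inj_on_def cball_eq_cball_iff point_clouds_def)
  have "\<Inter>?F \<noteq> {}"
  proof (rule Helly)
    show "DIM(real^'d) + 1 \<le> card ?F" using big by (simp add: card_image[OF inj])
    show "\<forall>s\<in>?F. convex s" by auto
    fix t assume t: "t \<subseteq> ?F" "card t = DIM(real^'d) + 1"
    then obtain \<tau> where \<tau>: "\<tau> \<subseteq> \<sigma>" "t = (\<lambda>i. cball (P $ i) r) ` \<tau>" by (meson subset_imageE)
    then have c: "card \<tau> = CARD('d) + 1" using t(2) by (simp add: card_image[OF inj])
    then have "\<tau> \<noteq> {}" "\<tau> \<subset> \<sigma>" using \<tau>(1) big by auto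
    then obtain q where "\<And>i. i \<in> \<tau> \<Longrightarrow> norm (P $ i - q) \<le> enclosing_radius P \<tau>"
      using enclosing_radius_attained[of \<tau> P] by blast
    then have "\<And>i. i \<in> \<tau> \<Longrightarrow> norm (P $ i - q) \<le> r" using r_ge \<open>\<tau> \<noteq> {}\<close> \<open>\<tau> \<subset> \<sigma>\<close> order_trans by blast
    then have "q \<in> \<Inter>t" by (auto simp: \<tau>(2) dist_norm)
    then show "\<Inter>t \<noteq> {}" by blast
  qed
  then obtain q where "q \<in> \<Inter>?F" by blast
  then have "norm (P $ i - q) \<le> r" if "i \<in> \<sigma>" for i using that by (auto simp: dist_norm)
  then have "enclosing_radius P \<sigma> \<le> r" using i by (intro enclosing_radius_le) auto
  then show False using r_less by simp
qed

text \<open>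
  No point has distance less than the enclosing radius from all points of \<open>\<sigma>\<close>. If a vertex \<open>v\<close> lay
  inside the ball, a small move of the centre towards a centre for \<open>\<sigma> - {v}\<close> would produce such a
  point; if the centre lay outside the convex hull, its projection to the hull would be such a point.
\<close>

lemma minimal_simplex_sphere:
  fixes P :: "real^'d^'n"
  assumes min: "minimal_simplex P \<sigma>" and card: "2 \<le> card \<sigma>"
  obtains c where "c \<in> convex hull (($) P ` \<sigma>)" "\<And>i. i \<in> \<sigma> \<Longrightarrow> norm (P $ i - c) = enclosing_radius P \<sigma>"
proof -
  let ?\<rho> = "enclosing_radius P \<sigma>"
  have ne: "\<sigma> \<noteq> {}" using card by auto
  obtain c where c: "\<And>i. i \<in> \<sigma> \<Longrightarrow> norm (P $ i - c) \<le> ?\<rho>"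
    using enclosing_radius_attained[OF ne, of P] by blast
  have no_better: False if "\<And>i. i \<in> \<sigma> \<Longrightarrow> norm (P $ i - q) < ?\<rho>" for q
  proof -
    define r where "r = Max ((\<lambda>i. norm (P $ i - q)) ` \<sigma>)"
    have "r < ?\<rho>" unfolding r_def using that ne by (simp add: Max_less_iff)
    moreover have "?\<rho> \<le> r" by (rule enclosing_radius_le[OF ne, of _ q]) (simp add: r_def)
    ultimately show False by simp
  qed
  have "norm (P $ v - c) = ?\<rho>" if v: "v \<in> \<sigma>" for v
  proof (rule ccontr)
    assume "norm (P $ v - c) \<noteq> ?\<rho>"
    then have lt: "norm (P $ v - c) < ?\<rho>" using c[OF v] by simp
    have "\<sigma> - {v} \<noteq> {}"
    proof
      assume "\<sigma> - {v} = {}"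
      then have "card \<sigma> \<le> card {v}" by (intro card_mono) auto
      then show False using card by simp
    qed
    moreover have "\<sigma> - {v} \<subset> \<sigma>" using v by auto
    ultimately have less: "enclosing_radius P (\<sigma> - {v}) < ?\<rho>" using min by (auto simp: minimal_simplex_def)
    obtain c' where c': "\<And>i. i \<in> \<sigma> - {v} \<Longrightarrow> norm (P $ i - c') \<le> enclosing_radius P (\<sigma> - {v})"
      using enclosing_radius_attained[OF \<open>\<sigma> - {v} \<noteq> {}\<close>, of P] by blast
    define K where "K = norm (c' - c)"
    \<comment> \<open>Small enough for \<open>v\<close> to stay inside the ball when the centre moves.\<close>
    define e where "e = min 1 ((?\<rho> - norm (P $ v - c)) / (2 * (K + 1)))"
    have K: "0 \<le> K" by (simp add: K_def)
    have e: "0 < e" "e \<le> 1" using lt K by (auto simp: e_def)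
    have "e * K < ?\<rho> - norm (P $ v - c)"
    proof -
      have "e * K \<le> (?\<rho> - norm (P $ v - c)) / (2 * (K + 1)) * K" using K by (intro mult_right_mono) (auto simp: e_def)
      also have "\<dots> = (?\<rho> - norm (P $ v - c)) * (K / (2 * (K + 1)))" by simp
      also have "\<dots> < (?\<rho> - norm (P $ v - c)) * 1"
        using lt K by (intro mult_strict_left_mono) (auto simp: field_simps)
      also have "\<dots> = ?\<rho> - norm (P $ v - c)" by simp
      finally show ?thesis .
    qed
    define q where "q = c + e *\<^sub>R (c' - c)"
    have "norm (P $ i - q) < ?\<rho>" if i: "i \<in> \<sigma>" for i
    proof (cases "i = v")
      case True
      have "P $ v - q = (P $ v - c) - e *\<^sub>R (c' - c)" by (simp add: q_def)
      have "norm (P $ v - q) \<le> norm (P $ v - c) + e * K"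
        unfolding \<open>P $ v - q = _\<close> using norm_triangle_ineq4[of "P $ v - c" "e *\<^sub>R (c' - c)"] e by (simp add: K_def)
      then show ?thesis using \<open>e * K < _\<close> True by simp
    next
      case False
      have "P $ i - q = (1 - e) *\<^sub>R (P $ i - c) + e *\<^sub>R (P $ i - c')" by (simp add: q_def algebra_simps)
      have "norm (P $ i - q) \<le> (1 - e) * norm (P $ i - c) + e * norm (P $ i - c')"
        unfolding \<open>P $ i - q = _\<close> using norm_triangle_ineq[of "(1 - e) *\<^sub>R (P $ i - c)" "e *\<^sub>R (P $ i - c')"] e by simp
      also have "\<dots> \<le> (1 - e) * ?\<rho> + e * enclosing_radius P (\<sigma> - {v})"
        using c[OF i] c'[of i] False i e by (intro add_mono mult_left_mono) auto
      also have "\<dots> < (1 - e) * ?\<rho> + e * ?\<rho>" using less e by simp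
      finally show ?thesis by (simp add: algebra_simps)
    qed
    then show False using no_better by blast
  qed
  moreover have "c \<in> convex hull (($) P ` \<sigma>)"
  proof (rule ccontr)
    let ?S = "convex hull (($) P ` \<sigma>)"
    assume nc: "c \<notin> ?S"
    define p where "p = closest_point ?S c"
    have "closed ?S" by (intro compact_imp_closed finite_imp_compact_convex_hull) simp
    then have S: "closed ?S" "?S \<noteq> {}" "convex ?S" using ne by auto
    have p: "p \<in> ?S" unfolding p_def by (rule closest_point_in_set[OF S(1,2)])
    have "norm (P $ i - p) < ?\<rho>" if i: "i \<in> \<sigma>" for i
    proof -
      have "P $ i \<in> ?S" using i by (auto intro: hull_inc)
      then have "(c - p) \<bullet> (P $ i - p) \<le> 0"
        unfolding p_def using closest_point_dot[OF S(3,1)] by blast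
      moreover have "(norm (a - b))\<^sup>2 = (norm a)\<^sup>2 + (norm b)\<^sup>2 - 2 * (b \<bullet> a)" for a b :: "real^'d"
        unfolding power2_norm_eq_inner by (simp add: inner_diff_left inner_diff_right inner_commute)
      from this[of "P $ i - p" "c - p"]
      have "(norm (P $ i - c))\<^sup>2 = (norm (P $ i - p))\<^sup>2 + (norm (c - p))\<^sup>2 - 2 * ((c - p) \<bullet> (P $ i - p))"
        by simp
      moreover have "0 < (norm (c - p))\<^sup>2" using p nc by auto
      ultimately have "(norm (P $ i - p))\<^sup>2 < (norm (P $ i - c))\<^sup>2" by linarith
      then have "norm (P $ i - p) < norm (P $ i - c)" by (rule power2_less_imp_less) simp
      then show ?thesis using c[OF i] by simp
    qed
    then show False using no_better by blast
  qed
  ultimately show ?thesis using that by blast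
qed

section \<open>Barcodes as functions of the radii\<close>

lemma cech_module_eq: "cech_module P i = filtration_module i (cech_complex P)"
  by (simp add: cech_module_def filtration_module_def)

lemma mono_cech_complex: "mono (cech_complex P)"
  by (auto simp: mono_def cech_complex_def)

text \<open>
  The adapted basis yields a barcode, and uniqueness identifies it with the one selected in the
  definition of \<open>PH\<close>.
\<close>

lemma PH_eq_bars:
  fixes P :: "real^'d^('n::{finite,linorder})" and S :: "('n set \<Rightarrow> 'f::field) set"
  assumes "fs.independent S"
    and "\<And>r. cycles i (cech_complex P r) \<subseteq> fs.span (S \<inter> cycles i (cech_complex P r))"
    and "\<And>r. boundaries i (cech_complex P r) \<subseteq> fs.span (S \<inter> boundaries i (cech_complex P r))"
  shows "PH TYPE('f) P i = image_mset (bar i (cech_complex P)) (mset_set {s\<in>S. bar i (cech_complex P) s \<noteq> {}})"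
  unfolding PH_def
proof (rule the_equality)
  note dec = filtration_module_decomposition[OF mono_cech_complex assms, folded cech_module_eq]
  from dec show "barcode (image_mset (bar i (cech_complex P)) (mset_set {s\<in>S. bar i (cech_complex P) s \<noteq> {}})) \<and>
    pm_isomorphic (cech_module P i :: ('f, ('n set \<Rightarrow> 'f) set) persistence_module)
     (barcode_module (image_mset (bar i (cech_complex P)) (mset_set {s\<in>S. bar i (cech_complex P) s \<noteq> {}})))"
    by blast
  fix D assume D: "barcode D \<and>
    pm_isomorphic (cech_module P i :: ('f, ('n set \<Rightarrow> 'f) set) persistence_module) (barcode_module D)"
  show "D = image_mset (bar i (cech_complex P)) (mset_set {s\<in>S. bar i (cech_complex P) s \<noteq> {}})"
    by (rule barcode_unique[OF conjunct1[OF D] dec(1) conjunct2[OF D] dec(2)])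
      (simp add: cech_module_eq pm_closed_filtration_module mono_cech_complex)
qed

definition same_radius_order :: "real^'d^'n \<Rightarrow> real^'d^'n \<Rightarrow> bool" where
  "same_radius_order P Q \<longleftrightarrow> (\<forall>\<sigma> \<tau>. \<sigma> \<noteq> {} \<longrightarrow> \<tau> \<noteq> {} \<longrightarrow>
    (enclosing_radius P \<sigma> \<le> enclosing_radius P \<tau> \<longleftrightarrow> enclosing_radius Q \<sigma> \<le> enclosing_radius Q \<tau>))"

lemma same_radius_order_refl: "same_radius_order P P"
  by (simp add: same_radius_order_def)

lemma same_radius_order_less:
  assumes "same_radius_order P Q" "\<sigma> \<noteq> {}" "\<tau> \<noteq> {}"
  shows "enclosing_radius P \<sigma> < enclosing_radius P \<tau> \<longleftrightarrow> enclosing_radius Q \<sigma> < enclosing_radius Q \<tau>"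
proof -
  have "enclosing_radius P \<tau> \<le> enclosing_radius P \<sigma> \<longleftrightarrow> enclosing_radius Q \<tau> \<le> enclosing_radius Q \<sigma>"
    using assms(1)[unfolded same_radius_order_def, rule_format, OF assms(3,2)] .
  then show ?thesis by linarith
qed

lemma cech_complex_same_radius_order:
  assumes "same_radius_order P Q" "\<sigma> \<noteq> {}"
  shows "cech_complex Q (enclosing_radius Q \<sigma>) = cech_complex P (enclosing_radius P \<sigma>)"
proof -
  have "enclosing_radius Q \<tau> \<le> enclosing_radius Q \<sigma> \<longleftrightarrow> enclosing_radius P \<tau> \<le> enclosing_radius P \<sigma>"
    if "\<tau> \<noteq> {}" for \<tau>
    using assms(1)[unfolded same_radius_order_def, rule_format, OF that assms(2), symmetric] .
  then show ?thesis unfolding cech_complex_def by (intro Collect_cong conj_cong refl)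
qed

text \<open>
  The complex changes only at radii of simplices: a nonempty complex is already present at the
  largest radius of its members.
\<close>

lemma cech_complex_cases:
  obtains "cech_complex P r = {}"
  | \<sigma> where "\<sigma> \<noteq> {}" "enclosing_radius P \<sigma> \<le> r" "cech_complex P r = cech_complex P (enclosing_radius P \<sigma>)"
proof (cases "cech_complex P r = {}")
  case False
  have "finite (enclosing_radius P ` cech_complex P r)" by simp
  then have "Max (enclosing_radius P ` cech_complex P r) \<in> enclosing_radius P ` cech_complex P r"
    using False by (intro Max_in) auto
  then obtain \<sigma> where \<sigma>: "\<sigma> \<in> cech_complex P r" "enclosing_radius P \<sigma> = Max (enclosing_radius P ` cech_complex P r)"
    by auto
  have "enclosing_radius P \<tau> \<le> enclosing_radius P \<sigma>" if "\<tau> \<in> cech_complex P r" for \<tau>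
    unfolding \<sigma>(2) using that by simp
  moreover have \<sigma>r: "\<sigma> \<noteq> {}" "enclosing_radius P \<sigma> \<le> r" using \<sigma>(1) by (simp_all add: cech_complex_def)
  ultimately have "cech_complex P r = cech_complex P (enclosing_radius P \<sigma>)"
    by (intro equalityI subsetI) (simp_all add: cech_complex_def)
  then show ?thesis by (rule that(2)[OF \<sigma>r])
qed (use that in blast)

lemma range_cech_complex_eq:
  assumes "same_radius_order P Q"
  shows "range (cech_complex Q) \<subseteq> range (cech_complex P)"
proof clarify
  fix r
  have "\<not> enclosing_radius P \<sigma> \<le> -1" if "\<sigma> \<noteq> {}" for \<sigma>
    using enclosing_radius_nonneg[OF that, of P] by simp
  then have empty: "cech_complex P (-1) = {}" unfolding cech_complex_def by blast
  show "cech_complex Q r \<in> range (cech_complex P)"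
  proof (cases rule: cech_complex_cases[of Q r])
    case 1
    then have "cech_complex Q r = cech_complex P (-1)" using empty by simp
    then show ?thesis by simp
  next
    case (2 \<sigma>)
    then show ?thesis unfolding 2(3) cech_complex_same_radius_order[OF assms 2(1)] by (intro rangeI)
  qed
qed

text \<open>
  A monotone property of the complex starts to hold at the radius of a simplex. Which simplex this is
  can be read off from the order of the radii, so it is the same for all order-equivalent clouds. The
  first alternative is a property that never holds.
\<close>

lemma cech_threshold:
  fixes P :: "real^'d^'n"
  assumes mono: "\<And>K L. K \<subseteq> L \<Longrightarrow> \<alpha> K \<Longrightarrow> \<alpha> L" and empty: "\<not> \<alpha> {}"
  obtains "\<And>Q. same_radius_order P Q \<Longrightarrow> {r. \<alpha> (cech_complex Q r)} = {}"
  | \<sigma> where "\<sigma> \<noteq> {}" "\<And>Q. same_radius_order P Q \<Longrightarrow> {r. \<alpha> (cech_complex Q r)} = {enclosing_radius Q \<sigma>..}"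
proof (cases "\<exists>\<sigma>. \<sigma> \<noteq> {} \<and> \<alpha> (cech_complex P (enclosing_radius P \<sigma>))")
  case False
  have "\<not> \<alpha> (cech_complex Q r)" if Q: "same_radius_order P Q" for Q r
    using cech_complex_same_radius_order[OF Q] False empty
    by (cases rule: cech_complex_cases[of Q r]) auto
  then show ?thesis using that(1) by blast
next
  case True
  define X where "X = {\<sigma>. \<sigma> \<noteq> {} \<and> \<alpha> (cech_complex P (enclosing_radius P \<sigma>))}"
  have X: "finite X" "X \<noteq> {}" using True by (auto simp: X_def)
  define \<sigma> where "\<sigma> = arg_min_on (enclosing_radius P) X"
  have \<sigma>: "\<sigma> \<in> X" unfolding \<sigma>_def by (rule arg_min_if_finite(1)[OF X])
  have min: "enclosing_radius P \<sigma> \<le> enclosing_radius P \<tau>" if "\<tau> \<in> X" for \<tau>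
    unfolding \<sigma>_def by (rule arg_min_least[OF X that])
  have "\<alpha> (cech_complex Q r) \<longleftrightarrow> enclosing_radius Q \<sigma> \<le> r" if Q: "same_radius_order P Q" for Q r
  proof
    assume \<alpha>: "\<alpha> (cech_complex Q r)"
    show "enclosing_radius Q \<sigma> \<le> r"
    proof (cases rule: cech_complex_cases[of Q r])
      case 1
      then show ?thesis using \<alpha> empty by simp
    next
      case (2 \<tau>)
      then have "\<tau> \<in> X" using \<alpha> cech_complex_same_radius_order[OF Q] by (simp add: X_def)
      then have "enclosing_radius Q \<sigma> \<le> enclosing_radius Q \<tau>"
        using min[of \<tau>] Q \<sigma> by (simp add: same_radius_order_def X_def)
      then show ?thesis using 2 by simp
    qed
  next
    assume "enclosing_radius Q \<sigma> \<le> r"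
    then have "cech_complex Q (enclosing_radius Q \<sigma>) \<subseteq> cech_complex Q r" using mono_cech_complex by (rule monoD[rotated])
    then show "\<alpha> (cech_complex Q r)"
      using \<sigma> mono cech_complex_same_radius_order[OF Q, of \<sigma>] by (auto simp: X_def)
  qed
  then have "{r. \<alpha> (cech_complex Q r)} = {enclosing_radius Q \<sigma>..}" if "same_radius_order P Q" for Q
    using that by auto
  then show ?thesis using that(2) \<sigma> unfolding X_def by blast
qed

text \<open>
  A bar is recorded by the simplices at whose radii it begins and ends; \<open>None\<close> marks a class that
  never dies.
\<close>

definition simplex_bar :: "real^'d^'n \<Rightarrow> 'n set \<times> 'n set option \<Rightarrow> real set" where
  "simplex_bar P p = (case p of
      (\<sigma>, None) \<Rightarrow> {enclosing_radius P \<sigma>..}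
    | (\<sigma>, Some \<tau>) \<Rightarrow> {enclosing_radius P \<sigma>..<enclosing_radius P \<tau>})"

definition proper_pair :: "real^'d^'n \<Rightarrow> 'n set \<times> 'n set option \<Rightarrow> bool" where
  "proper_pair P p \<longleftrightarrow> fst p \<noteq> {} \<and>
    (\<forall>\<tau>. snd p = Some \<tau> \<longrightarrow> \<tau> \<noteq> {} \<and> enclosing_radius P (fst p) < enclosing_radius P \<tau>)"

lemma simplex_bar_nonempty:
  assumes p: "proper_pair P p" and Q: "same_radius_order P Q"
  shows "simplex_bar Q p \<noteq> {}"
proof (cases "snd p")
  case None
  then show ?thesis by (simp add: simplex_bar_def split_beta)
next
  case (Some \<tau>)
  then have "fst p \<noteq> {}" "\<tau> \<noteq> {}" "enclosing_radius P (fst p) < enclosing_radius P \<tau>"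
    using p by (simp_all add: proper_pair_def)
  then have "enclosing_radius Q (fst p) < enclosing_radius Q \<tau>" using same_radius_order_less[OF Q] by blast
  then show ?thesis using Some by (simp add: simplex_bar_def split_beta)
qed

lemma cycles_empty: "cycles i {} = {0}" and boundaries_empty: "boundaries i {} = {0}"
proof -
  have chains: "carrier (chain_module i {}) = {0}" for i by (auto simp: chain_module_def fun_eq_iff)
  have "boundary 0 = 0" by (auto simp: boundary_def)
  then show "cycles i {} = {0}" "boundaries i {} = {0}"
    by (auto simp: cycles_def boundaries_def chains zero_fun_def)
qed

text \<open>
  The bar of \<open>s\<close> begins where \<open>s\<close> becomes a cycle and ends where \<open>s\<close> becomes a boundary. Both are
  monotone properties of the complex, and neither holds for the empty complex when \<open>s \<noteq> 0\<close>.
\<close>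

lemma bar_eq_simplex_bar:
  fixes P :: "real^'d^('n::{finite,linorder})" and s :: "'n set \<Rightarrow> 'f::field"
  assumes "s \<noteq> 0"
  obtains "\<And>Q. same_radius_order P Q \<Longrightarrow> bar i (cech_complex Q) s = {}"
  | p where "proper_pair P p" "\<And>Q. same_radius_order P Q \<Longrightarrow> bar i (cech_complex Q) s = simplex_bar Q p"
proof -
  have bar: "bar i (cech_complex Q) s = {r. s \<in> cycles i (cech_complex Q r)} - {r. s \<in> boundaries i (cech_complex Q r)}"
    for Q :: "real^'d^('n::{finite,linorder})" by (auto simp: bar_def)
  have "s \<notin> cycles i {}" "s \<notin> boundaries i {}"
    using assms by (simp_all add: cycles_empty boundaries_empty)
  note Zcases = cech_threshold[of "\<lambda>K. s \<in> cycles i K" P, OF _ this(1)]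
    and Bcases = cech_threshold[of "\<lambda>K. s \<in> boundaries i K" P, OF _ this(2)]
  show ?thesis
  proof (rule Zcases)
    show "s \<in> cycles i L" if "K \<subseteq> L" "s \<in> cycles i K" for K L using cycles_mono that by blast
    assume "\<And>Q. same_radius_order P Q \<Longrightarrow> {r. s \<in> cycles i (cech_complex Q r)} = {}"
    then show thesis by (intro that(1)) (simp add: bar)
  next
    fix \<sigma> assume \<sigma>: "\<sigma> \<noteq> {}"
      "\<And>Q. same_radius_order P Q \<Longrightarrow> {r. s \<in> cycles i (cech_complex Q r)} = {enclosing_radius Q \<sigma>..}"
    show thesis
    proof (rule Bcases)
      show "s \<in> boundaries i L" if "K \<subseteq> L" "s \<in> boundaries i K" for K L using boundaries_mono that by blast
      assume "\<And>Q. same_radius_order P Q \<Longrightarrow> {r. s \<in> boundaries i (cech_complex Q r)} = {}"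
      then show thesis using \<sigma>
        by (intro that(2)[of "(\<sigma>, None)"]) (simp_all add: bar proper_pair_def simplex_bar_def)
    next
      fix \<tau> assume \<tau>: "\<tau> \<noteq> {}"
        "\<And>Q. same_radius_order P Q \<Longrightarrow> {r. s \<in> boundaries i (cech_complex Q r)} = {enclosing_radius Q \<tau>..}"
      have b: "bar i (cech_complex Q) s = {enclosing_radius Q \<sigma>..<enclosing_radius Q \<tau>}" if "same_radius_order P Q" for Q
        unfolding bar \<sigma>(2)[OF that] \<tau>(2)[OF that] by auto
      show thesis
      proof (cases "enclosing_radius P \<sigma> < enclosing_radius P \<tau>")
        case True
        then show thesis using \<sigma>(1) \<tau>(1) b
          by (intro that(2)[of "(\<sigma>, Some \<tau>)"]) (simp_all add: proper_pair_def simplex_bar_def)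
      next
        case False
        have "bar i (cech_complex Q) s = {}" if "same_radius_order P Q" for Q
          using b[OF that] False same_radius_order_less[OF that \<sigma>(1) \<tau>(1)] by simp
        then show thesis by (rule that(1))
      qed
    qed
  qed
qed

text \<open>
  The order of the radii determines which complexes occur, so a basis adapted to the cycles and
  boundaries of \<open>P\<close> is adapted to those of every order-equivalent cloud.
\<close>

theorem PH_eq_simplex_bars:
  fixes P :: "real^'d^('n::{finite,linorder})"
  obtains T where "\<And>p. p \<in># T \<Longrightarrow> proper_pair P p"
    "\<And>Q. same_radius_order P Q \<Longrightarrow> PH TYPE('f::field) Q i = image_mset (simplex_bar Q) T"
proof -
  let ?Z = "(\<lambda>r. cycles i (cech_complex P r)) :: real \<Rightarrow> ('n set \<Rightarrow> 'f) set"
    and ?B = "(\<lambda>r. boundaries i (cech_complex P r)) :: real \<Rightarrow> ('n set \<Rightarrow> 'f) set"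
  have fin: "finite (range (\<lambda>r. F (cech_complex P r)))" for F :: "'n set set \<Rightarrow> ('n set \<Rightarrow> 'f) set"
  proof -
    have "range (\<lambda>r. F (cech_complex P r)) \<subseteq> range F" by auto
    then show ?thesis by (rule finite_subset) simp
  qed
  have mono: "cech_complex P r \<subseteq> cech_complex P s \<or> cech_complex P s \<subseteq> cech_complex P r" for r s
    using linear[of r s] monoD[OF mono_cech_complex] by blast
  obtain S where S: "fs.independent S" "\<And>X. X \<in> range ?Z \<union> range ?B \<Longrightarrow> X \<subseteq> fs.span (S \<inter> X)"
  proof (rule fs.common_adapted_basis[of "range ?Z" "range ?B"])
    show "finite (range ?Z)" "finite (range ?B)" by (rule fin)+
    show "X \<subseteq> Y \<or> Y \<subseteq> X" if ran: "X \<in> range ?Z" "Y \<in> range ?Z" for X Y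
    proof -
      obtain r s where XY: "X = ?Z r" "Y = ?Z s" using ran by auto
      from mono[of r s] show ?thesis unfolding XY by (rule disj_forward) (rule cycles_mono, assumption)+
    qed
    show "X \<subseteq> Y \<or> Y \<subseteq> X" if ran: "X \<in> range ?B" "Y \<in> range ?B" for X Y
    proof -
      obtain r s where XY: "X = ?B r" "Y = ?B s" using ran by auto
      from mono[of r s] show ?thesis unfolding XY by (rule disj_forward) (rule boundaries_mono, assumption)+
    qed
    show "fs.subspace X" if ran: "X \<in> range ?Z" for X using ran by (auto simp: subspace_cycles)
    show "fs.subspace X" if ran: "X \<in> range ?B" for X using ran by (auto simp: subspace_boundaries)
  qed blast
  define S' where "S' = {s\<in>S. bar i (cech_complex P) s \<noteq> {}}"
  have ne0: "s \<noteq> 0" if "s \<in> S" for s using S(1) that fs.dependent_zero by blast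
  have "\<exists>p. proper_pair P p \<and> (\<forall>Q. same_radius_order P Q \<longrightarrow> bar i (cech_complex Q) s = simplex_bar Q p)"
    if "s \<in> S'" for s
  proof (rule bar_eq_simplex_bar[of s P i])
    show "s \<noteq> 0" using that ne0 by (simp add: S'_def)
    assume "\<And>Q. same_radius_order P Q \<Longrightarrow> bar i (cech_complex Q) s = {}"
    then show ?thesis using that same_radius_order_refl by (auto simp: S'_def)
  qed blast
  then obtain pr where pr: "\<And>s. s \<in> S' \<Longrightarrow> proper_pair P (pr s)"
    "\<And>s Q. s \<in> S' \<Longrightarrow> same_radius_order P Q \<Longrightarrow> bar i (cech_complex Q) s = simplex_bar Q (pr s)"
    by metis
  have fin': "finite S'" using finite_independent_functions[OF S(1)] by (simp add: S'_def)
  have "PH TYPE('f) Q i = image_mset (simplex_bar Q) (image_mset pr (mset_set S'))" if Q: "same_radius_order P Q" for Q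
  proof -
    have rng: "cech_complex Q r \<in> range (cech_complex P)" for r using range_cech_complex_eq[OF Q] by blast
    have "{s\<in>S. bar i (cech_complex Q) s \<noteq> {}} = S'"
    proof (intro equalityI subsetI)
      fix s assume s: "s \<in> {s\<in>S. bar i (cech_complex Q) s \<noteq> {}}"
      show "s \<in> S'"
      proof (rule bar_eq_simplex_bar[of s P i])
        show "s \<noteq> 0" using s ne0 by simp
        assume "\<And>Q. same_radius_order P Q \<Longrightarrow> bar i (cech_complex Q) s = {}"
        then show "s \<in> S'" using s Q by auto
      next
        fix p assume p: "proper_pair P p" "\<And>Q. same_radius_order P Q \<Longrightarrow> bar i (cech_complex Q) s = simplex_bar Q p"
        have "bar i (cech_complex P) s \<noteq> {}"
          unfolding p(2)[OF same_radius_order_refl] by (rule simplex_bar_nonempty[OF p(1) same_radius_order_refl])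
        then show "s \<in> S'" using s by (simp add: S'_def)
      qed
    next
      fix s assume s: "s \<in> S'"
      have "bar i (cech_complex Q) s \<noteq> {}"
        unfolding pr(2)[OF s Q] by (rule simplex_bar_nonempty[OF pr(1)[OF s] Q])
      then show "s \<in> {s\<in>S. bar i (cech_complex Q) s \<noteq> {}}" using s by (simp add: S'_def)
    qed
    moreover have "PH TYPE('f) Q i = image_mset (bar i (cech_complex Q)) (mset_set {s\<in>S. bar i (cech_complex Q) s \<noteq> {}})"
    proof (rule PH_eq_bars[OF S(1)])
      fix r
      obtain t where "cech_complex Q r = cech_complex P t" using rng by blast
      then show "cycles i (cech_complex Q r) \<subseteq> fs.span (S \<inter> cycles i (cech_complex Q r))"
        "boundaries i (cech_complex Q r) \<subseteq> fs.span (S \<inter> boundaries i (cech_complex Q r))"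
        using S(2) by simp_all
    qed
    moreover have "image_mset (bar i (cech_complex Q)) (mset_set S') = image_mset (\<lambda>s. simplex_bar Q (pr s)) (mset_set S')"
      using pr(2)[OF _ Q] fin' by (intro image_mset_cong) simp
    ultimately show ?thesis by (simp only: multiset.map_comp o_def)
  qed
  moreover have "proper_pair P p" if "p \<in># image_mset pr (mset_set S')" for p
    using that pr(1) fin' by auto
  ultimately show ?thesis using that by blast
qed

text \<open>
  An order isomorphism of a finite chain onto itself is the identity. At a least point where \<open>f\<close> and
  \<open>g\<close> differ, the smaller of the two values is also taken by the other function, at an earlier point.
  There \<open>f\<close> and \<open>g\<close> agree, which contradicts the strictness of the order.
\<close>

lemma eq_of_same_order_same_image:
  fixes f g :: "'a \<Rightarrow> 'b::linorder"
  assumes fin: "finite X" and ord: "\<And>x y. x \<in> X \<Longrightarrow> y \<in> X \<Longrightarrow> f x \<le> f y \<longleftrightarrow> g x \<le> g y"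
    and img: "f ` X = g ` X" and x: "x \<in> X"
  shows "f x = g x"
proof (rule ccontr)
  assume "f x \<noteq> g x"
  define Y where "Y = {x\<in>X. f x \<noteq> g x}"
  have Y: "finite Y" "Y \<noteq> {}" using fin x \<open>f x \<noteq> g x\<close> by (auto simp: Y_def)
  define y where "y = arg_min_on f Y"
  have y: "y \<in> X" "f y \<noteq> g y" using arg_min_if_finite(1)[OF Y, of f] by (simp_all add: y_def Y_def)
  have good: "f z = g z" if "z \<in> X" "f z < f y" for z
  proof (rule ccontr)
    assume "f z \<noteq> g z"
    then have "f y \<le> f z" unfolding y_def using that by (intro arg_min_least[OF Y]) (simp add: Y_def)
    then show False using that by simp
  qed
  show False
  proof (cases "g y < f y")
    case True
    have "g y \<in> f ` X" using imageI[OF y(1), of g] unfolding img .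
    then obtain z where z: "g y = f z" "z \<in> X" by (elim imageE)
    then have "f z = g z" using good[of z] True by simp
    then have "f y \<le> f z" using ord[OF y(1) z(2)] z(1) by simp
    then show False using True z(1) by simp
  next
    case False
    have "f y \<in> g ` X" using imageI[OF y(1), of f] unfolding img .
    then obtain z where z: "f y = g z" "z \<in> X" by (elim imageE)
    then have "g z < g y" using False y(2) by simp
    then have "\<not> f y \<le> f z" using ord[OF y(1) z(2)] by simp
    then have less: "f z < f y" by simp
    have "f z = f y" unfolding z(1) by (rule good[OF z(2) less])
    then show False using less by simp
  qed
qed

lemma endpoint_simplex_bar:
  assumes "proper_pair P p" "same_radius_order P Q"
  shows "endpoint x (simplex_bar Q p) \<longleftrightarrow>
    x = enclosing_radius Q (fst p) \<or> (\<exists>\<tau>. snd p = Some \<tau> \<and> x = enclosing_radius Q \<tau>)"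
proof (cases "snd p")
  case None
  have "\<not> bdd_above {a::real..}" for a
  proof
    assume "bdd_above {a..}"
    then obtain M where M: "x \<le> M" if "a \<le> x" for x by (auto simp: bdd_above_def)
    show False using M[of "max a (M + 1)"] by simp
  qed
  then show ?thesis using None by (simp add: simplex_bar_def split_beta endpoint_def)
next
  case (Some \<tau>)
  then have "fst p \<noteq> {}" "\<tau> \<noteq> {}" "enclosing_radius P (fst p) < enclosing_radius P \<tau>"
    using assms(1) by (simp_all add: proper_pair_def)
  then have "enclosing_radius Q (fst p) < enclosing_radius Q \<tau>" using same_radius_order_less[OF assms(2)] by blast
  then show ?thesis using Some by (simp add: simplex_bar_def split_beta endpoint_def)
qed

text \<open>
  By \<open>PH_eq_simplex_bars\<close> the endpoints of the bars are the radii of the simplices in a fixed set \<open>X\<close>.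
  If the barcodes agree, then the radii of \<open>P\<close> and of \<open>Q\<close> take the same values on \<open>X\<close>, in the same
  order, and are equal there. Conversely, every simplex in \<open>X\<close> has a critical face with the same
  radius, so that agreement on critical simplices gives agreement on \<open>X\<close>; single points have radius
  \<open>0\<close> in every cloud.
\<close>

theorem PH_eq_iff_critical_radii:
  fixes P Q :: "real^'d^('n::{finite,linorder})"
  assumes PQ: "same_radius_order P Q"
  shows "PH TYPE('f::field) Q = PH TYPE('f) P \<longleftrightarrow>
    (\<forall>\<sigma>\<in>critical_hypergraph TYPE('f) P. enclosing_radius Q \<sigma> = enclosing_radius P \<sigma>)"
proof -
  have "\<exists>T. (\<forall>p. p \<in># T \<longrightarrow> proper_pair P p) \<and>
      (\<forall>Q. same_radius_order P Q \<longrightarrow> PH TYPE('f) Q i = image_mset (simplex_bar Q) T)" for i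
    by (rule PH_eq_simplex_bars[of P i]) blast
  then obtain T where T: "\<And>i p. p \<in># T i \<Longrightarrow> proper_pair P p"
    "\<And>i Q. same_radius_order P Q \<Longrightarrow> PH TYPE('f) Q i = image_mset (simplex_bar Q) (T i)"
    by metis
  note PHP = T(2)[OF same_radius_order_refl] and PHQ = T(2)[OF PQ]
  define X where "X = {\<sigma>. \<exists>i. \<exists>p\<in>#T i. \<sigma> = fst p \<or> snd p = Some \<sigma>}"
  have Xne: "\<sigma> \<noteq> {}" if "\<sigma> \<in> X" for \<sigma>
    using that T(1) unfolding X_def proper_pair_def by blast
  have endpoints: "(\<exists>i. \<exists>I\<in>#PH TYPE('f) Q i. endpoint x I) \<longleftrightarrow> x \<in> enclosing_radius Q ` X"
    if Q: "same_radius_order P Q" for Q :: "real^'d^('n::{finite,linorder})" and x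
  proof -
    have "(\<exists>I\<in>#PH TYPE('f) Q i. endpoint x I) \<longleftrightarrow>
        (\<exists>p\<in>#T i. \<exists>\<sigma>. (\<sigma> = fst p \<or> snd p = Some \<sigma>) \<and> x = enclosing_radius Q \<sigma>)" for i
      unfolding T(2)[OF Q] using endpoint_simplex_bar[OF T(1) Q] by auto
    then show ?thesis unfolding X_def by blast
  qed
  have crit: "critical_simplex TYPE('f) P \<sigma> \<longleftrightarrow> minimal_simplex P \<sigma> \<and> enclosing_radius P \<sigma> \<in> enclosing_radius P ` X" for \<sigma>
    unfolding critical_simplex_def minimal_simplex_def endpoints[OF same_radius_order_refl] by blast
  have ord: "enclosing_radius P \<sigma> \<le> enclosing_radius P \<tau> \<longleftrightarrow> enclosing_radius Q \<sigma> \<le> enclosing_radius Q \<tau>"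
    if "\<sigma> \<noteq> {}" "\<tau> \<noteq> {}" for \<sigma> \<tau>
    using PQ[unfolded same_radius_order_def, rule_format, OF that] .
  have transfer: "enclosing_radius Q \<sigma> = enclosing_radius Q \<tau>"
    if "enclosing_radius P \<sigma> = enclosing_radius P \<tau>" "\<sigma> \<noteq> {}" "\<tau> \<noteq> {}" for \<sigma> \<tau>
    using ord[OF that(2,3)] ord[OF that(3,2)] that(1) by (intro antisym) simp_all
  show ?thesis
  proof
    assume eq: "PH TYPE('f) Q = PH TYPE('f) P"
    have img: "enclosing_radius P ` X = enclosing_radius Q ` X"
      using endpoints[OF PQ] endpoints[OF same_radius_order_refl] unfolding eq by blast
    have X: "enclosing_radius P \<tau> = enclosing_radius Q \<tau>" if "\<tau> \<in> X" for \<tau>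
    proof (rule eq_of_same_order_same_image[OF _ _ img that])
      show "finite X" by simp
      show "enclosing_radius P \<sigma> \<le> enclosing_radius P \<tau> \<longleftrightarrow> enclosing_radius Q \<sigma> \<le> enclosing_radius Q \<tau>"
        if "\<sigma> \<in> X" "\<tau> \<in> X" for \<sigma> \<tau> using that by (intro ord Xne)
    qed
    show "\<forall>\<sigma>\<in>critical_hypergraph TYPE('f) P. enclosing_radius Q \<sigma> = enclosing_radius P \<sigma>"
    proof
      fix \<sigma> assume "\<sigma> \<in> critical_hypergraph TYPE('f) P"
      then have "minimal_simplex P \<sigma>" "enclosing_radius P \<sigma> \<in> enclosing_radius P ` X"
        by (simp_all add: critical_hypergraph_def crit)
      then obtain \<tau> where \<tau>: "\<tau> \<in> X" "enclosing_radius P \<sigma> = enclosing_radius P \<tau>" "\<sigma> \<noteq> {}"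
        by (auto simp: minimal_simplex_def)
      then show "enclosing_radius Q \<sigma> = enclosing_radius P \<sigma>"
        using X[OF \<tau>(1)] transfer[OF \<tau>(2,3) Xne[OF \<tau>(1)]] by simp
    qed
  next
    assume rad: "\<forall>\<sigma>\<in>critical_hypergraph TYPE('f) P. enclosing_radius Q \<sigma> = enclosing_radius P \<sigma>"
    have X: "enclosing_radius Q \<tau> = enclosing_radius P \<tau>" if \<tau>: "\<tau> \<in> X" for \<tau>
    proof -
      obtain \<sigma> where \<sigma>: "minimal_simplex P \<sigma>" "enclosing_radius P \<sigma> = enclosing_radius P \<tau>"
        using minimal_face[OF Xne[OF \<tau>], of P] by metis
      have ne: "\<sigma> \<noteq> {}" using \<sigma>(1) by (simp add: minimal_simplex_def)
      have crit: "critical_simplex TYPE('f) P \<sigma>" using \<sigma> \<tau> by (simp add: crit)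
      have "enclosing_radius Q \<sigma> = enclosing_radius P \<sigma>"
      proof (cases "2 \<le> card \<sigma>")
        case True
        then show ?thesis using rad crit by (simp add: critical_hypergraph_def)
      next
        case False
        then have "card \<sigma> = 1" using ne by (simp add: Suc_leI card_gt_0_iff le_antisym not_less_eq_eq numeral_2_eq_2)
        then obtain i where "\<sigma> = {i}" by (rule card_1_singletonE)
        then show ?thesis by (simp add: enclosing_radius_singleton)
      qed
      then show ?thesis using transfer[OF \<sigma>(2) ne Xne[OF \<tau>]] \<sigma>(2) by simp
    qed
    have "image_mset (simplex_bar Q) (T i) = image_mset (simplex_bar P) (T i)" for i
    proof (rule image_mset_cong)
      fix p assume p: "p \<in># T i"
      then have "fst p \<in> X" "\<And>\<tau>. snd p = Some \<tau> \<Longrightarrow> \<tau> \<in> X" unfolding X_def by blast+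
      then show "simplex_bar Q p = simplex_bar P p"
        by (cases "snd p") (simp_all add: simplex_bar_def split_beta X)
    qed
    then show "PH TYPE('f) Q = PH TYPE('f) P" by (intro ext) (simp only: PHP PHQ)
  qed
qed

section \<open>Circumradii and Cayley-Menger determinants\<close>

lemma dim_Delta_mat: "Delta_mat R \<in> carrier_mat (Suc (length R)) (Suc (length R))"
  by (rule carrier_matI) (simp_all add: Delta_mat_def Lambda_mat_def)

lemma Delta_mat_index:
  assumes "i < Suc (length R)" "j < Suc (length R)"
  shows "Delta_mat R $$ (i, j) =
    (if i = 0 then if j = 0 then 0 else 1 else if j = 0 then 1 else (norm (R ! (i - 1) - R ! (j - 1)))\<^sup>2)"
  using assms by (cases i; cases j) (auto simp: Delta_mat_def Lambda_mat_def)

lemma Delta_mat_mult_vec: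
  assumes "x \<in> carrier_vec (Suc (length R))"
  shows "vec_index (Delta_mat R *\<^sub>v x) 0 = (\<Sum>j<length R. vec_index x (Suc j))"
    and "i < length R \<Longrightarrow> vec_index (Delta_mat R *\<^sub>v x) (Suc i) =
      vec_index x 0 + (\<Sum>j<length R. (norm (R ! i - R ! j))\<^sup>2 * vec_index x (Suc j))"
proof -
  have *: "vec_index (Delta_mat R *\<^sub>v x) i = (\<Sum>j<Suc (length R). Delta_mat R $$ (i, j) * vec_index x j)"
    if "i < Suc (length R)" for i
    using that assms dim_Delta_mat[of R] by (auto simp: scalar_prod_def lessThan_atLeast0 intro!: sum.cong)
  show "vec_index (Delta_mat R *\<^sub>v x) 0 = (\<Sum>j<length R. vec_index x (Suc j))"
    by (subst *) (auto simp: sum.lessThan_Suc_shift Delta_mat_index simp del: sum.lessThan_Suc)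
  show "vec_index (Delta_mat R *\<^sub>v x) (Suc i) =
      vec_index x 0 + (\<Sum>j<length R. (norm (R ! i - R ! j))\<^sup>2 * vec_index x (Suc j))" if "i < length R"
    using that by (subst *) (auto simp: sum.lessThan_Suc_shift Delta_mat_index simp del: sum.lessThan_Suc)
qed

text \<open>Leibniz's identity for the barycentre \<open>c\<close>.\<close>

lemma weighted_square_distances:
  fixes p :: "'i \<Rightarrow> 'a::real_inner"
  assumes "sum l I = 1" "c = (\<Sum>j\<in>I. l j *\<^sub>R p j)"
  shows "(\<Sum>j\<in>I. (norm (a - p j))\<^sup>2 * l j) = (norm (a - c))\<^sup>2 + (\<Sum>j\<in>I. (norm (p j - c))\<^sup>2 * l j)"
proof -
  have cosine: "(norm (a - p j))\<^sup>2 = (norm (a - c))\<^sup>2 + (norm (p j - c))\<^sup>2 - 2 * ((a - c) \<bullet> (p j - c))" for j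
  proof -
    have "(norm (u - v))\<^sup>2 = (norm u)\<^sup>2 + (norm v)\<^sup>2 - 2 * (u \<bullet> v)" for u v :: 'a
      unfolding power2_norm_eq_inner by (simp add: inner_diff_left inner_diff_right inner_commute)
    from this[of "a - c" "p j - c"] show ?thesis by simp
  qed
  have "(\<Sum>j\<in>I. (norm (a - p j))\<^sup>2 * l j) =
      (\<Sum>j\<in>I. (norm (a - c))\<^sup>2 * l j + (norm (p j - c))\<^sup>2 * l j - 2 * ((a - c) \<bullet> (l j *\<^sub>R (p j - c))))"
    unfolding cosine by (intro sum.cong refl) (simp add: left_diff_distrib distrib_right)
  also have "\<dots> = (norm (a - c))\<^sup>2 * sum l I + (\<Sum>j\<in>I. (norm (p j - c))\<^sup>2 * l j)
      - 2 * ((a - c) \<bullet> (\<Sum>j\<in>I. l j *\<^sub>R (p j - c)))"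
    by (simp add: sum.distrib sum_subtractf sum_distrib_left inner_sum_right)
  also have "(\<Sum>j\<in>I. l j *\<^sub>R (p j - c)) = c - sum l I *\<^sub>R c"
    using assms(2) by (simp add: scaleR_diff_right sum_subtractf scaleR_left.sum)
  finally show ?thesis using assms(1) by simp
qed

text \<open>
  By Leibniz's identity, the vector \<open>x = (-2 r\<^sup>2, l)\<close> with the barycentric coordinates \<open>l\<close> of the
  circumcentre solves \<open>\<Delta> x = (1, 0, \<dots>, 0)\<close>. Cramer's rule for its first entry has \<open>det \<Lambda>\<close> as numerator.
\<close>

lemma det_Lambda_eq_circumradius:
  fixes R :: "(real^'d) list"
  assumes l: "(\<Sum>i<length R. l i) = 1" and c: "c = (\<Sum>i<length R. l i *\<^sub>R R ! i)"
    and r: "\<And>i. i < length R \<Longrightarrow> norm (R ! i - c) = r"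
  shows "Determinant.det (Lambda_mat R) = - 2 * r\<^sup>2 * Determinant.det (Delta_mat R)"
proof -
  let ?k = "length R"
  define x where "x = vec (Suc ?k) (\<lambda>i. if i = 0 then - 2 * r\<^sup>2 else l (i - 1))"
  have x: "x \<in> carrier_vec (Suc ?k)" by (simp add: x_def)
  have x0: "vec_index x 0 = - 2 * r\<^sup>2" by (simp add: x_def)
  have xS: "vec_index x (Suc j) = l j" if "j < ?k" for j using that by (simp add: x_def)
  have r2: "(\<Sum>j<?k. (norm (R ! j - c))\<^sup>2 * l j) = r\<^sup>2"
  proof -
    have "(\<Sum>j<?k. (norm (R ! j - c))\<^sup>2 * l j) = (\<Sum>j<?k. r\<^sup>2 * l j)" using r by (intro sum.cong) auto
    then show ?thesis using l by (simp flip: sum_distrib_left)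
  qed
  have e: "Delta_mat R *\<^sub>v x = unit_vec (Suc ?k) 0"
  proof (rule eq_vecI)
    show "dim_vec (Delta_mat R *\<^sub>v x) = dim_vec (unit_vec (Suc ?k) 0)" using dim_Delta_mat[of R] by simp
    fix i assume "i < dim_vec (unit_vec (Suc ?k) 0 :: real vec)"
    then consider "i = 0" | i' where "i = Suc i'" "i' < ?k" by (cases i) auto
    then show "vec_index (Delta_mat R *\<^sub>v x) i = vec_index (unit_vec (Suc ?k) 0) i"
    proof cases
      case 1
      then show ?thesis using l by (simp add: Delta_mat_mult_vec(1)[OF x] xS)
    next
      case 2
      have "(\<Sum>j<?k. (norm (R ! i' - R ! j))\<^sup>2 * l j) = 2 * r\<^sup>2"
        using weighted_square_distances[OF l c, of "R ! i'"] r[OF 2(2)] r2 by simp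
      then show ?thesis using 2 by (simp add: Delta_mat_mult_vec(2)[OF x] x0 xS)
    qed
  qed
  have "replace_col (Delta_mat R) (unit_vec (Suc ?k) 0) 0 =
      four_block_mat (1\<^sub>m 1) (Matrix.mat 1 ?k (\<lambda>_. 1)) (0\<^sub>m ?k 1) (Lambda_mat R)"
    by (rule eq_matI) (auto simp: replace_col_def Delta_mat_def Lambda_mat_def)
  moreover have "Determinant.det (four_block_mat (1\<^sub>m 1) (Matrix.mat 1 ?k (\<lambda>_. 1)) (0\<^sub>m ?k 1) (Lambda_mat R)) =
      Determinant.det (1\<^sub>m 1 :: real mat) * Determinant.det (Lambda_mat R)"
    by (rule det_four_block_mat_lower_left_zero_col) (auto simp: Lambda_mat_def)
  moreover have "Determinant.det (replace_col (Delta_mat R) (Delta_mat R *\<^sub>v x) 0) =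
      vec_index x 0 * Determinant.det (Delta_mat R)"
    by (rule cramer_lemma_mat[OF dim_Delta_mat x]) simp
  ultimately show ?thesis unfolding e by (simp add: x_def)
qed

text \<open>
  Conversely, let \<open>x = (\<mu>, l)\<close> solve this system. Then \<open>l\<close> has sum \<open>1\<close>, and for its barycentre \<open>c\<close> the
  rows of the system say that all points have the same squared distance \<open>- \<mu> - V\<close> from \<open>c\<close>, where \<open>V\<close>
  is the weighted mean of these squared distances. Hence \<open>V = - \<mu> - V\<close>.
\<close>

lemma circumsphere_exists:
  fixes R :: "(real^'d) list"
  assumes det: "Determinant.det (Delta_mat R) \<noteq> 0"
  obtains c r where "\<And>i. i < length R \<Longrightarrow> norm (R ! i - c) = r"
    "Determinant.det (Lambda_mat R) = - 2 * r\<^sup>2 * Determinant.det (Delta_mat R)"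
proof -
  let ?k = "length R"
  define A where "A = adj_mat (Delta_mat R)"
  define x where "x = (1 / Determinant.det (Delta_mat R)) \<cdot>\<^sub>v (A *\<^sub>v unit_vec (Suc ?k) 0)"
  have A: "A \<in> carrier_mat (Suc ?k) (Suc ?k)" "Delta_mat R * A = Determinant.det (Delta_mat R) \<cdot>\<^sub>m 1\<^sub>m (Suc ?k)"
    using adj_mat[OF dim_Delta_mat[of R]] by (auto simp: A_def)
  have x: "x \<in> carrier_vec (Suc ?k)" using A by (simp add: x_def)
  have "Delta_mat R *\<^sub>v x = (1 / Determinant.det (Delta_mat R)) \<cdot>\<^sub>v (Delta_mat R *\<^sub>v (A *\<^sub>v unit_vec (Suc ?k) 0))"
    unfolding x_def using A(1) by (intro mult_mat_vec[OF dim_Delta_mat]) simp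
  also have "Delta_mat R *\<^sub>v (A *\<^sub>v unit_vec (Suc ?k) 0) = (Delta_mat R * A) *\<^sub>v unit_vec (Suc ?k) 0"
    by (rule assoc_mult_mat_vec[OF dim_Delta_mat A(1), symmetric]) simp
  also have "(1 / Determinant.det (Delta_mat R)) \<cdot>\<^sub>v \<dots> = unit_vec (Suc ?k) 0"
    unfolding A(2) using det by (auto intro!: eq_vecI simp: scalar_prod_right_unit)
  finally have e: "Delta_mat R *\<^sub>v x = unit_vec (Suc ?k) 0" .
  define l where "l j = vec_index x (Suc j)" for j
  define \<mu> where "\<mu> = vec_index x 0"
  have l: "(\<Sum>j<?k. l j) = 1"
    using Delta_mat_mult_vec(1)[OF x] unfolding e by (simp add: l_def)
  have rows: "\<mu> + (\<Sum>j<?k. (norm (R ! i - R ! j))\<^sup>2 * l j) = 0" if "i < ?k" for i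
    using Delta_mat_mult_vec(2)[OF x that] that unfolding e by (simp add: l_def \<mu>_def)
  define c where "c = (\<Sum>j<?k. l j *\<^sub>R R ! j)"
  define V where "V = (\<Sum>j<?k. (norm (R ! j - c))\<^sup>2 * l j)"
  have dist: "(norm (R ! i - c))\<^sup>2 = - \<mu> - V" if "i < ?k" for i
    using rows[OF that] weighted_square_distances[OF l c_def, of "R ! i"] by (simp add: V_def)
  have "V = (\<Sum>j<?k. (- \<mu> - V) * l j)" 
    by (subst V_def, intro sum.cong refl) (simp only: dist lessThan_iff)
  also have "\<dots> = - \<mu> - V" using l by (simp flip: sum_distrib_left)
  finally have V: "V = - \<mu> / 2" by simp
  have "norm (R ! i - c) = sqrt (- \<mu> / 2)" if "i < ?k" for i
    using dist[OF that] V by (intro real_sqrt_unique[symmetric]) auto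
  then show ?thesis by (intro that[of c "sqrt (- \<mu> / 2)"] det_Lambda_eq_circumradius[OF l c_def])
qed

text \<open>
  On vectors \<open>l\<close> with sum \<open>0\<close> the quadratic form of \<open>\<Lambda>\<close> is \<open>- 2 \<parallel>\<Sum>\<^sub>i l\<^sub>i r\<^sub>i\<parallel>\<^sup>2\<close>. It vanishes if \<open>l\<close> extends
  to a kernel vector of \<open>\<Delta>\<close>, so a kernel vector yields an affine dependence.
\<close>

lemma det_Delta_nonzero:
  fixes R :: "(real^'d) list"
  assumes ne: "R \<noteq> []"
    and aff: "\<And>l i. (\<Sum>i<length R. l i) = 0 \<Longrightarrow> (\<Sum>i<length R. l i *\<^sub>R R ! i) = 0 \<Longrightarrow> i < length R \<Longrightarrow> l i = 0"
  shows "Determinant.det (Delta_mat R) \<noteq> 0"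
proof
  let ?k = "length R"
  assume "Determinant.det (Delta_mat R) = 0"
  then obtain x where x: "x \<in> carrier_vec (Suc ?k)" "x \<noteq> 0\<^sub>v (Suc ?k)" "Delta_mat R *\<^sub>v x = 0\<^sub>v (Suc ?k)"
    using det_0_iff_vec_prod_zero[OF dim_Delta_mat[of R]] by blast
  define l where "l j = vec_index x (Suc j)" for j
  define \<mu> where "\<mu> = vec_index x 0"
  have l: "(\<Sum>j<?k. l j) = 0"
    using Delta_mat_mult_vec(1)[OF x(1)] unfolding x(3) by (simp add: l_def)
  have rows: "\<mu> + (\<Sum>j<?k. (norm (R ! i - R ! j))\<^sup>2 * l j) = 0" if "i < ?k" for i
    using Delta_mat_mult_vec(2)[OF x(1) that] that unfolding x(3) by (simp add: l_def \<mu>_def)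
  define w where "w = (\<Sum>j<?k. l j *\<^sub>R R ! j)"
  have expand: "(\<Sum>j<?k. (norm (a - R ! j))\<^sup>2 * l j) = (\<Sum>j<?k. (norm (R ! j))\<^sup>2 * l j) - 2 * (a \<bullet> w)" for a
  proof -
    have cosine: "(norm (u - v))\<^sup>2 = (norm u)\<^sup>2 + (norm v)\<^sup>2 - 2 * (u \<bullet> v)" for u v :: "real^'d"
      unfolding power2_norm_eq_inner by (simp add: inner_diff_left inner_diff_right inner_commute)
    have "(\<Sum>j<?k. (norm (a - R ! j))\<^sup>2 * l j) =
        (\<Sum>j<?k. (norm a)\<^sup>2 * l j + (norm (R ! j))\<^sup>2 * l j - 2 * (a \<bullet> (l j *\<^sub>R R ! j)))"
      unfolding cosine by (intro sum.cong refl) (simp add: left_diff_distrib distrib_right)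
    also have "\<dots> = (norm a)\<^sup>2 * (\<Sum>j<?k. l j) + (\<Sum>j<?k. (norm (R ! j))\<^sup>2 * l j) - 2 * (a \<bullet> w)"
      by (simp add: sum.distrib sum_subtractf sum_distrib_left inner_sum_right w_def)
    finally show ?thesis using l by simp
  qed
  define V where "V = (\<Sum>j<?k. (norm (R ! j))\<^sup>2 * l j)"
  have "(\<Sum>i<?k. (\<mu> + V - 2 * (R ! i \<bullet> w)) * l i) = 0"
  proof (rule sum.neutral, rule ballI)
    fix i assume "i \<in> {..<?k}"
    then have "\<mu> + V - 2 * (R ! i \<bullet> w) = 0"
      using rows[of i] expand[of "R ! i"] unfolding V_def[symmetric] by simp
    then show "(\<mu> + V - 2 * (R ! i \<bullet> w)) * l i = 0" by simp
  qed
  moreover have "(\<Sum>i<?k. (\<mu> + V - 2 * (R ! i \<bullet> w)) * l i) = (\<mu> + V) * (\<Sum>i<?k. l i) - 2 * (w \<bullet> w)"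
  proof -
    have "(\<Sum>i<?k. (\<mu> + V - 2 * (R ! i \<bullet> w)) * l i) = (\<Sum>i<?k. (\<mu> + V) * l i - 2 * ((l i *\<^sub>R R ! i) \<bullet> w))"
      by (intro sum.cong) (auto simp: algebra_simps)
    also have "\<dots> = (\<mu> + V) * (\<Sum>i<?k. l i) - 2 * ((\<Sum>i<?k. l i *\<^sub>R R ! i) \<bullet> w)"
      by (simp only: sum_subtractf sum_distrib_left inner_sum_left)
    finally show ?thesis unfolding w_def[symmetric] .
  qed
  ultimately have "w = 0" using l by simp
  then have l0: "l i = 0" if "i < ?k" for i using aff[OF l _ that] by (simp add: w_def)
  have "\<mu> = 0" using rows[of 0] ne l0 by simp
  have "x = 0\<^sub>v (Suc ?k)"
  proof (rule eq_vecI)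
    fix i assume "i < dim_vec (0\<^sub>v (Suc ?k) :: real vec)"
    then show "vec_index x i = vec_index (0\<^sub>v (Suc ?k)) i"
      using l0 \<open>\<mu> = 0\<close> by (cases i) (auto simp: l_def \<mu>_def)
  qed (use x(1) in simp)
  then show False using x(2) by simp
qed

abbreviation Lambda_det :: "'n set \<Rightarrow> real^'d^('n::{finite,linorder}) \<Rightarrow> real"
  where "Lambda_det \<sigma> P \<equiv> Determinant.det (Lambda_mat (subcloud \<sigma> P))"

abbreviation Delta_det :: "'n set \<Rightarrow> real^'d^('n::{finite,linorder}) \<Rightarrow> real"
  where "Delta_det \<sigma> P \<equiv> Determinant.det (Delta_mat (subcloud \<sigma> P))"

lemma length_subcloud [simp]: "length (subcloud \<sigma> P) = card \<sigma>"
  by (simp add: subcloud_def)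

lemma subcloud_nth: "k < card \<sigma> \<Longrightarrow> subcloud \<sigma> P ! k = P $ (sorted_list_of_set \<sigma> ! k)"
  by (simp add: subcloud_def)

lemma bij_betw_sorted_list_of_set:
  fixes \<sigma> :: "'n::{finite,linorder} set"
  shows "bij_betw ((!) (sorted_list_of_set \<sigma>)) {..<card \<sigma>} \<sigma>"
  by (rule bij_betw_nth) simp_all

lemma sum_sorted_list_of_set:
  fixes \<sigma> :: "'n::{finite,linorder} set"
  shows "(\<Sum>k<card \<sigma>. g (sorted_list_of_set \<sigma> ! k)) = (\<Sum>i\<in>\<sigma>. g i)"
  by (rule sum.reindex_bij_betw[OF bij_betw_sorted_list_of_set])

lemma Lambda_det_eq_circumradius:
  fixes P :: "real^'d^('n::{finite,linorder})"
  assumes u: "sum u \<sigma> = 1" and c: "c = (\<Sum>i\<in>\<sigma>. u i *\<^sub>R P $ i)"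
    and r: "\<And>i. i \<in> \<sigma> \<Longrightarrow> norm (P $ i - c) = r"
  shows "Lambda_det \<sigma> P = - 2 * r\<^sup>2 * Delta_det \<sigma> P"
proof (rule det_Lambda_eq_circumradius[where l = "\<lambda>k. u (sorted_list_of_set \<sigma> ! k)"])
  show "(\<Sum>k<length (subcloud \<sigma> P). u (sorted_list_of_set \<sigma> ! k)) = 1"
    using u by (simp add: sum_sorted_list_of_set)
  have "(\<Sum>k<card \<sigma>. u (sorted_list_of_set \<sigma> ! k) *\<^sub>R subcloud \<sigma> P ! k) =
      (\<Sum>k<card \<sigma>. u (sorted_list_of_set \<sigma> ! k) *\<^sub>R P $ (sorted_list_of_set \<sigma> ! k))"
    by (intro sum.cong) (simp_all add: subcloud_nth)
  then show "c = (\<Sum>k<length (subcloud \<sigma> P). u (sorted_list_of_set \<sigma> ! k) *\<^sub>R subcloud \<sigma> P ! k)"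
    using c sum_sorted_list_of_set[of "\<lambda>i. u i *\<^sub>R P $ i" \<sigma>] by simp
  fix k assume k: "k < length (subcloud \<sigma> P)"
  then have "sorted_list_of_set \<sigma> ! k \<in> \<sigma>"
    using bij_betwE[OF bij_betw_sorted_list_of_set, of \<sigma>] by simp
  then show "norm (subcloud \<sigma> P ! k - c) = r" using k r by (simp add: subcloud_nth)
qed

text \<open>
  The smallest enclosing ball of a minimal simplex is bounded by a circumsphere with centre in the
  convex hull.
\<close>

lemma minimal_simplex_Lambda_det:
  fixes P :: "real^'d^('n::{finite,linorder})"
  assumes P: "P \<in> point_clouds" and min: "minimal_simplex P \<sigma>" and card: "2 \<le> card \<sigma>"
  shows "Lambda_det \<sigma> P = - 2 * (enclosing_radius P \<sigma>)\<^sup>2 * Delta_det \<sigma> P"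
proof -
  obtain c where c: "c \<in> convex hull (($) P ` \<sigma>)" "\<And>i. i \<in> \<sigma> \<Longrightarrow> norm (P $ i - c) = enclosing_radius P \<sigma>"
    using minimal_simplex_sphere[OF min card] by blast
  have inj: "inj_on (($) P) \<sigma>" using P by (auto simp: inj_on_def point_clouds_def)
  obtain u where u: "sum u (($) P ` \<sigma>) = 1" "(\<Sum>x\<in>($) P ` \<sigma>. u x *\<^sub>R x) = c"
    using c(1) by (auto simp: convex_hull_finite)
  show ?thesis
  proof (rule Lambda_det_eq_circumradius)
    show "(\<Sum>i\<in>\<sigma>. u (P $ i)) = 1" using u(1) by (simp add: sum.reindex[OF inj])
    show "c = (\<Sum>i\<in>\<sigma>. u (P $ i) *\<^sub>R P $ i)" using u(2) by (simp add: sum.reindex[OF inj])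
  qed (rule c(2))
qed

text \<open>
  The circumcentre of an edge is its midpoint.
\<close>

lemma edge_Lambda_det:
  fixes P :: "real^'d^('n::{finite,linorder})"
  assumes "i \<noteq> j"
  shows "Lambda_det {i, j} P = - 2 * (norm (P $ i - P $ j) / 2)\<^sup>2 * Delta_det {i, j} P"
proof (rule Lambda_det_eq_circumradius[where u = "\<lambda>_. 1 / 2" and c = "(1 / 2) *\<^sub>R (P $ i + P $ j)"])
  have "P $ i - (1 / 2) *\<^sub>R (P $ i + P $ j) = (1 / 2) *\<^sub>R (P $ i - P $ j)"
    "P $ j - (1 / 2) *\<^sub>R (P $ i + P $ j) = (1 / 2) *\<^sub>R (P $ j - P $ i)"
    by (simp_all add: algebra_simps flip: scaleR_left_distrib)
  then show "norm (P $ k - (1 / 2) *\<^sub>R (P $ i + P $ j)) = norm (P $ i - P $ j) / 2" if "k \<in> {i, j}" for k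
    using that by (auto simp: norm_minus_commute)
qed (use assms in \<open>simp_all add: scaleR_right_distrib\<close>)

lemma Delta_det_nonzero_circumsphere:
  fixes P :: "real^'d^('n::{finite,linorder})"
  assumes "Delta_det \<sigma> P \<noteq> 0"
  obtains c r where "\<And>i. i \<in> \<sigma> \<Longrightarrow> norm (P $ i - c) = r" "Lambda_det \<sigma> P = - 2 * r\<^sup>2 * Delta_det \<sigma> P"
proof (rule circumsphere_exists[OF assms])
  fix c r assume *: "\<And>k. k < length (subcloud \<sigma> P) \<Longrightarrow> norm (subcloud \<sigma> P ! k - c) = r"
    and **: "Lambda_det \<sigma> P = - 2 * r\<^sup>2 * Delta_det \<sigma> P"
  have "norm (P $ i - c) = r" if i: "i \<in> \<sigma>" for i
  proof -
    have "i \<in> (!) (sorted_list_of_set \<sigma>) ` {..<card \<sigma>}"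
      using i bij_betw_imp_surj_on[OF bij_betw_sorted_list_of_set, of \<sigma>] by simp
    then obtain k where "k < card \<sigma>" "i = sorted_list_of_set \<sigma> ! k" by auto
    then show ?thesis using *[of k] by (simp add: subcloud_nth)
  qed
  then show thesis using ** by (rule that)
qed

section \<open>Generic clouds\<close>

text \<open>
  The origin together with different unit vectors is affinely independent.
\<close>

lemma Delta_det_not_identically_zero:
  fixes \<sigma> :: "'n::{finite,linorder} set"
  assumes "\<sigma> \<noteq> {}" "card \<sigma> \<le> CARD('d::finite) + 1"
  obtains P :: "real^'d^('n::{finite,linorder})" where "Delta_det \<sigma> P \<noteq> 0"
proof -
  obtain v where v: "v \<in> \<sigma>" using assms(1) by blast
  have "card (\<sigma> - {v}) \<le> card (UNIV :: 'd set)" using v assms(2) by simp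
  then obtain h :: "'n::{finite,linorder} \<Rightarrow> 'd" where h: "inj_on h (\<sigma> - {v})"
    using card_le_inj[of "\<sigma> - {v}" "UNIV :: 'd set"] by auto
  define P :: "real^'d^('n::{finite,linorder})" where "P = (\<chi> i. if i = v then 0 else axis (h i) 1)"
  have "Delta_det \<sigma> P \<noteq> 0"
  proof (rule det_Delta_nonzero)
    show "subcloud \<sigma> P \<noteq> []" using v by (metis card_0_eq empty_iff finite length_subcloud list.size(3))
    fix l k assume l: "(\<Sum>i<length (subcloud \<sigma> P). l i) = 0"
      "(\<Sum>i<length (subcloud \<sigma> P). l i *\<^sub>R subcloud \<sigma> P ! i) = 0" and k: "k < length (subcloud \<sigma> P)"
    define xs where "xs = sorted_list_of_set \<sigma>"
    have bij: "bij_betw ((!) xs) {..<card \<sigma>} \<sigma>" unfolding xs_def by (rule bij_betw_sorted_list_of_set)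
    define u where "u i = l (inv_into {..<card \<sigma>} ((!) xs) i)" for i
    have lu: "l k = u (xs ! k)" if "k < card \<sigma>" for k
      using that bij by (simp add: u_def bij_betw_def)
    have "sum u \<sigma> = (\<Sum>i<card \<sigma>. u (xs ! i))" unfolding xs_def by (rule sum_sorted_list_of_set[symmetric])
    also have "\<dots> = (\<Sum>i<card \<sigma>. l i)" using lu by (intro sum.cong) simp_all
    finally have u1: "sum u \<sigma> = 0" using l(1) by simp
    have "(\<Sum>i\<in>\<sigma>. u i *\<^sub>R P $ i) = (\<Sum>i<card \<sigma>. u (xs ! i) *\<^sub>R P $ (xs ! i))"
      unfolding xs_def by (rule sum_sorted_list_of_set[symmetric])
    also have "\<dots> = (\<Sum>i<card \<sigma>. l i *\<^sub>R subcloud \<sigma> P ! i)"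
      using lu by (intro sum.cong) (simp_all add: subcloud_nth xs_def)
    finally have u2: "(\<Sum>i\<in>\<sigma>. u i *\<^sub>R P $ i) = 0" using l(2) by simp
    have u0: "u j = 0" if j: "j \<in> \<sigma> - {v}" for j
    proof -
      have "0 = (\<Sum>i\<in>\<sigma>. u i *\<^sub>R P $ i) $ h j" using u2 by simp
      also have "\<dots> = (\<Sum>i\<in>\<sigma>. if i = j then u i else 0)"
        unfolding sum_component
      proof (rule sum.cong[OF refl])
        fix i assume "i \<in> \<sigma>"
        then show "(u i *\<^sub>R P $ i) $ h j = (if i = j then u i else 0)"
          using j h by (auto simp: P_def axis_def inj_on_def)
      qed
      also have "\<dots> = u j" using j by simp
      finally show ?thesis by simp
    qed
    have "sum u \<sigma> = u v + sum u (\<sigma> - {v})" using v by (intro sum.remove) simp_all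
    then have "u v = 0" using u1 u0 by simp
    then have "u i = 0" if "i \<in> \<sigma>" for i using u0 that by (cases "i = v") simp_all
    then show "l k = 0" using lu[of k] k bij_betwE[OF bij, rule_format, of k] by simp
  qed
  then show ?thesis by (rule that)
qed

lemma finite_roots_real_polynomial_function:
  fixes p :: "real \<Rightarrow> real" and s :: real
  assumes "real_polynomial_function p" "p s \<noteq> 0"
  shows "finite {t. p t = 0}"
proof -
  obtain a n where p: "p = (\<lambda>x. \<Sum>i\<le>n. a i * x^i)"
    using assms(1) real_polynomial_function_iff_sum by blast
  have "\<exists>i\<le>n. a i \<noteq> 0"
  proof (rule ccontr)
    assume "\<not> ?thesis"
    then have "p s = 0" unfolding p by (intro sum.neutral) auto
    then show False using assms(2) by simp
  qed
  then show ?thesis unfolding p by (simp add: polyfun_finite_roots)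
qed

lemma real_polynomial_function_line:
  fixes f :: "'a::euclidean_space \<Rightarrow> real"
  assumes "real_polynomial_function f"
  shows "real_polynomial_function (\<lambda>t. f (x + t *\<^sub>R y))"
proof -
  have "polynomial_function (\<lambda>t::real. x + t *\<^sub>R y)"
    by (intro polynomial_function_add polynomial_function_const polynomial_function_bounded_linear bounded_linear_scaleR_left)
  from real_polynomial_function_compose[OF this assms] show ?thesis by (simp add: o_def)
qed

text \<open>
  On the line through \<open>x\<close> and \<open>y\<close> both factors are nonzero polynomials in one variable, with finitely
  many roots.
\<close>

lemma real_polynomial_function_mult_nonzero:
  fixes f g :: "'a::euclidean_space \<Rightarrow> real"
  assumes "real_polynomial_function f" "real_polynomial_function g" "f x \<noteq> 0" "g y \<noteq> 0"
  obtains z where "f z * g z \<noteq> 0"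
proof -
  let ?p = "\<lambda>t. f (x + t *\<^sub>R (y - x))" and ?q = "\<lambda>t. g (x + t *\<^sub>R (y - x))"
  have "finite {t. ?p t = 0}"
    by (rule finite_roots_real_polynomial_function[OF real_polynomial_function_line[OF assms(1)], where s = 0])
      (use assms(3) in simp)
  moreover have "finite {t. ?q t = 0}"
    by (rule finite_roots_real_polynomial_function[OF real_polynomial_function_line[OF assms(2)], where s = 1])
      (use assms(4) in simp)
  ultimately have "finite ({t. ?p t = 0} \<union> {t. ?q t = 0})" by simp
  then obtain t where "t \<notin> {t. ?p t = 0} \<union> {t. ?q t = 0}"
    using ex_new_if_finite[OF infinite_UNIV_char_0] by blast
  then show ?thesis using that[of "x + t *\<^sub>R (y - x)"] by simp
qed

lemma real_polynomial_function_prod_nonzero: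
  fixes f :: "'i \<Rightarrow> 'a::euclidean_space \<Rightarrow> real"
  assumes "finite I" "\<And>i. i \<in> I \<Longrightarrow> real_polynomial_function (f i)" "\<And>i. i \<in> I \<Longrightarrow> \<exists>x. f i x \<noteq> 0"
  shows "\<exists>x. (\<Prod>i\<in>I. f i x) \<noteq> 0"
  using assms
proof (induction I rule: finite_induct)
  case (insert i I)
  obtain x y where xy: "f i x \<noteq> 0" "(\<Prod>i\<in>I. f i y) \<noteq> 0" using insert by (meson insertCI)
  have prod: "real_polynomial_function (\<lambda>x. \<Prod>i\<in>I. f i x)"
    using insert by (intro real_polynomial_function_prod) simp_all
  obtain z where "f i z * (\<Prod>i\<in>I. f i z) \<noteq> 0"
  proof (rule real_polynomial_function_mult_nonzero[of "f i" "\<lambda>x. \<Prod>i\<in>I. f i x" x y])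
    show "real_polynomial_function (f i)" using insert by simp
  qed (use xy prod in blast)+
  then show ?case using insert by (intro exI[of _ z]) simp
qed simp

lemma real_polynomial_function_det:
  fixes M :: "'a::euclidean_space \<Rightarrow> real mat"
  assumes "\<And>x. M x \<in> carrier_mat n n"
    and "\<And>i j. i < n \<Longrightarrow> j < n \<Longrightarrow> real_polynomial_function (\<lambda>x. M x $$ (i, j))"
  shows "real_polynomial_function (\<lambda>x. Determinant.det (M x))"
proof -
  have "real_polynomial_function (\<lambda>x. \<Sum>p\<in>{p. p permutes {0..<n}}. signof p * (\<Prod>i = 0..<n. M x $$ (i, p i)))"
  proof (intro real_polynomial_function_sum real_polynomial_function.intros(4) real_polynomial_function.intros(2)
      real_polynomial_function_prod)
    fix p i assume "p \<in> {p. p permutes {0..<n}}" "i \<in> {0..<n}"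
    then have "i < n" "p i < n" using permutes_in_image[of p "{0..<n}" i] by simp_all
    then show "real_polynomial_function (\<lambda>x. M x $$ (i, p i))" by (rule assms(2))
  qed (simp_all add: finite_permutations)
  then show ?thesis by (simp only: det_def'[OF assms(1)])
qed

lemma real_polynomial_function_dist2:
  "real_polynomial_function (\<lambda>P :: real^'d^('n::{finite,linorder}). (norm (P $ i - P $ j))\<^sup>2)"
proof -
  have "bounded_linear (\<lambda>P :: real^'d^('n::{finite,linorder}). P $ i $ k)" for i k
    by (rule bounded_linear_compose[OF bounded_linear_vec_nth bounded_linear_vec_nth])
  then have "real_polynomial_function (\<lambda>P :: real^'d^('n::{finite,linorder}). \<Sum>k\<in>UNIV. (P $ i $ k - P $ j $ k)\<^sup>2)"
    by (intro real_polynomial_function_sum real_polynomial_function_power real_polynomial_function_diff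
        real_polynomial_function.intros(1)) simp_all
  moreover have "(norm (P $ i - P $ j))\<^sup>2 = (\<Sum>k\<in>UNIV. (P $ i $ k - P $ j $ k)\<^sup>2)" for P :: "real^'d^('n::{finite,linorder})"
    unfolding power2_norm_eq_inner inner_vec_def by (simp add: power2_eq_square)
  ultimately show ?thesis by simp
qed

lemma
  fixes \<sigma> :: "'n::{finite,linorder} set"
  shows real_polynomial_function_Lambda_det: "real_polynomial_function (Lambda_det \<sigma> :: real^'d^('n::{finite,linorder}) \<Rightarrow> real)"
    and real_polynomial_function_Delta_det: "real_polynomial_function (Delta_det \<sigma> :: real^'d^('n::{finite,linorder}) \<Rightarrow> real)"
proof -
  show "real_polynomial_function (Lambda_det \<sigma> :: real^'d^('n::{finite,linorder}) \<Rightarrow> real)"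
    by (rule real_polynomial_function_det[where n = "card \<sigma>"])
      (auto simp: Lambda_mat_def subcloud_nth intro!: real_polynomial_function_dist2)
  show "real_polynomial_function (Delta_det \<sigma> :: real^'d^('n::{finite,linorder}) \<Rightarrow> real)"
  proof (rule real_polynomial_function_det[where n = "Suc (card \<sigma>)"])
    show "Delta_mat (subcloud \<sigma> P) \<in> carrier_mat (Suc (card \<sigma>)) (Suc (card \<sigma>))" for P :: "real^'d^('n::{finite,linorder})"
      using dim_Delta_mat[of "subcloud \<sigma> P"] by simp
    fix i j assume ij: "i < Suc (card \<sigma>)" "j < Suc (card \<sigma>)"
    show "real_polynomial_function (\<lambda>P :: real^'d^('n::{finite,linorder}). Delta_mat (subcloud \<sigma> P) $$ (i, j))"
    proof (cases "i = 0 \<or> j = 0")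
      case True
      then have "(\<lambda>P :: real^'d^('n::{finite,linorder}). Delta_mat (subcloud \<sigma> P) $$ (i, j)) = (\<lambda>_. if i = 0 \<and> j = 0 then 0 else 1)"
        using ij by (intro ext) (auto simp: Delta_mat_index)
      then show ?thesis by (simp only: real_polynomial_function.intros(2))
    next
      case False
      then have "(\<lambda>P :: real^'d^('n::{finite,linorder}). Delta_mat (subcloud \<sigma> P) $$ (i, j)) =
          (\<lambda>P. (norm (P $ (sorted_list_of_set \<sigma> ! (i - 1)) - P $ (sorted_list_of_set \<sigma> ! (j - 1))))\<^sup>2)"
        using ij by (intro ext) (auto simp: Delta_mat_index subcloud_nth)
      then show ?thesis by (simp only: real_polynomial_function_dist2)
    qed
  qed
qed

text \<open>
  If both simplices have a circumsphere and nonzero \<open>det \<Delta>\<close>, this vanishes exactly when the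
  circumradii agree.
\<close>

definition radius_discriminant :: "'n set \<Rightarrow> 'n set \<Rightarrow> real^'d^('n::{finite,linorder}) \<Rightarrow> real" where
  "radius_discriminant \<sigma> \<tau> P = Lambda_det \<sigma> P * Delta_det \<tau> P - Lambda_det \<tau> P * Delta_det \<sigma> P"

lemma real_polynomial_function_radius_discriminant: "real_polynomial_function (radius_discriminant \<sigma> \<tau>)"
  unfolding radius_discriminant_def
  by (intro real_polynomial_function_diff real_polynomial_function.intros(4)
      real_polynomial_function_Lambda_det real_polynomial_function_Delta_det)

text \<open>
  Move a vertex \<open>v\<close> of one simplex that is not a vertex of the other one along a line. If the
  discriminant vanished identically, the circumradius of the first simplex would be the constant
  circumradius of the second one whenever \<open>det \<Delta>\<close> is nonzero, that is, for all but finitely many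
  positions. But it is at least half the distance of \<open>v\<close> from another vertex, which is unbounded.
\<close>

lemma radius_discriminant_not_identically_zero:
  fixes \<sigma> \<tau> :: "'n::{finite,linorder} set"
  assumes \<sigma>: "2 \<le> card \<sigma>" "card \<sigma> \<le> CARD('d::finite) + 1" and \<tau>: "2 \<le> card \<tau>" "card \<tau> \<le> CARD('d) + 1"
    and ne: "\<sigma> \<noteq> \<tau>"
  shows "\<exists>P :: real^'d^('n::{finite,linorder}). radius_discriminant \<sigma> \<tau> P \<noteq> 0"
proof -
  have main: "\<exists>P :: real^'d^('n::{finite,linorder}). radius_discriminant \<sigma> \<tau> P \<noteq> 0"
    if \<sigma>: "2 \<le> card \<sigma>" "card \<sigma> \<le> CARD('d::finite) + 1" and \<tau>: "2 \<le> card \<tau>" "card \<tau> \<le> CARD('d) + 1"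
      and v: "v \<in> \<sigma>" "v \<notin> \<tau>" for \<sigma> \<tau> :: "'n::{finite,linorder} set" and v
  proof (rule ccontr)
    assume "\<not> ?thesis"
    then have zero: "Lambda_det \<sigma> P * Delta_det \<tau> P = Lambda_det \<tau> P * Delta_det \<sigma> P" for P :: "real^'d^('n::{finite,linorder})"
      by (simp add: radius_discriminant_def)
    have "\<sigma> \<noteq> {}" "\<tau> \<noteq> {}" using \<sigma> \<tau> by auto
    obtain P1 P2 :: "real^'d^('n::{finite,linorder})" where P12: "Delta_det \<sigma> P1 \<noteq> 0" "Delta_det \<tau> P2 \<noteq> 0"
      using Delta_det_not_identically_zero[OF \<open>\<sigma> \<noteq> {}\<close> \<sigma>(2)] Delta_det_not_identically_zero[OF \<open>\<tau> \<noteq> {}\<close> \<tau>(2)]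
      by metis
    obtain P0 :: "real^'d^('n::{finite,linorder})" where "Delta_det \<sigma> P0 * Delta_det \<tau> P0 \<noteq> 0"
      using real_polynomial_function_mult_nonzero[OF real_polynomial_function_Delta_det real_polynomial_function_Delta_det P12]
      by blast
    then have P0: "Delta_det \<sigma> P0 \<noteq> 0" "Delta_det \<tau> P0 \<noteq> 0" by simp_all
    obtain w :: "real^'d" where w: "norm w = 1" using vector_choose_size[of 1] by auto
    define M :: "real^'d^('n::{finite,linorder})" where "M = axis v w"
    define Q where "Q t = P0 + t *\<^sub>R M" for t
    have Qv: "Q t $ v = P0 $ v + t *\<^sub>R w" and Qi: "i \<noteq> v \<Longrightarrow> Q t $ i = P0 $ i" for t i
      by (simp_all add: Q_def M_def axis_def)
    have sub: "subcloud \<tau> (Q t) = subcloud \<tau> P0" for t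
        unfolding subcloud_def by (rule map_cong[OF refl], rule Qi) (use v(2) in auto)
    define K where "K = \<bar>Lambda_det \<tau> P0 / (2 * Delta_det \<tau> P0)\<bar>"
    have bound: "\<bar>t\<bar> \<le> 2 * sqrt K + norm (P0 $ u - P0 $ v)"
      if nz: "Delta_det \<sigma> (Q t) \<noteq> 0" and u: "u \<in> \<sigma>" "u \<noteq> v" for t u
    proof -
      obtain c r where c: "\<And>i. i \<in> \<sigma> \<Longrightarrow> norm (Q t $ i - c) = r"
        and r: "Lambda_det \<sigma> (Q t) = - 2 * r\<^sup>2 * Delta_det \<sigma> (Q t)"
        using Delta_det_nonzero_circumsphere[OF nz] by blast
      have "- 2 * r\<^sup>2 * Delta_det \<tau> P0 = Lambda_det \<tau> P0"
      proof -
        have "(- 2 * r\<^sup>2 * Delta_det \<tau> P0) * Delta_det \<sigma> (Q t) = Lambda_det \<tau> P0 * Delta_det \<sigma> (Q t)"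
          using zero[of "Q t"] unfolding r sub by (simp add: algebra_simps)
        then show ?thesis by (rule mult_right_cancel[OF nz, THEN iffD1])
      qed
      then have "r\<^sup>2 = - Lambda_det \<tau> P0 / (2 * Delta_det \<tau> P0)" using P0(2) by (simp add: field_simps)
      then have "r\<^sup>2 \<le> K" unfolding K_def by (metis abs_ge_minus_self minus_divide_left)
      moreover have "0 \<le> r" using c[OF u(1)] by (metis norm_ge_zero)
      ultimately have "r \<le> sqrt K" by (simp add: real_le_rsqrt)
      have "\<bar>t\<bar> = norm (t *\<^sub>R w)" using w by simp
      also have "t *\<^sub>R w = (Q t $ v - c) - (Q t $ u - c) + (P0 $ u - P0 $ v)"
        using u(2) by (simp add: Qv Qi)
      also have "norm \<dots> \<le> norm (Q t $ v - c) + norm (Q t $ u - c) + norm (P0 $ u - P0 $ v)"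
        by (meson add_right_mono norm_triangle_ineq norm_triangle_ineq4 order_trans)
      also have "\<dots> = 2 * r + norm (P0 $ u - P0 $ v)" using c[OF v(1)] c[OF u(1)] by simp
      finally show ?thesis using \<open>r \<le> sqrt K\<close> by simp
    qed
    have "\<exists>u\<in>\<sigma>. u \<noteq> v"
    proof (rule ccontr)
      assume "\<not> ?thesis"
      then have "\<sigma> \<subseteq> {v}" by blast
      then have "card \<sigma> \<le> card {v}" by (intro card_mono) simp_all
      then show False using \<sigma>(1) by simp
    qed
    then obtain u where u: "u \<in> \<sigma>" "u \<noteq> v" by blast
    define B where "B = 2 * sqrt K + norm (P0 $ u - P0 $ v)"
    have "finite {t. Delta_det \<sigma> (P0 + t *\<^sub>R M) = 0}"
      by (rule finite_roots_real_polynomial_function[OF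
            real_polynomial_function_line[OF real_polynomial_function_Delta_det], where s = 0]) (use P0 in simp)
    then have "finite {t. Delta_det \<sigma> (Q t) = 0}" by (simp add: Q_def)
    then have "infinite ({max 0 B<..} - {t. Delta_det \<sigma> (Q t) = 0})"
      by (simp add: Diff_infinite_finite infinite_Ioi)
    then obtain t where "t > max 0 B" "Delta_det \<sigma> (Q t) \<noteq> 0"
      by (metis (mono_tags, lifting) DiffE finite.emptyI greaterThan_iff equals0I mem_Collect_eq)
    then show False using bound[of t u] u by (simp add: B_def)
  qed
  consider v where "v \<in> \<sigma>" "v \<notin> \<tau>" | v where "v \<in> \<tau>" "v \<notin> \<sigma>" using ne by blast
  then show ?thesis
  proof cases
    case 1 then show ?thesis using main[OF \<sigma> \<tau>] by blast
  next
    case 2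
    then obtain P :: "real^'d^('n::{finite,linorder})" where "radius_discriminant \<tau> \<sigma> P \<noteq> 0" using main[OF \<tau> \<sigma>] by blast
    then show ?thesis by (intro exI[of _ P]) (simp add: radius_discriminant_def)
  qed
qed

text \<open>
  The possible hyperedges in dimension \<open>d\<close>; the type argument carries \<open>d\<close>.
\<close>

definition small_simplices :: "'d::finite itself \<Rightarrow> 'n::finite set set" where
  "small_simplices _ = {\<sigma>. 2 \<le> card \<sigma> \<and> card \<sigma> \<le> CARD('d) + 1}"

definition genericity_polynomial :: "real^'d^('n::{finite,linorder}) \<Rightarrow> real" where
  "genericity_polynomial P =
    (\<Prod>\<sigma>\<in>small_simplices TYPE('d). Delta_det \<sigma> P) *
    (\<Prod>(\<sigma>, \<tau>)\<in>{(\<sigma>, \<tau>). \<sigma> \<in> small_simplices TYPE('d) \<and> \<tau> \<in> small_simplices TYPE('d) \<and> \<sigma> \<noteq> \<tau>}.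
      radius_discriminant \<sigma> \<tau> P)"

definition nongeneric_clouds :: "(real^'d^('n::{finite,linorder})) set" where
  "nongeneric_clouds = {P. genericity_polynomial P = 0}"

lemma genericity_polynomial_not_identically_zero:
  "real_polynomial_function (genericity_polynomial :: real^'d^('n::{finite,linorder}) \<Rightarrow> real)"
  "\<exists>P :: real^'d^('n::{finite,linorder}). genericity_polynomial P \<noteq> 0"
proof -
  let ?I = "small_simplices TYPE('d) :: 'n::{finite,linorder} set set"
  let ?J = "{(\<sigma>, \<tau>). \<sigma> \<in> ?I \<and> \<tau> \<in> ?I \<and> \<sigma> \<noteq> \<tau>}"
  let ?f = "\<lambda>P :: real^'d^('n::{finite,linorder}). \<Prod>\<sigma>\<in>?I. Delta_det \<sigma> P"
  let ?h = "\<lambda>(\<sigma>, \<tau>) (P :: real^'d^('n::{finite,linorder})). radius_discriminant \<sigma> \<tau> P"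
  let ?g = "\<lambda>P :: real^'d^('n::{finite,linorder}). \<Prod>p\<in>?J. ?h p P"
  have eq: "genericity_polynomial = (\<lambda>P. ?f P * ?g P)"
    by (intro ext) (simp add: genericity_polynomial_def split_beta)
  have hpoly: "real_polynomial_function (?h p)" for p
    using real_polynomial_function_radius_discriminant[of "fst p" "snd p"] by (simp add: split_beta)
  have f: "real_polynomial_function ?f"
    by (intro real_polynomial_function_prod real_polynomial_function_Delta_det) simp
  have g: "real_polynomial_function ?g"
    by (intro real_polynomial_function_prod hpoly) simp
  show "real_polynomial_function (genericity_polynomial :: real^'d^('n::{finite,linorder}) \<Rightarrow> real)"
    unfolding eq by (intro real_polynomial_function.intros(4) f g)
  have "\<exists>P. ?f P \<noteq> 0"
  proof (rule real_polynomial_function_prod_nonzero)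
    fix \<sigma> assume "\<sigma> \<in> ?I"
    then have "\<sigma> \<noteq> {}" "card \<sigma> \<le> CARD('d) + 1" by (auto simp: small_simplices_def)
    then obtain P :: "real^'d^('n::{finite,linorder})" where "Delta_det \<sigma> P \<noteq> 0"
      using Delta_det_not_identically_zero by blast
    then show "\<exists>P :: real^'d^('n::{finite,linorder}). Delta_det \<sigma> P \<noteq> 0" by blast
  qed (simp_all add: real_polynomial_function_Delta_det)
  then obtain P1 where P1: "?f P1 \<noteq> 0" by blast
  have "\<exists>P. ?g P \<noteq> 0"
  proof (rule real_polynomial_function_prod_nonzero)
    fix p assume "p \<in> ?J"
    then show "\<exists>P. ?h p P \<noteq> 0"
      using radius_discriminant_not_identically_zero[where ?'d = 'd, of "fst p" "snd p"]
      by (simp add: small_simplices_def split_beta)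
    show "real_polynomial_function (?h p)" by (rule hpoly)
  qed simp
  then obtain P2 where P2: "?g P2 \<noteq> 0" by blast
  obtain P where "?f P * ?g P \<noteq> 0" by (rule real_polynomial_function_mult_nonzero[OF f g P1 P2])
  then show "\<exists>P :: real^'d^('n::{finite,linorder}). genericity_polynomial P \<noteq> 0"
    unfolding eq by blast
qed

lemma generic_cloudD:
  fixes P :: "real^'d^('n::{finite,linorder})"
  assumes "P \<notin> nongeneric_clouds"
  shows "\<sigma> \<in> small_simplices TYPE('d) \<Longrightarrow> Delta_det \<sigma> P \<noteq> 0"
    and "\<sigma> \<in> small_simplices TYPE('d) \<Longrightarrow> \<tau> \<in> small_simplices TYPE('d) \<Longrightarrow> \<sigma> \<noteq> \<tau> \<Longrightarrow>
      radius_discriminant \<sigma> \<tau> P \<noteq> 0"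
  using assms by (auto simp: nongeneric_clouds_def genericity_polynomial_def)

lemma algebraic_nongeneric_clouds:
  "algebraic_set (nongeneric_clouds :: (real^'d^('n::{finite,linorder})) set)"
  "(nongeneric_clouds :: (real^'d^('n::{finite,linorder})) set) \<noteq> UNIV"
proof -
  show "algebraic_set (nongeneric_clouds :: (real^'d^('n::{finite,linorder})) set)"
    unfolding algebraic_set_def nongeneric_clouds_def
    by (intro exI[of _ "{genericity_polynomial}"]) (simp add: genericity_polynomial_not_identically_zero(1))
  show "(nongeneric_clouds :: (real^'d^('n::{finite,linorder})) set) \<noteq> UNIV"
    using genericity_polynomial_not_identically_zero(2)[where ?'d = 'd and ?'n = 'n]
    by (auto simp: nongeneric_clouds_def)
qed

section \<open>Clouds near a generic cloud\<close>

lemma minimal_simplex_small: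
  fixes P :: "real^'d^('n::finite)"
  assumes "P \<in> point_clouds" "minimal_simplex P \<sigma>" "2 \<le> card \<sigma>"
  shows "\<sigma> \<in> small_simplices TYPE('d)"
  using minimal_simplex_card_le[OF assms(1,2)] assms(3) by (simp add: small_simplices_def)

lemma radius_pos_iff_card:
  assumes "P \<in> point_clouds" "\<sigma> \<noteq> {}"
  shows "0 < enclosing_radius P \<sigma> \<longleftrightarrow> 2 \<le> card \<sigma>"
proof
  assume pos: "0 < enclosing_radius P \<sigma>"
  show "2 \<le> card \<sigma>"
  proof (rule ccontr)
    assume "\<not> 2 \<le> card \<sigma>"
    moreover have "0 < card \<sigma>" using assms(2) by (simp add: card_gt_0_iff)
    ultimately have "card \<sigma> = 1" by linarith
    then obtain i where "\<sigma> = {i}" by (rule card_1_singletonE)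
    then show False using pos by (simp add: enclosing_radius_singleton)
  qed
qed (rule enclosing_radius_pos[OF assms(1)])

lemma generic_equal_circumradius:
  fixes P :: "real^'d^('n::{finite,linorder})"
  assumes gen: "P \<notin> nongeneric_clouds" and small: "\<sigma> \<in> small_simplices TYPE('d)" "\<tau> \<in> small_simplices TYPE('d)"
    and "Lambda_det \<sigma> P = - 2 * r\<^sup>2 * Delta_det \<sigma> P" "Lambda_det \<tau> P = - 2 * r\<^sup>2 * Delta_det \<tau> P"
  shows "\<sigma> = \<tau>"
proof (rule ccontr)
  assume "\<sigma> \<noteq> \<tau>"
  then have "radius_discriminant \<sigma> \<tau> P \<noteq> 0" by (rule generic_cloudD(2)[OF gen small])
  then show False using assms(4,5) by (simp add: radius_discriminant_def)
qed

lemma isCont_imp_tendsto_nhds: "isCont f x \<Longrightarrow> (f \<longlongrightarrow> f x) (nhds x)"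
  unfolding isCont_def by (rule tendsto_at_iff_tendsto_nhds[THEN iffD1])

text \<open>
  Strict inequalities between radii persist by continuity. For equalities, let \<open>\<sigma>\<close> have positive
  radius, and let \<open>\<tau>\<close> be a minimal face of \<open>\<sigma>\<close> at \<open>P\<close> with the same radius. At a cloud \<open>Q\<close> near \<open>P\<close>, some minimal face \<open>\<tau>'\<close> has the radius of
  \<open>\<sigma>\<close>, and satisfies \<open>det \<Lambda> = -2 \<rho>\<^sup>2 det \<Delta>\<close> at \<open>Q\<close>. As this equation would fail near \<open>P\<close> if it failed
  at \<open>P\<close>, it holds at \<open>P\<close> too, where \<open>\<tau>\<close> and \<open>\<tau>'\<close> have the same radius because strict inequalities
  persist; genericity gives \<open>\<tau>' = \<tau>\<close>.
  So the radius of \<open>\<sigma>\<close> is that of \<open>\<tau>\<close> at all clouds near \<open>P\<close>. Two simplices with equal positive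
  radii at \<open>P\<close> have the same minimal face \<open>\<tau>\<close>, again by genericity, and keep equal radii. Radius \<open>0\<close>
  belongs to the single points, in every cloud.
\<close>

lemma eventually_same_radius_order:
  fixes P :: "real^'d^('n::{finite,linorder})"
  assumes P: "P \<in> point_clouds" and gen: "P \<notin> nongeneric_clouds"
  shows "\<forall>\<^sub>F Q in nhds P. Q \<in> point_clouds \<longrightarrow> same_radius_order P Q"
proof -
  have cont_radius: "isCont (\<lambda>Q :: real^'d^('n::{finite,linorder}). enclosing_radius Q \<sigma>) P" if "\<sigma> \<noteq> {}" for \<sigma>
    by (rule continuous_on_interior[OF continuous_enclosing_radius[OF that, of UNIV]]) simp
  have cont_poly: "isCont f P" if "real_polynomial_function f" for f :: "real^'d^('n::{finite,linorder}) \<Rightarrow> real"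
    using continuous_real_polymonial_function[OF that] .
  have "\<forall>\<^sub>F Q in nhds P. \<sigma> \<noteq> {} \<longrightarrow> \<tau> \<noteq> {} \<longrightarrow> enclosing_radius P \<sigma> < enclosing_radius P \<tau> \<longrightarrow>
      enclosing_radius Q \<sigma> < enclosing_radius Q \<tau>" for \<sigma> \<tau> :: "'n::{finite,linorder} set"
  proof (cases "\<sigma> \<noteq> {} \<and> \<tau> \<noteq> {} \<and> enclosing_radius P \<sigma> < enclosing_radius P \<tau>")
    case True
    have "isCont (\<lambda>Q. enclosing_radius Q \<tau> - enclosing_radius Q \<sigma>) P"
      using True by (intro continuous_intros cont_radius) simp_all
    then have "((\<lambda>Q. enclosing_radius Q \<tau> - enclosing_radius Q \<sigma>) \<longlongrightarrow> enclosing_radius P \<tau> - enclosing_radius P \<sigma>) (nhds P)"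
      by (rule isCont_imp_tendsto_nhds)
    then have "\<forall>\<^sub>F Q in nhds P. 0 < enclosing_radius Q \<tau> - enclosing_radius Q \<sigma>"
      by (rule order_tendstoD(1)) (use True in simp)
    then show ?thesis by eventually_elim simp
  qed (rule always_eventually, blast)
  then have E1: "\<forall>\<^sub>F Q in nhds P. \<forall>\<sigma> \<tau>. \<sigma> \<noteq> {} \<longrightarrow> \<tau> \<noteq> {} \<longrightarrow> enclosing_radius P \<sigma> < enclosing_radius P \<tau> \<longrightarrow>
      enclosing_radius Q \<sigma> < enclosing_radius Q \<tau>"
    by (intro eventually_all_finite)
  \<comment> \<open>The defect in the equation that holds at clouds where \<open>\<sigma>\<close> is minimal.\<close>
  define h where "h \<sigma> Q = Lambda_det \<sigma> Q + 2 * (enclosing_radius Q \<sigma>)\<^sup>2 * Delta_det \<sigma> Q"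
    for \<sigma> and Q :: "real^'d^('n::{finite,linorder})"
  have "\<forall>\<^sub>F Q in nhds P. \<sigma> \<noteq> {} \<longrightarrow> h \<sigma> P \<noteq> 0 \<longrightarrow> h \<sigma> Q \<noteq> 0" for \<sigma>
  proof (cases "\<sigma> \<noteq> {} \<and> h \<sigma> P \<noteq> 0")
    case True
    have "isCont (h \<sigma>) P"
      unfolding h_def using True
      by (intro continuous_intros cont_radius cont_poly real_polynomial_function_Lambda_det
          real_polynomial_function_Delta_det) simp
    then have "(h \<sigma> \<longlongrightarrow> h \<sigma> P) (nhds P)" by (rule isCont_imp_tendsto_nhds)
    then have "\<forall>\<^sub>F Q in nhds P. h \<sigma> Q \<noteq> 0" by (rule tendsto_imp_eventually_ne) (use True in simp)
    then show ?thesis by eventually_elim simp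
  qed (rule always_eventually, blast)
  then have E2: "\<forall>\<^sub>F Q in nhds P. \<forall>\<sigma>. \<sigma> \<noteq> {} \<longrightarrow> h \<sigma> P \<noteq> 0 \<longrightarrow> h \<sigma> Q \<noteq> 0"
    by (intro eventually_all_finite)
  have h0: "Lambda_det \<sigma> Q = - 2 * (enclosing_radius Q \<sigma>)\<^sup>2 * Delta_det \<sigma> Q \<longleftrightarrow> h \<sigma> Q = 0" for \<sigma> Q
    by (auto simp: h_def)
  show ?thesis
    using E1 E2
  proof eventually_elim
    fix Q :: "real^'d^('n::{finite,linorder})"
    assume E1: "\<forall>\<sigma> \<tau>. \<sigma> \<noteq> {} \<longrightarrow> \<tau> \<noteq> {} \<longrightarrow> enclosing_radius P \<sigma> < enclosing_radius P \<tau> \<longrightarrow>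
      enclosing_radius Q \<sigma> < enclosing_radius Q \<tau>"
    assume E2: "\<forall>\<sigma>. \<sigma> \<noteq> {} \<longrightarrow> h \<sigma> P \<noteq> 0 \<longrightarrow> h \<sigma> Q \<noteq> 0"
    show "Q \<in> point_clouds \<longrightarrow> same_radius_order P Q"
    proof
      assume Q: "Q \<in> point_clouds"
      have stable: "\<tau> \<subseteq> \<sigma> \<Longrightarrow> minimal_simplex P \<tau> \<Longrightarrow> enclosing_radius P \<tau> = enclosing_radius P \<sigma> \<Longrightarrow>
          enclosing_radius Q \<tau> = enclosing_radius Q \<sigma>"
        if \<sigma>: "2 \<le> card \<sigma>" for \<sigma> \<tau>
      proof -
        assume \<tau>: "minimal_simplex P \<tau>" "enclosing_radius P \<tau> = enclosing_radius P \<sigma>"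
        have \<sigma>ne: "\<sigma> \<noteq> {}" using \<sigma> by auto
        obtain \<tau>' where \<tau>': "\<tau>' \<subseteq> \<sigma>" "minimal_simplex Q \<tau>'" "enclosing_radius Q \<tau>' = enclosing_radius Q \<sigma>"
          using minimal_face[OF \<sigma>ne, of Q] by blast
        have ne: "\<tau> \<noteq> {}" "\<tau>' \<noteq> {}" using \<tau>(1) \<tau>'(2) by (simp_all add: minimal_simplex_def)
        have "\<not> enclosing_radius P \<tau>' < enclosing_radius P \<sigma>"
          using E1[rule_format, OF ne(2) \<sigma>ne] \<tau>'(3) by auto
        then have eq: "enclosing_radius P \<tau>' = enclosing_radius P \<sigma>"
          using enclosing_radius_mono[OF ne(2) \<tau>'(1), of P] by simp
        have "0 < enclosing_radius P \<sigma>" by (rule enclosing_radius_pos[OF P \<sigma>])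
        then have card: "2 \<le> card \<tau>" "2 \<le> card \<tau>'"
          using radius_pos_iff_card[OF P ne(1)] radius_pos_iff_card[OF P ne(2)] \<tau>(2) eq by simp_all
        have "h \<tau>' Q = 0" using minimal_simplex_Lambda_det[OF Q \<tau>'(2) card(2)] h0 by blast
        then have "h \<tau>' P = 0" using E2 ne(2) by blast
        then have "Lambda_det \<tau>' P = - 2 * (enclosing_radius P \<sigma>)\<^sup>2 * Delta_det \<tau>' P"
          using h0[of \<tau>' P] eq by simp
        moreover have "Lambda_det \<tau> P = - 2 * (enclosing_radius P \<sigma>)\<^sup>2 * Delta_det \<tau> P"
          using minimal_simplex_Lambda_det[OF P \<tau>(1) card(1)] \<tau>(2) by simp
        ultimately have "\<tau>' = \<tau>"
          by (rule generic_equal_circumradius[OF gen minimal_simplex_small[OF Q \<tau>'(2) card(2)]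
                minimal_simplex_small[OF P \<tau>(1) card(1)]])
        then show ?thesis using \<tau>'(3) by simp
      qed
      have eq: "enclosing_radius Q \<sigma> = enclosing_radius Q \<tau>"
        if ne: "\<sigma> \<noteq> {}" "\<tau> \<noteq> {}" and same: "enclosing_radius P \<sigma> = enclosing_radius P \<tau>" for \<sigma> \<tau>
      proof (cases "2 \<le> card \<sigma>")
        case True
        then have \<tau>card: "2 \<le> card \<tau>"
          using radius_pos_iff_card[OF P ne(1)] radius_pos_iff_card[OF P ne(2)] same by simp
        obtain \<sigma>' where \<sigma>': "\<sigma>' \<subseteq> \<sigma>" "minimal_simplex P \<sigma>'" "enclosing_radius P \<sigma>' = enclosing_radius P \<sigma>"
          using minimal_face[OF ne(1), of P] by blast
        obtain \<tau>' where \<tau>': "\<tau>' \<subseteq> \<tau>" "minimal_simplex P \<tau>'" "enclosing_radius P \<tau>' = enclosing_radius P \<tau>"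
          using minimal_face[OF ne(2), of P] by blast
        have ne': "\<sigma>' \<noteq> {}" "\<tau>' \<noteq> {}" using \<sigma>'(2) \<tau>'(2) by (simp_all add: minimal_simplex_def)
        have "0 < enclosing_radius P \<sigma>" by (rule enclosing_radius_pos[OF P True])
        then have card: "2 \<le> card \<sigma>'" "2 \<le> card \<tau>'"
          using radius_pos_iff_card[OF P ne'(1)] radius_pos_iff_card[OF P ne'(2)] \<sigma>'(3) \<tau>'(3) same by simp_all
        have "\<sigma>' = \<tau>'"
        proof (rule generic_equal_circumradius[OF gen minimal_simplex_small[OF P \<sigma>'(2) card(1)]
                minimal_simplex_small[OF P \<tau>'(2) card(2)]])
          show "Lambda_det \<sigma>' P = - 2 * (enclosing_radius P \<sigma>)\<^sup>2 * Delta_det \<sigma>' P"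
            using minimal_simplex_Lambda_det[OF P \<sigma>'(2) card(1)] \<sigma>'(3) by simp
          show "Lambda_det \<tau>' P = - 2 * (enclosing_radius P \<sigma>)\<^sup>2 * Delta_det \<tau>' P"
            using minimal_simplex_Lambda_det[OF P \<tau>'(2) card(2)] \<tau>'(3) same by simp
        qed
        then show ?thesis using stable[OF True \<sigma>'] stable[OF \<tau>card \<tau>'] by simp
      next
        case False
        then have "\<not> 2 \<le> card \<tau>"
          using radius_pos_iff_card[OF P ne(1)] radius_pos_iff_card[OF P ne(2)] same by simp
        then have "\<not> 0 < enclosing_radius Q \<sigma>" "\<not> 0 < enclosing_radius Q \<tau>"
          using False radius_pos_iff_card[OF Q ne(1)] radius_pos_iff_card[OF Q ne(2)] by simp_all
        then show ?thesis using enclosing_radius_nonneg[OF ne(1), of Q] enclosing_radius_nonneg[OF ne(2), of Q] by simp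
      qed
      show "same_radius_order P Q"
        unfolding same_radius_order_def
      proof (intro allI impI)
        fix \<sigma> \<tau> :: "'n::{finite,linorder} set" assume ne: "\<sigma> \<noteq> {}" "\<tau> \<noteq> {}"
        consider "enclosing_radius P \<sigma> < enclosing_radius P \<tau>" | "enclosing_radius P \<tau> < enclosing_radius P \<sigma>"
          | "enclosing_radius P \<sigma> = enclosing_radius P \<tau>" by linarith
        then show "enclosing_radius P \<sigma> \<le> enclosing_radius P \<tau> \<longleftrightarrow> enclosing_radius Q \<sigma> \<le> enclosing_radius Q \<tau>"
        proof cases
          case 1 then show ?thesis using E1[rule_format, OF ne] by simp
        next
          case 2 then show ?thesis using E1[rule_format, OF ne(2,1)] by simp
        next
          case 3 then show ?thesis using eq[OF ne] by simp
        qed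
      qed
    qed
  qed
qed

text \<open>
  Hyperedges are minimal at both clouds. So each determinant \<open>det \<Lambda>\<close> is \<open>-2 \<rho>\<^sup>2 det \<Delta>\<close>, and the common
  nonzero factor \<open>det \<Delta>(P) det \<Delta>(Q)\<close> cancels.
\<close>

lemma framework_equivalent_iff_radii:
  fixes P Q :: "real^'d^('n::{finite,linorder})"
  assumes clouds: "P \<in> point_clouds" "Q \<in> point_clouds" and order: "same_radius_order P Q"
    and E: "\<And>\<sigma>. \<sigma> \<in> E \<Longrightarrow> minimal_simplex P \<sigma> \<and> 2 \<le> card \<sigma> \<and> Delta_det \<sigma> P \<noteq> 0 \<and> Delta_det \<sigma> Q \<noteq> 0"
  shows "framework_equivalent E P Q \<longleftrightarrow> (\<forall>\<sigma>\<in>E. enclosing_radius Q \<sigma> = enclosing_radius P \<sigma>)"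
  unfolding framework_equivalent_def
proof (rule ball_cong[OF refl])
  fix \<sigma> assume \<sigma>E: "\<sigma> \<in> E"
  then have \<sigma>: "minimal_simplex P \<sigma>" "2 \<le> card \<sigma>" "Delta_det \<sigma> P \<noteq> 0" "Delta_det \<sigma> Q \<noteq> 0" using E by blast+
  have ne: "\<sigma> \<noteq> {}" using \<sigma>(1) by (simp add: minimal_simplex_def)
  have "enclosing_radius Q \<tau> < enclosing_radius Q \<sigma>" if "\<tau> \<noteq> {}" "\<tau> \<subset> \<sigma>" for \<tau>
    using same_radius_order_less[OF order that(1) ne] \<sigma>(1) that unfolding minimal_simplex_def by blast
  then have minQ: "minimal_simplex Q \<sigma>" using ne unfolding minimal_simplex_def by blast
  have "Delta_det \<sigma> P * Lambda_det \<sigma> Q = Delta_det \<sigma> Q * Lambda_det \<sigma> P \<longleftrightarrow>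
      (Delta_det \<sigma> P * Delta_det \<sigma> Q) * (enclosing_radius Q \<sigma>)\<^sup>2 = (Delta_det \<sigma> P * Delta_det \<sigma> Q) * (enclosing_radius P \<sigma>)\<^sup>2"
    unfolding minimal_simplex_Lambda_det[OF clouds(1) \<sigma>(1,2)] minimal_simplex_Lambda_det[OF clouds(2) minQ \<sigma>(2)]
    by (auto simp: algebra_simps)
  also have "\<dots> \<longleftrightarrow> (enclosing_radius Q \<sigma>)\<^sup>2 = (enclosing_radius P \<sigma>)\<^sup>2" using \<sigma>(3,4) by simp
  also have "\<dots> \<longleftrightarrow> enclosing_radius Q \<sigma> = enclosing_radius P \<sigma>"
    using enclosing_radius_nonneg[OF ne] by (intro power2_eq_iff_nonneg)
  finally show "Delta_det \<sigma> P * Lambda_det \<sigma> Q = Delta_det \<sigma> Q * Lambda_det \<sigma> P \<longleftrightarrow>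
      enclosing_radius Q \<sigma> = enclosing_radius P \<sigma>" .
qed

text \<open>
  The distance of two points is twice the circumradius of the edge between them.
\<close>

lemma generic_distances_distinct:
  fixes P :: "real^'d^('n::{finite,linorder})"
  assumes gen: "P \<notin> nongeneric_clouds" and ne: "i \<noteq> j" "k \<noteq> l"
    and eq: "norm (P $ i - P $ j) = norm (P $ k - P $ l)"
  shows "{i, j} = {k, l}"
proof (rule generic_equal_circumradius[OF gen])
  have "0 < CARD('d)" by simp
  then show "{i, j} \<in> small_simplices TYPE('d)" "{k, l} \<in> small_simplices TYPE('d)"
    using ne by (simp_all add: small_simplices_def Suc_le_eq)
  show "Lambda_det {i, j} P = - 2 * (norm (P $ i - P $ j) / 2)\<^sup>2 * Delta_det {i, j} P"
    by (rule edge_Lambda_det[OF ne(1)])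
  show "Lambda_det {k, l} P = - 2 * (norm (P $ i - P $ j) / 2)\<^sup>2 * Delta_det {k, l} P"
    unfolding eq by (rule edge_Lambda_det[OF ne(2)])
qed

text \<open>
  Near \<open>P\<close>, different distances in \<open>P\<close> stay different. So an isometry has to map each edge to
  itself, since the distances in \<open>P\<close> tell its edges apart.
\<close>

lemma eventually_isometric_iff_congruent:
  fixes P :: "real^'d^('n::{finite,linorder})"
  assumes gen: "P \<notin> nongeneric_clouds"
  shows "\<forall>\<^sub>F Q in nhds P. isometric_clouds P Q \<longleftrightarrow> congruent_clouds P Q"
proof -
  have "\<forall>\<^sub>F Q in nhds P. norm (P $ i - P $ j) \<noteq> norm (P $ k - P $ l) \<longrightarrow>
      norm (P $ i - P $ j) \<noteq> norm (Q $ k - Q $ l)" for i j k l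
  proof (cases "norm (P $ i - P $ j) = norm (P $ k - P $ l)")
    case False
    have "((\<lambda>Q. norm (Q $ k - Q $ l)) \<longlongrightarrow> norm (P $ k - P $ l)) (nhds P)"
      by (intro tendsto_intros filterlim_ident)
    then have "\<forall>\<^sub>F Q in nhds P. norm (Q $ k - Q $ l) \<noteq> norm (P $ i - P $ j)"
      by (rule tendsto_imp_eventually_ne) (use False in simp)
    then show ?thesis by eventually_elim simp
  qed simp
  then have "\<forall>\<^sub>F Q in nhds P. \<forall>i j k l. norm (P $ i - P $ j) \<noteq> norm (P $ k - P $ l) \<longrightarrow>
      norm (P $ i - P $ j) \<noteq> norm (Q $ k - Q $ l)"
    by (intro eventually_all_finite)
  then show ?thesis
  proof eventually_elim
    fix Q :: "real^'d^('n::{finite,linorder})"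
    assume near: "\<forall>i j k l. norm (P $ i - P $ j) \<noteq> norm (P $ k - P $ l) \<longrightarrow>
      norm (P $ i - P $ j) \<noteq> norm (Q $ k - Q $ l)"
    show "isometric_clouds P Q \<longleftrightarrow> congruent_clouds P Q"
    proof
      assume "congruent_clouds P Q"
      then show "isometric_clouds P Q"
        unfolding isometric_clouds_def congruent_clouds_def by (intro exI[of _ id]) simp
    next
      assume "isometric_clouds P Q"
      then obtain f where f: "bij f" "\<And>i j. norm (P $ i - P $ j) = norm (Q $ f i - Q $ f j)"
        unfolding isometric_clouds_def by blast
      show "congruent_clouds P Q"
        unfolding congruent_clouds_def
      proof (intro allI)
        fix i j
        show "norm (P $ i - P $ j) = norm (Q $ i - Q $ j)"
        proof (cases "i = j")
          case False
          then have "f i \<noteq> f j" using f(1) by (simp add: bij_def inj_eq)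
          moreover have "norm (P $ i - P $ j) = norm (P $ f i - P $ f j)" using near f(2) by blast
          ultimately have "{i, j} = {f i, f j}" using generic_distances_distinct[OF gen False] by blast
          then have "norm (Q $ f i - Q $ f j) = norm (Q $ i - Q $ j)"
            by (auto simp: doubleton_eq_iff norm_minus_commute)
          then show ?thesis using f(2)[of i j] by simp
        qed simp
      qed
    qed
  qed
qed

section \<open>Local identifiability and rigidity\<close>

text \<open>
  Both sides of the main equivalence have this form, so they can be compared on a common
  neighbourhood.
\<close>

lemma ex_openin_iff_eventually:
  assumes "P \<in> S"
  shows "(\<exists>U. openin (top_of_set S) U \<and> P \<in> U \<and> (\<forall>Q\<in>U. R Q)) \<longleftrightarrow> (\<forall>\<^sub>F Q in nhds P. Q \<in> S \<longrightarrow> R Q)"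
proof
  assume "\<exists>U. openin (top_of_set S) U \<and> P \<in> U \<and> (\<forall>Q\<in>U. R Q)"
  then obtain T where "open T" "P \<in> T" "\<forall>Q\<in>S \<inter> T. R Q" unfolding openin_open by blast
  then show "\<forall>\<^sub>F Q in nhds P. Q \<in> S \<longrightarrow> R Q" unfolding eventually_nhds by blast
next
  assume "\<forall>\<^sub>F Q in nhds P. Q \<in> S \<longrightarrow> R Q"
  then obtain T where "open T" "P \<in> T" "\<forall>Q\<in>T. Q \<in> S \<longrightarrow> R Q" unfolding eventually_nhds by blast
  then show "\<exists>U. openin (top_of_set S) U \<and> P \<in> U \<and> (\<forall>Q\<in>U. R Q)"
    using assms by (intro exI[of _ "S \<inter> T"]) (auto simp: openin_open)
qed

lemma generic_locally_identifiable_iff_rigid: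
  fixes P :: "real^'d^('n::{finite,linorder})"
  assumes P: "P \<in> point_clouds" and gen: "P \<notin> nongeneric_clouds"
  shows "locally_identifiable TYPE('f::field) P \<longleftrightarrow> rigid_framework (critical_hypergraph TYPE('f) P) P"
proof -
  let ?H = "critical_hypergraph TYPE('f) P"
  have H: "minimal_simplex P \<sigma> \<and> 2 \<le> card \<sigma>" if "\<sigma> \<in> ?H" for \<sigma>
    using that unfolding critical_hypergraph_def critical_simplex_def minimal_simplex_def by blast
  have small: "\<sigma> \<in> small_simplices TYPE('d)" if "\<sigma> \<in> ?H" for \<sigma>
    using minimal_simplex_small[OF P] H[OF that] by blast
  have framework: "circumsphere_framework ?H P"
    using P small unfolding circumsphere_framework_def small_simplices_def by blast
  have "\<forall>\<^sub>F Q in nhds P. \<sigma> \<in> ?H \<longrightarrow> Delta_det \<sigma> Q \<noteq> 0" for \<sigma>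
  proof (cases "\<sigma> \<in> ?H")
    case True
    have "isCont (Delta_det \<sigma>) P"
      by (rule continuous_real_polymonial_function[OF real_polynomial_function_Delta_det])
    then have "(Delta_det \<sigma> \<longlongrightarrow> Delta_det \<sigma> P) (nhds P)" by (rule isCont_imp_tendsto_nhds)
    then have "\<forall>\<^sub>F Q in nhds P. Delta_det \<sigma> Q \<noteq> 0"
      by (rule tendsto_imp_eventually_ne) (rule generic_cloudD(1)[OF gen small[OF True]])
    then show ?thesis by eventually_elim simp
  qed simp
  then have nonzero: "\<forall>\<^sub>F Q in nhds P. \<forall>\<sigma>. \<sigma> \<in> ?H \<longrightarrow> Delta_det \<sigma> Q \<noteq> 0" by (intro eventually_all_finite)
  have "\<forall>\<^sub>F Q in nhds P. Q \<in> point_clouds \<longrightarrow>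
      (PH TYPE('f) Q = PH TYPE('f) P \<longleftrightarrow> framework_equivalent ?H P Q) \<and>
      (isometric_clouds P Q \<longleftrightarrow> congruent_clouds P Q)"
    using eventually_same_radius_order[OF P gen] eventually_isometric_iff_congruent[OF gen] nonzero
  proof eventually_elim
    fix Q :: "real^'d^('n::{finite,linorder})"
    assume order: "Q \<in> point_clouds \<longrightarrow> same_radius_order P Q"
      and iso: "isometric_clouds P Q \<longleftrightarrow> congruent_clouds P Q"
      and nz: "\<forall>\<sigma>. \<sigma> \<in> ?H \<longrightarrow> Delta_det \<sigma> Q \<noteq> 0"
    show "Q \<in> point_clouds \<longrightarrow>
      (PH TYPE('f) Q = PH TYPE('f) P \<longleftrightarrow> framework_equivalent ?H P Q) \<and>
      (isometric_clouds P Q \<longleftrightarrow> congruent_clouds P Q)"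
    proof (intro impI conjI iso)
      assume Q: "Q \<in> point_clouds"
      then have ord: "same_radius_order P Q" using order by blast
      have "minimal_simplex P \<sigma> \<and> 2 \<le> card \<sigma> \<and> Delta_det \<sigma> P \<noteq> 0 \<and> Delta_det \<sigma> Q \<noteq> 0" if "\<sigma> \<in> ?H" for \<sigma>
        using H[OF that] generic_cloudD(1)[OF gen small[OF that]] nz that by blast
      from framework_equivalent_iff_radii[OF P Q ord this]
      show "PH TYPE('f) Q = PH TYPE('f) P \<longleftrightarrow> framework_equivalent ?H P Q"
        unfolding PH_eq_iff_critical_radii[OF ord] by simp
    qed
  qed
  note near = this
  have "(\<forall>\<^sub>F Q in nhds P. Q \<in> point_clouds \<longrightarrow> PH TYPE('f) Q = PH TYPE('f) P \<longrightarrow> isometric_clouds P Q) \<longleftrightarrow>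
      (\<forall>\<^sub>F Q in nhds P. Q \<in> point_clouds \<longrightarrow> framework_equivalent ?H P Q \<longrightarrow> congruent_clouds P Q)"
    by (rule eventually_subst, use near in eventually_elim) blast
  then show ?thesis
    unfolding locally_identifiable_def rigid_framework_def ex_openin_iff_eventually[OF P]
    using framework by simp
qed

theorem theorem4:
  shows "\<exists>A :: (real^'d^('n::{finite,linorder})) set. algebraic_set A \<and> A \<noteq> UNIV \<and>
    (\<forall>P \<in> point_clouds - A.
      locally_identifiable TYPE('f::field) P \<longleftrightarrow>
      rigid_framework (critical_hypergraph TYPE('f) P) P)"
proof (intro exI[of _ nongeneric_clouds] conjI ballI)
  fix P :: "real^'d^('n::{finite,linorder})"
  assume "P \<in> point_clouds - nongeneric_clouds"
  then show "locally_identifiable TYPE('f) P \<longleftrightarrow> rigid_framework (critical_hypergraph TYPE('f) P) P"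
    by (intro generic_locally_identifiable_iff_rigid) simp_all
qed (rule algebraic_nongeneric_clouds)+

end
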